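(* Let $p$ be an odd prime, $\eta$ trivial or $\left(\frac\cdot p\right)$, $\lambda\in\mathbb Z_p^\times$ a nonsquare mod $p$, $\delta\in\{1,\lambda\}$, $\ell\ge1$. (i) In the unramified cases ($\ell$ even or odd), for $w\in W^U_{\eta_\ell}$, $$\mathcal V_{2\ell-1,\delta}f_w=f_{\mathcal T_{\ell,\delta}w},$$ and consequently $\mathcal Y_{2\ell-1}f_w=(I+\mathcal V_{2\ell-1,1}+\mathcal V_{2\ell-1,\lambda})f_w=0$. (ii) In both ramified cases ($\ell$ even or odd), for $w\in W^U_{\eta_\ell}$, $$\mathcal V_{2\ell,\delta}f_{\phi_w}=f_{\mathcal T_{\ell+1,\delta}\phi_w},$$ and consequently $\mathcal Y_{2\ell}f_{\phi_w}=(I+\mathcal V_{2\ell,1}+\mathcal V_{2\ell,\lambda})f_{\phi_w}=0$.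
   Context: Cover. $G=\mathrm{SL}_2(\mathbb Q_p)$, $(\cdot,\cdot)_p$ the quadratic Hilbert symbol. For $A=\begin{pmatrix}a&b\\ c&d\end{pmatrix}$ put $\tau(A)=c$ if $c\ne0$, $\tau(A)=d$ if $c=0$; for $g\in G$, $s_p(g)=(c,d)_p$ if $cd\neq0$ and $\mathrm{ord}_p(c)$ odd, $s_p(g)=1$ otherwise; $c(g,h)=(\tau(gh)\tau(g),\tau(gh)\tau(h))_p\,s_p(g)s_p(h)s_p(gh)$. $\widetilde G=G\times\{\pm1\}$ with $(g,\epsilon_1)(h,\epsilon_2)=(gh,\epsilon_1\epsilon_2c(g,h))$; a tilde or bar over a subgroup denotes its full inverse image. $x(s)=\begin{pmatrix}1&s\\ 0&1\end{pmatrix}$, $y(s)=\begin{pmatrix}1&0\\ s&1\end{pmatrix}$, $h(t)=\mathrm{diag}(t,t^{-1})$, $w(t)=\begin{pmatrix}0&t\\ -t^{-1}&0\end{pmatrix}$, $\alpha=\mathrm{diag}(p,1)$, $K^0=\mathrm{SL}_2(\mathbb Z_p)$, $K^1=\alpha^{-1}K^0\alpha$, $K_r=K_0(p^r)\subset K^0$ (lower-left entry in $p^r\mathbb Z_p$), $N_r=x(p^r\mathbb Z_p)$. Splittings. $s^\delta:K^\delta\to\{\pm1\}$ ($\delta=0,1$) is the function such that $k\mapsto(k,s^\delta(k))$ is a homomorphism, with $s^0=1$ on $x(\mathbb Z_p),y(\mathbb Z_p),h(\mathbb Z_p^\times),w(1)$, and $s^1=1$ on $x(p^{-1}\mathbb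 Z_p),y(p\mathbb Z_p),w(p^{-1})$, $s^1(h(u))=\left(\frac up\right)$ for $u\in\mathbb Z_p^\times$. The genuine lift of a representation $\rho$ of $K^\delta$ is $\widetilde\rho((k,\epsilon))=\epsilon s^\delta(k)\rho(k)$. Data. $K_{\mathrm{GL}}=\mathrm{GL}_2(\mathbb Z_p)$; $I_{\mathrm{GL}}=\{\begin{pmatrix}a&b\\ c&d\end{pmatrix}\in K_{\mathrm{GL}}:c\in p\mathbb Z_p\}$; $Z$ the center of $\mathrm{GL}_2(\mathbb Q_p)$; $Z'$ the group generated by $\begin{pmatrix}0&1\\ p&0\end{pmatrix}$; $I=I_{\mathrm{GL}}\cap G$. An unramified (resp. ramified) very cuspidal datum of level $\ell$ is an irreducible smooth representation $\tau$ of $ZK_{\mathrm{GL}}$ (resp. $Z'I_{\mathrm{GL}}$) trivial on $1+p^\ell M_2(\mathbb Z_p)$ (resp. on $\{\begin{pmatrix}a&b\\ c&d\end{pmatrix}\in I_{\mathrm{GL}}:a,d\in1+p^\ell\mathbb Z_p,b\in p^\ell\mathbb Z_p,c\in p^{\ell+1}\mathbb Z_p\}$) with $\operatorname{Hom}_{N_{\ell-1}}(1,\tau)=0$. The four cases. $\eta_\ell=\eta$ for unramified with $\ell$ even; $\eta_\ell=\eta\cdot\left(\frac\cdot p\right)$ for unramified with $\ell$ odd and in the ramified case. Unramified: $(\rho,W)$ is an irreducible constituent of $\tau|_{K^0}$, $\tau$ unramified of level $\ell$; $W^U_{\eta_\ell}=\{w:\rho(h(u))w=\eta_\ell(u)w\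 \forall u\in\mathbb Z_p^\times\}$. If $\ell$ is even: $K=K^0$, $m=\ell/2$, $\widetilde\rho$ the genuine lift of $\rho$ via $s^0$. If $\ell$ is odd: $K=K^1$, $m=(\ell-1)/2$, $\widetilde\rho$ the genuine lift via $s^1$ of $\rho^\alpha(k)=\rho(\alpha k\alpha^{-1})$. Ramified: $(\sigma,W)$ is an irreducible constituent of $\tau|_I$, $\tau$ ramified of level $\ell$; $W^U_{\eta_\ell}=\{w:\sigma(h(u))w=\eta_\ell(u)w\ \forall u\}$. If $\ell$ is even: $\rho=\operatorname{Ind}_I^{K^1}\sigma$, $K=K^1$, $m=\ell/2$, $\widetilde\rho$ the genuine lift of $\rho$ via $s^1$. If $\ell$ is odd: $\rho=\operatorname{Ind}_I^{K^0}\sigma$, $K=K^1$, $m=(\ell-1)/2$, $\widetilde\rho$ the genuine lift via $s^1$ of $\rho^\alpha(k)=\rho(\alpha k\alpha^{-1})$. In the ramified cases $\phi_w\in\rho$ is $\phi_w(k)=\sigma(k)w$ for $k\in I$, $0$ for $k\notin I$. Vectors. $\widetilde\pi=\operatorname{c-Ind}_{\widetilde K}^{\widetilde G}\widetilde\rho$ (functions with $f(\tilde k\tilde g)=\widetilde\rho(\tilde k)f(\tilde g)$, right translation). For a vector $v$ of $\widetilde\rho$, $f_v((g,\epsilon))=c(k,h(p^m))\,\epsilon\,\widetilde\rho((k,1))v$ if $g=kh(p^m)$, $k\in K$, and $0$ if $g\notin Kh(p^m)$. $\eta$ defines the genuine character $\eta((\begin{pmatrix}a&b\\ c&d\end{pmatrix},\epsilon))=\epsilon\eta(d)$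 of $\overline{K_r}$; one has $f_w\in\widetilde\pi_\eta^{K_{2\ell}}$ (unramified) and $f_{\phi_w}\in\widetilde\pi_\eta^{K_{2\ell+1}}$ (ramified), where $\widetilde\pi_\eta^{K_r}$ is the space of $f$ with $\widetilde\pi(\tilde k)f=\eta(\tilde k)f$ for $\tilde k\in\overline{K_r}$. Operators. With $M=2\ell$ (unramified) or $M=2\ell+1$ (ramified), $\mathcal V_{M-1,\delta}$ is the function on $\widetilde G$ supported on $\overline{K_M}(y(\delta p^{M-1}),1)\overline{K_M}$, with value $1$ at $(y(\delta p^{M-1}),1)$ and $\mathcal V(\tilde k\tilde g\tilde k')=\overline\eta(\tilde k)\overline\eta(\tilde k')\mathcal V(\tilde g)$, acting on $\widetilde\pi_\eta^{K_M}$ by $\int\mathcal V(g)\widetilde\pi(g)v\,dg$ with $\mathrm{vol}(\overline{K_M})=1$, i.e. $[\mathcal V_{M-1,\delta}f](\tilde g)=\sum_{u\in\mathbb Z_p^\times/\sqrt{1+p\mathbb Z_p}}\eta(u)f(\tilde g(h(u),1)(y(\delta p^{M-1}),1))$, $\sqrt{1+p\mathbb Z_p}=\{\pm1\}(1+p\mathbb Z_p)$. The linear operators are $\mathcal T_{r,\delta}(v)=\sum_{u\in\mathbb Z_p^\times/\sqrt{1+p\mathbb Z_p}}\eta_\ell(u)^{-1}\rho\big(h(u)y(\delta p^{r-1})\big)v$, with $\rho$ the representation so named in the description of the four cases (before $\alpha$-conjugation); in (i) $r=\ell$, $v=w$, in (ii) $r=\ell+1$, $v=\phi_w$. *)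

theory Defs
  imports
    "HOL-Analysis.Analysis"
    "HOL-Algebra.Left_Coset"
    "HOL-Algebra.Generated_Groups"
    "HOL-Number_Theory.Residues"
    "HOL-Computational_Algebra.Fraction_Field"
    "HOL-Library.Function_Algebras"
    "Berlekamp_Zassenhaus.Finite_Field"
begin

section \<open>The field of p-adic numbers\<close>

text \<open>
  The prime is the cardinality of the index type \<open>'p\<close>; a free type variable of class
  \<open>prime_card\<close> ranges over all primes.  The ring of p-adic integers is the inverse limit of
  the rings of integers modulo the powers of the prime: an element is the sequence of its
  reduced residues.
\<close>

typedef (overloaded) 'p padic_int =
  "{x :: nat \<Rightarrow> int. \<forall>n. x n \<in> {0..<int CARD('p::prime_card) ^ n} \<and>
      x (Suc n) mod int CARD('p) ^ n = x n}"
  by (rule exI[of _ "\<lambda>_. 0"]) (auto simp: zero_less_card_finite)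

setup_lifting type_definition_padic_int

lemma card_prime_pos [simp]: "int CARD('p::prime_card) ^ n > 0"
  by (simp add: zero_less_card_finite)

lemma mod_Suc_mod: "(a mod int CARD('p::prime_card) ^ Suc n) mod int CARD('p) ^ n = a mod int CARD('p) ^ n"
  by (rule mod_mod_cancel) simp

instantiation padic_int :: (prime_card) comm_ring_1
begin

lift_definition zero_padic_int :: "'a padic_int" is "\<lambda>_. 0"
  by simp

lift_definition one_padic_int :: "'a padic_int" is "\<lambda>n. 1 mod int CARD('a) ^ n"
  using mod_Suc_mod[where 'p='a] by auto

lift_definition plus_padic_int :: "'a padic_int \<Rightarrow> 'a padic_int \<Rightarrow> 'a padic_int"
  is "\<lambda>x y n. (x n + y n) mod int CARD('a) ^ n"
proof (intro allI conjI)
  fix x y :: "nat \<Rightarrow> int" and n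
  assume x: "\<And>n. x n \<in> {0..<int CARD('a) ^ n} \<and> x (Suc n) mod int CARD('a) ^ n = x n"
    and y: "\<And>n. y n \<in> {0..<int CARD('a) ^ n} \<and> y (Suc n) mod int CARD('a) ^ n = y n"
  show "(x n + y n) mod int CARD('a) ^ n \<in> {0..<int CARD('a) ^ n}" by simp
  show "(x (Suc n) + y (Suc n)) mod int CARD('a) ^ Suc n mod int CARD('a) ^ n =
      (x n + y n) mod int CARD('a) ^ n"
    unfolding mod_Suc_mod using x y by (metis mod_add_eq)
qed

lift_definition uminus_padic_int :: "'a padic_int \<Rightarrow> 'a padic_int"
  is "\<lambda>x n. (- x n) mod int CARD('a) ^ n"
proof (intro allI conjI)
  fix x :: "nat \<Rightarrow> int" and n
  assume x: "\<And>n. x n \<in> {0..<int CARD('a) ^ n} \<and> x (Suc n) mod int CARD('a) ^ n = x n"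
  show "(- x n) mod int CARD('a) ^ n \<in> {0..<int CARD('a) ^ n}" by simp
  show "(- x (Suc n)) mod int CARD('a) ^ Suc n mod int CARD('a) ^ n =
      (- x n) mod int CARD('a) ^ n"
    unfolding mod_Suc_mod using x by (metis mod_minus_eq)
qed

lift_definition times_padic_int :: "'a padic_int \<Rightarrow> 'a padic_int \<Rightarrow> 'a padic_int"
  is "\<lambda>x y n. (x n * y n) mod int CARD('a) ^ n"
proof (intro allI conjI)
  fix x y :: "nat \<Rightarrow> int" and n
  assume x: "\<And>n. x n \<in> {0..<int CARD('a) ^ n} \<and> x (Suc n) mod int CARD('a) ^ n = x n"
    and y: "\<And>n. y n \<in> {0..<int CARD('a) ^ n} \<and> y (Suc n) mod int CARD('a) ^ n = y n"
  show "(x n * y n) mod int CARD('a) ^ n \<in> {0..<int CARD('a) ^ n}" by simp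
  show "(x (Suc n) * y (Suc n)) mod int CARD('a) ^ Suc n mod int CARD('a) ^ n =
      (x n * y n) mod int CARD('a) ^ n"
    unfolding mod_Suc_mod using x y by (metis mod_mult_eq)
qed

definition minus_padic_int :: "'a padic_int \<Rightarrow> 'a padic_int \<Rightarrow> 'a padic_int" where
  "minus_padic_int x y = x + - y"

instance
proof
  fix a b c :: "'a padic_int"
  show "a * b * c = a * (b * c)"
    by transfer (simp add: mod_mult_left_eq mod_mult_right_eq mult.assoc)
  show "a * b = b * a" by transfer (simp add: mult.commute)
  show "1 * a = a" by transfer (simp add: mod_mult_left_eq fun_eq_iff)
  show "a + b + c = a + (b + c)"
    by transfer (simp add: mod_add_left_eq mod_add_right_eq add.assoc)
  show "a + b = b + a" by transfer (simp add: add.commute)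
  show "0 + a = a" by transfer (simp add: fun_eq_iff)
  show "- a + a = 0" by transfer (simp add: mod_add_left_eq)
  show "a - b = a + - b" by (simp add: minus_padic_int_def)
  show "(a + b) * c = a * c + b * c"
    by transfer (simp add: mod_mult_left_eq mod_add_eq distrib_right)
  have "1 < int CARD('a)" using prime_gt_1_nat[OF prime_card[where 'a='a]] by simp
  then show "(0 :: 'a padic_int) \<noteq> 1"
    by transfer (auto simp: fun_eq_iff intro!: exI[of _ 1])
qed

end

lemma padic_residue_mod:
  assumes "\<forall>n. x n \<in> {0..<int CARD('p::prime_card) ^ n} \<and> x (Suc n) mod int CARD('p) ^ n = x n"
  shows "x (n + k) mod int CARD('p) ^ n = x n"
proof (induction k)
  case 0
  show ?case using assms by simp
next
  case (Suc k)
  have "int CARD('p) ^ n dvd int CARD('p) ^ (n + k)" by (simp add: le_imp_power_dvd)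
  then have "x (n + Suc k) mod int CARD('p) ^ n
      = x (Suc (n + k)) mod int CARD('p) ^ (n + k) mod int CARD('p) ^ n"
    by (simp add: mod_mod_cancel)
  then show ?case using Suc assms by simp
qed

instance padic_int :: (prime_card) idom
proof
  fix a b :: "'a padic_int"
  assume "a \<noteq> 0" "b \<noteq> 0"
  then show "a * b \<noteq> 0"
  proof transfer
    fix x y :: "nat \<Rightarrow> int"
    let ?p = "int CARD('a)"
    assume x: "\<forall>n. x n \<in> {0..<?p ^ n} \<and> x (Suc n) mod ?p ^ n = x n"
      and y: "\<forall>n. y n \<in> {0..<?p ^ n} \<and> y (Suc n) mod ?p ^ n = y n"
      and nz: "x \<noteq> (\<lambda>_. 0)" "y \<noteq> (\<lambda>_. 0)"
    from nz obtain m n where mn: "x m \<noteq> 0" "y n \<noteq> 0" by (auto simp: fun_eq_iff)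
    have pr: "prime ?p" using prime_card[where 'a='a] by simp
    have 1: "\<not> ?p ^ m dvd x (m + n)"
      using padic_residue_mod[OF x, of m n] mn by (auto simp: dvd_eq_mod_eq_0)
    have 2: "\<not> ?p ^ n dvd y (m + n)"
      using padic_residue_mod[OF y, of n m] mn by (auto simp: dvd_eq_mod_eq_0 add.commute)
    have "\<not> ?p ^ (m + n) dvd x (m + n) * y (m + n)"
    proof
      assume d: "?p ^ (m + n) dvd x (m + n) * y (m + n)"
      have xy: "x (m + n) \<noteq> 0" "y (m + n) \<noteq> 0" using 1 2 by auto
      have "m + n \<le> multiplicity ?p (x (m + n) * y (m + n))"
        using d xy pr by (intro multiplicity_geI) auto
      also have "\<dots> = multiplicity ?p (x (m + n)) + multiplicity ?p (y (m + n))"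
        using pr xy by (intro prime_elem_multiplicity_mult_distrib) auto
      finally have "m \<le> multiplicity ?p (x (m + n)) \<or> n \<le> multiplicity ?p (y (m + n))"
        by linarith
      with 1 2 show False by (meson multiplicity_dvd')
    qed
    then show "(\<lambda>n. (x n * y n) mod ?p ^ n) \<noteq> (\<lambda>_. 0)"
      by (auto simp: fun_eq_iff dvd_eq_mod_eq_0)
  qed
qed

type_synonym 'p qp = "'p padic_int fract"

abbreviation pp :: "'p::prime_card qp" where
  "pp \<equiv> of_nat CARD('p)"

definition Zp :: "'p::prime_card qp set" where
  "Zp = range (\<lambda>a. Fract a 1)"

definition Zp_units :: "'p::prime_card qp set" where
  "Zp_units = {u \<in> Zp. u \<noteq> 0 \<and> inverse u \<in> Zp}"

definition pZ :: "int \<Rightarrow> 'p::prime_card qp set" where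
  "pZ r = (\<lambda>z. pp powi r * z) ` Zp"

text \<open>Meaningful for nonzero arguments only.\<close>

definition ord_p :: "'p::prime_card qp \<Rightarrow> int" where
  "ord_p x = (THE n. \<exists>u\<in>Zp_units. x = pp powi n * u)"

definition residue :: "'p::prime_card qp \<Rightarrow> int" where
  "residue z = (THE n. 0 \<le> n \<and> n < int CARD('p) \<and> z - of_int n \<in> pZ 1)"

definition legendre_p :: "'p::prime_card qp \<Rightarrow> int" where
  "legendre_p u = Legendre (residue u) (int CARD('p))"

definition hilbert :: "'p::prime_card qp \<Rightarrow> 'p qp \<Rightarrow> int" where
  "hilbert a b =
     (if \<exists>x y z. (x, y, z) \<noteq> (0, 0, 0) \<and> z\<^sup>2 = a * x\<^sup>2 + b * y\<^sup>2 then 1 else - 1)"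

section \<open>Matrices and subgroups\<close>

type_synonym 'p mat2 = "'p qp ^ 2 ^ 2"

definition mat2 :: "'p::prime_card qp \<Rightarrow> 'p qp \<Rightarrow> 'p qp \<Rightarrow> 'p qp \<Rightarrow> 'p mat2" where
  "mat2 a b c d = vector [vector [a, b], vector [c, d]]"

definition xm :: "'p::prime_card qp \<Rightarrow> 'p mat2" where "xm s = mat2 1 s 0 1"
definition ym :: "'p::prime_card qp \<Rightarrow> 'p mat2" where "ym s = mat2 1 0 s 1"
definition hm :: "'p::prime_card qp \<Rightarrow> 'p mat2" where "hm t = mat2 t 0 0 (inverse t)"
definition wm :: "'p::prime_card qp \<Rightarrow> 'p mat2" where "wm t = mat2 0 t (- inverse t) 0"
definition alpha :: "'p::prime_card mat2" where "alpha = mat2 pp 0 0 1"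

definition GL2 :: "'p::prime_card mat2 monoid" where
  "GL2 = \<lparr>carrier = {A. det A \<noteq> 0}, monoid.mult = (**), one = mat 1\<rparr>"

definition SL2 :: "'p::prime_card mat2 monoid" where
  "SL2 = \<lparr>carrier = {A. det A = 1}, monoid.mult = (**), one = mat 1\<rparr>"

definition K_zero :: "'p::prime_card mat2 set" where
  "K_zero = {A \<in> carrier SL2. \<forall>i j. A $ i $ j \<in> Zp}"

definition K_one :: "'p::prime_card mat2 set" where
  "K_one = (\<lambda>k. matrix_inv alpha ** k ** alpha) ` K_zero"

definition K_level :: "nat \<Rightarrow> 'p::prime_card mat2 set" where
  "K_level r = {A \<in> K_zero. A $ 2 $ 1 \<in> pZ (int r)}"

definition N_level :: "int \<Rightarrow> 'p::prime_card mat2 set" where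
  "N_level r = xm ` pZ r"

definition K_GL :: "'p::prime_card mat2 set" where
  "K_GL = {A. (\<forall>i j. A $ i $ j \<in> Zp) \<and> det A \<in> Zp_units}"

definition I_GL :: "'p::prime_card mat2 set" where
  "I_GL = {A \<in> K_GL. A $ 2 $ 1 \<in> pZ 1}"

definition Iw :: "'p::prime_card mat2 set" where
  "Iw = I_GL \<inter> carrier SL2"

definition center_GL :: "'p::prime_card mat2 set" where
  "center_GL = {z \<in> carrier GL2. \<forall>g\<in>carrier GL2. z ** g = g ** z}"

definition Z_prime :: "'p::prime_card mat2 set" where
  "Z_prime = generate GL2 {mat2 0 1 pp 0}"

definition ZK :: "'p::prime_card mat2 set" where
  "ZK = center_GL <#>\<^bsub>GL2\<^esub> K_GL"

definition ZI :: "'p::prime_card mat2 set" where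
  "ZI = Z_prime <#>\<^bsub>GL2\<^esub> I_GL"

definition congr_unram :: "nat \<Rightarrow> 'p::prime_card mat2 set" where
  "congr_unram l = {A. \<forall>i j. (A - mat 1) $ i $ j \<in> pZ (int l)}"

definition congr_ram :: "nat \<Rightarrow> 'p::prime_card mat2 set" where
  "congr_ram l = {A \<in> I_GL. A $ 1 $ 1 - 1 \<in> pZ (int l) \<and> A $ 2 $ 2 - 1 \<in> pZ (int l) \<and>
     A $ 1 $ 2 \<in> pZ (int l) \<and> A $ 2 $ 1 \<in> pZ (int l + 1)}"

section \<open>The double cover\<close>

definition tau_entry :: "'p::prime_card mat2 \<Rightarrow> 'p qp" where
  "tau_entry A = (if A $ 2 $ 1 \<noteq> 0 then A $ 2 $ 1 else A $ 2 $ 2)"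

definition s_p :: "'p::prime_card mat2 \<Rightarrow> int" where
  "s_p g = (if g $ 2 $ 1 * g $ 2 $ 2 \<noteq> 0 \<and> odd (ord_p (g $ 2 $ 1))
            then hilbert (g $ 2 $ 1) (g $ 2 $ 2) else 1)"

definition cocycle :: "'p::prime_card mat2 \<Rightarrow> 'p mat2 \<Rightarrow> int" where
  "cocycle g h = hilbert (tau_entry (g ** h) * tau_entry g) (tau_entry (g ** h) * tau_entry h)
     * s_p g * s_p h * s_p (g ** h)"

definition cover_preimage :: "'p::prime_card mat2 set \<Rightarrow> ('p mat2 \<times> int) set" where
  "cover_preimage H = H \<times> {1, - 1}"

definition Mp :: "('p::prime_card mat2 \<times> int) monoid" where
  "Mp = \<lparr>carrier = cover_preimage (carrier SL2),
         monoid.mult = (\<lambda>(g, e1) (h, e2). (g ** h, e1 * e2 * cocycle g h)),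
         one = (mat 1, 1)\<rparr>"

definition is_splitting :: "'p::prime_card mat2 set \<Rightarrow> ('p mat2 \<Rightarrow> int) \<Rightarrow> bool" where
  "is_splitting K s \<longleftrightarrow> (\<lambda>k. (k, s k)) \<in> hom (SL2\<lparr>carrier := K\<rparr>) Mp"

definition is_s_zero :: "('p::prime_card mat2 \<Rightarrow> int) \<Rightarrow> bool" where
  "is_s_zero s \<longleftrightarrow> is_splitting K_zero s \<and>
     (\<forall>t\<in>Zp. s (xm t) = 1 \<and> s (ym t) = 1) \<and> (\<forall>u\<in>Zp_units. s (hm u) = 1) \<and> s (wm 1) = 1"

definition is_s_one :: "('p::prime_card mat2 \<Rightarrow> int) \<Rightarrow> bool" where
  "is_s_one s \<longleftrightarrow> is_splitting K_one s \<and>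
     (\<forall>t\<in>pZ (- 1). s (xm t) = 1) \<and> (\<forall>t\<in>pZ 1. s (ym t) = 1) \<and> s (wm (inverse pp)) = 1 \<and>
     (\<forall>u\<in>Zp_units. s (hm u) = legendre_p u)"

section \<open>Representations\<close>

text \<open>
  A complex vector space is a type \<open>'v\<close> with a scalar multiplication \<open>sc\<close>; a representation of
  a group \<open>H\<close> of matrices is a map into the endomorphisms of \<open>'v\<close>, with irrelevant values
  off \<open>H\<close>.
\<close>

definition is_rep :: "(complex \<Rightarrow> 'v::ab_group_add \<Rightarrow> 'v) \<Rightarrow> 'p::prime_card mat2 set \<Rightarrow>
    ('p mat2 \<Rightarrow> 'v \<Rightarrow> 'v) \<Rightarrow> bool" where
  "is_rep sc H \<pi> \<longleftrightarrow> vector_space sc \<and> (\<forall>h\<in>H. Vector_Spaces.linear sc sc (\<pi> h)) \<and>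
     \<pi> (mat 1) = id \<and> (\<forall>g\<in>H. \<forall>h\<in>H. \<pi> (g ** h) = \<pi> g \<circ> \<pi> h)"

definition is_irred :: "(complex \<Rightarrow> 'v::ab_group_add \<Rightarrow> 'v) \<Rightarrow> 'p::prime_card mat2 set \<Rightarrow>
    ('p mat2 \<Rightarrow> 'v \<Rightarrow> 'v) \<Rightarrow> bool" where
  "is_irred sc H \<pi> \<longleftrightarrow> is_rep sc H \<pi> \<and> (\<exists>v::'v. v \<noteq> 0) \<and>
     (\<forall>S. module.subspace sc S \<and> (\<forall>h\<in>H. \<pi> h ` S \<subseteq> S) \<longrightarrow> S = {0} \<or> S = UNIV)"

text \<open>The congruence subgroups form a neighbourhood basis of the identity.\<close>

definition is_smooth :: "'p::prime_card mat2 set \<Rightarrow> ('p mat2 \<Rightarrow> 'v \<Rightarrow> 'v) \<Rightarrow> bool" where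
  "is_smooth H \<pi> \<longleftrightarrow> (\<forall>v. \<exists>n\<ge>1. \<forall>k \<in> H \<inter> congr_unram n. \<pi> k v = v)"

definition Hom_triv :: "(complex \<Rightarrow> 'v::ab_group_add \<Rightarrow> 'v) \<Rightarrow> 'p::prime_card mat2 set \<Rightarrow>
    ('p mat2 \<Rightarrow> 'v \<Rightarrow> 'v) \<Rightarrow> (complex \<Rightarrow> 'v) set" where
  "Hom_triv sc H \<pi> = {T. Vector_Spaces.linear (*) sc T \<and> (\<forall>h\<in>H. \<forall>z. T z = \<pi> h (T z))}"

definition unram_datum :: "nat \<Rightarrow> (complex \<Rightarrow> 'v::ab_group_add \<Rightarrow> 'v) \<Rightarrow>
    ('p::prime_card mat2 \<Rightarrow> 'v \<Rightarrow> 'v) \<Rightarrow> bool" where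
  "unram_datum l sc \<tau> \<longleftrightarrow> is_irred sc ZK \<tau> \<and> is_smooth ZK \<tau> \<and>
     (\<forall>k\<in>congr_unram l. \<tau> k = id) \<and> Hom_triv sc (N_level (int l - 1)) \<tau> = {\<lambda>_. 0}"

definition ram_datum :: "nat \<Rightarrow> (complex \<Rightarrow> 'v::ab_group_add \<Rightarrow> 'v) \<Rightarrow>
    ('p::prime_card mat2 \<Rightarrow> 'v \<Rightarrow> 'v) \<Rightarrow> bool" where
  "ram_datum l sc \<tau> \<longleftrightarrow> is_irred sc ZI \<tau> \<and> is_smooth ZI \<tau> \<and>
     (\<forall>k\<in>congr_ram l. \<tau> k = id) \<and> Hom_triv sc (N_level (int l - 1)) \<tau> = {\<lambda>_. 0}"

text \<open>An irreducible constituent is an irreducible subquotient: \<open>T\<close> is an equivariant linear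
  surjection from an \<open>H\<close>-stable subspace \<open>B\<close>.\<close>

definition is_constituent :: "(complex \<Rightarrow> 'v::ab_group_add \<Rightarrow> 'v) \<Rightarrow> ('p::prime_card mat2 \<Rightarrow> 'v \<Rightarrow> 'v) \<Rightarrow>
    'p mat2 set \<Rightarrow> (complex \<Rightarrow> 'w::ab_group_add \<Rightarrow> 'w) \<Rightarrow> ('p mat2 \<Rightarrow> 'w \<Rightarrow> 'w) \<Rightarrow> bool" where
  "is_constituent scV \<tau> H scW \<rho> \<longleftrightarrow> is_irred scW H \<rho> \<and>
     (\<exists>B T. module.subspace scV B \<and> (\<forall>h\<in>H. \<tau> h ` B \<subseteq> B) \<and>
        (\<forall>v\<in>B. \<forall>v'\<in>B. T (v + v') = T v + T v') \<and> (\<forall>a. \<forall>v\<in>B. T (scV a v) = scW a (T v)) \<and>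
        (\<forall>h\<in>H. \<forall>v\<in>B. T (\<tau> h v) = \<rho> h (T v)) \<and> T ` B = UNIV)"

definition eigen_U :: "(complex \<Rightarrow> 'w \<Rightarrow> 'w) \<Rightarrow> ('p::prime_card qp \<Rightarrow> complex) \<Rightarrow>
    ('p mat2 \<Rightarrow> 'w \<Rightarrow> 'w) \<Rightarrow> 'w set" where
  "eigen_U sc ch \<rho> = {w. \<forall>u\<in>Zp_units. \<rho> (hm u) w = sc (ch u) w}"

text \<open>Functions on a group \<open>K\<close> of matrices are extended by zero.  The representation induced from
  \<open>J\<close> to \<open>K\<close> is \<open>Ind_act K\<close> on \<open>Ind_space J K \<sigma>\<close>; no smoothness condition is needed since
  \<open>J\<close> has finite index in \<open>K\<close>.\<close>

definition fun_scale :: "(complex \<Rightarrow> 'w \<Rightarrow> 'w) \<Rightarrow> complex \<Rightarrow> ('g \<Rightarrow> 'w) \<Rightarrow> 'g \<Rightarrow> 'w" where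
  "fun_scale sc a \<phi> = (\<lambda>x. sc a (\<phi> x))"

definition Ind_space :: "'p::prime_card mat2 set \<Rightarrow> 'p mat2 set \<Rightarrow> ('p mat2 \<Rightarrow> 'w::ab_group_add \<Rightarrow> 'w) \<Rightarrow>
    ('p mat2 \<Rightarrow> 'w) set" where
  "Ind_space J K \<sigma> = {\<phi>. (\<forall>x. x \<notin> K \<longrightarrow> \<phi> x = 0) \<and> (\<forall>j\<in>J. \<forall>k\<in>K. \<phi> (j ** k) = \<sigma> j (\<phi> k))}"

definition Ind_act :: "'p::prime_card mat2 set \<Rightarrow> 'p mat2 \<Rightarrow>
    ('p mat2 \<Rightarrow> 'w::ab_group_add) \<Rightarrow> 'p mat2 \<Rightarrow> 'w" where
  "Ind_act K k \<phi> = (\<lambda>x. if x \<in> K then \<phi> (x ** k) else 0)"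

lemma Ind_act_closed:
  assumes "\<And>a b. a \<in> K \<Longrightarrow> b \<in> K \<Longrightarrow> a ** b \<in> K" "J \<subseteq> K" "k \<in> K" "\<phi> \<in> Ind_space J K \<sigma>"
  shows "Ind_act K k \<phi> \<in> Ind_space J K \<sigma>"
  using assms by (auto simp: Ind_space_def Ind_act_def matrix_mul_assoc[symmetric] subset_iff)

definition phi_vec :: "('p::prime_card mat2 \<Rightarrow> 'w::ab_group_add \<Rightarrow> 'w) \<Rightarrow> 'w \<Rightarrow> 'p mat2 \<Rightarrow> 'w" where
  "phi_vec \<sigma> w = (\<lambda>k. if k \<in> Iw then \<sigma> k w else 0)"

definition alpha_conj :: "('p::prime_card mat2 \<Rightarrow> 'v \<Rightarrow> 'v) \<Rightarrow> 'p mat2 \<Rightarrow> 'v \<Rightarrow> 'v" where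
  "alpha_conj \<rho> k = \<rho> (alpha ** k ** matrix_inv alpha)"

definition genuine_lift :: "(complex \<Rightarrow> 'v \<Rightarrow> 'v) \<Rightarrow> ('p::prime_card mat2 \<Rightarrow> int) \<Rightarrow>
    ('p mat2 \<Rightarrow> 'v \<Rightarrow> 'v) \<Rightarrow> 'p mat2 \<times> int \<Rightarrow> 'v \<Rightarrow> 'v" where
  "genuine_lift sc s \<rho> = (\<lambda>(k, e) v. sc (of_int (e * s k)) (\<rho> k v))"

section \<open>Vectors in the compactly induced representation\<close>

text \<open>The compactly induced representation consists of functions on \<open>carrier Mp\<close> and acts by right
  translation.\<close>

definition f_vec :: "(complex \<Rightarrow> 'v::ab_group_add \<Rightarrow> 'v) \<Rightarrow> 'p::prime_card mat2 set \<Rightarrow>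
    ('p mat2 \<times> int \<Rightarrow> 'v \<Rightarrow> 'v) \<Rightarrow> nat \<Rightarrow> 'v \<Rightarrow> 'p mat2 \<times> int \<Rightarrow> 'v" where
  "f_vec sc K \<rho>t m v = (\<lambda>(g, e).
     if \<exists>k\<in>K. g = k ** hm (pp ^ m)
     then (let k = (THE k. k \<in> K \<and> g = k ** hm (pp ^ m))
           in sc (of_int (cocycle k (hm (pp ^ m)) * e)) (\<rho>t (k, 1) v))
     else 0)"

definition eta_unram :: "('p::prime_card qp \<Rightarrow> complex) \<Rightarrow> nat \<Rightarrow> 'p qp \<Rightarrow> complex" where
  "eta_unram \<eta> l = (if even l then \<eta> else (\<lambda>u. \<eta> u * of_int (legendre_p u)))"

definition eta_ram :: "('p::prime_card qp \<Rightarrow> complex) \<Rightarrow> 'p qp \<Rightarrow> complex" where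
  "eta_ram \<eta> = (\<lambda>u. \<eta> u * of_int (legendre_p u))"

definition f_unram :: "(complex \<Rightarrow> 'w::ab_group_add \<Rightarrow> 'w) \<Rightarrow> ('p::prime_card mat2 \<Rightarrow> int) \<Rightarrow>
    ('p mat2 \<Rightarrow> int) \<Rightarrow> nat \<Rightarrow> ('p mat2 \<Rightarrow> 'w \<Rightarrow> 'w) \<Rightarrow> 'w \<Rightarrow> 'p mat2 \<times> int \<Rightarrow> 'w" where
  "f_unram sc s0 s1 l \<rho> =
     (if even l then f_vec sc K_zero (genuine_lift sc s0 \<rho>) (l div 2)
      else f_vec sc K_one (genuine_lift sc s1 (alpha_conj \<rho>)) ((l - 1) div 2))"

text \<open>The representation induced from \<open>Iw\<close> to \<open>ram_K l\<close>, before conjugation by \<open>alpha\<close>.\<close>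

definition ram_K :: "nat \<Rightarrow> 'p::prime_card mat2 set" where
  "ram_K l = (if even l then K_one else K_zero)"

definition rho_ram :: "nat \<Rightarrow> 'p::prime_card mat2 \<Rightarrow> ('p mat2 \<Rightarrow> 'w::ab_group_add) \<Rightarrow> 'p mat2 \<Rightarrow> 'w" where
  "rho_ram l = Ind_act (ram_K l)"

definition f_ram :: "(complex \<Rightarrow> 'w::ab_group_add \<Rightarrow> 'w) \<Rightarrow> ('p::prime_card mat2 \<Rightarrow> int) \<Rightarrow>
    nat \<Rightarrow> ('p mat2 \<Rightarrow> 'w) \<Rightarrow> 'p mat2 \<times> int \<Rightarrow> 'p mat2 \<Rightarrow> 'w" where
  "f_ram sc s1 l =
     (if even l then f_vec (fun_scale sc) K_one (genuine_lift (fun_scale sc) s1 (rho_ram l)) (l div 2)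
      else f_vec (fun_scale sc) K_one
             (genuine_lift (fun_scale sc) s1 (alpha_conj (rho_ram l))) ((l - 1) div 2))"

section \<open>Operators\<close>

definition eta_cover :: "('p::prime_card qp \<Rightarrow> complex) \<Rightarrow> 'p mat2 \<times> int \<Rightarrow> complex" where
  "eta_cover \<eta> = (\<lambda>(A, e). of_int e * \<eta> (A $ 2 $ 2))"

definition V_fun :: "('p::prime_card qp \<Rightarrow> complex) \<Rightarrow> nat \<Rightarrow> 'p qp \<Rightarrow> 'p mat2 \<times> int \<Rightarrow> complex" where
  "V_fun \<eta> M \<delta> = (let KM = cover_preimage (K_level M); y0 = (ym (\<delta> * pp ^ (M - 1)), 1) in
     THE F. (\<forall>g. F g \<noteq> 0 \<longrightarrow> g \<in> KM <#>\<^bsub>Mp\<^esub> {y0} <#>\<^bsub>Mp\<^esub> KM) \<and> F y0 = 1 \<and>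
       (\<forall>k\<in>KM. \<forall>k'\<in>KM. \<forall>g\<in>carrier Mp.
          F (k \<otimes>\<^bsub>Mp\<^esub> g \<otimes>\<^bsub>Mp\<^esub> k') = cnj (eta_cover \<eta> k) * cnj (eta_cover \<eta> k') * F g))"

text \<open>
  The action of a function \<open>F\<close> by integration against right translation.  On vectors transforming
  under \<open>L\<close> by a character, where \<open>F\<close> transforms on the right by the inverse of that
  character, the integrand is right \<open>L\<close>-invariant.  Hence the Haar integral with
  \<open>L\<close> of volume one is the sum over the left cosets of \<open>L\<close> in the support of \<open>F\<close>.
\<close>

definition conv_act :: "(complex \<Rightarrow> 'v::ab_group_add \<Rightarrow> 'v) \<Rightarrow> ('p::prime_card mat2 \<times> int) set \<Rightarrow>
    ('p mat2 \<times> int \<Rightarrow> complex) \<Rightarrow> ('p mat2 \<times> int \<Rightarrow> 'v) \<Rightarrow> 'p mat2 \<times> int \<Rightarrow> 'v" where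
  "conv_act sc L F f = (\<lambda>x. \<Sum>C \<in> {C \<in> lcosets\<^bsub>Mp\<^esub> L. \<exists>g\<in>C. F g \<noteq> 0}.
     (let g = (SOME g. g \<in> C) in sc (F g) (f (x \<otimes>\<^bsub>Mp\<^esub> g))))"

text \<open>\<open>V_op sc \<eta> M \<delta>\<close> and \<open>Y_op sc \<eta> M lam\<close> are the operators with index \<open>M - 1\<close>.\<close>

definition V_op :: "(complex \<Rightarrow> 'v::ab_group_add \<Rightarrow> 'v) \<Rightarrow> ('p::prime_card qp \<Rightarrow> complex) \<Rightarrow> nat \<Rightarrow>
    'p qp \<Rightarrow> ('p mat2 \<times> int \<Rightarrow> 'v) \<Rightarrow> 'p mat2 \<times> int \<Rightarrow> 'v" where
  "V_op sc \<eta> M \<delta> = conv_act sc (cover_preimage (K_level M)) (V_fun \<eta> M \<delta>)"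

definition Y_op :: "(complex \<Rightarrow> 'v::ab_group_add \<Rightarrow> 'v) \<Rightarrow> ('p::prime_card qp \<Rightarrow> complex) \<Rightarrow> nat \<Rightarrow>
    'p qp \<Rightarrow> ('p mat2 \<times> int \<Rightarrow> 'v) \<Rightarrow> 'p mat2 \<times> int \<Rightarrow> 'v" where
  "Y_op sc \<eta> M lam f = (\<lambda>x. f x + V_op sc \<eta> M 1 f x + V_op sc \<eta> M lam f x)"

definition sqrt_one :: "'p::prime_card qp set" where
  "sqrt_one = {e * (1 + z) | e z. e \<in> {1, - 1} \<and> z \<in> pZ 1}"

definition unit_classes :: "'p::prime_card qp set set" where
  "unit_classes = (\<lambda>u. (*) u ` sqrt_one) ` Zp_units"

definition T_op :: "(complex \<Rightarrow> 'v::ab_group_add \<Rightarrow> 'v) \<Rightarrow> ('p::prime_card qp \<Rightarrow> complex) \<Rightarrow>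
    ('p mat2 \<Rightarrow> 'v \<Rightarrow> 'v) \<Rightarrow> nat \<Rightarrow> 'p qp \<Rightarrow> 'v \<Rightarrow> 'v" where
  "T_op sc ch \<rho> r \<delta> v = (\<Sum>C \<in> unit_classes.
     (let u = (SOME u. u \<in> C) in
       sc (inverse (ch u)) (\<rho> (hm u ** ym (\<delta> * pp ^ (r - 1))) v)))"

end

theory Submission
  imports Defs "HOL-Number_Theory.Euler_Criterion"
begin

text \<open>
  The function \<open>V_fun\<close> is the character \<open>eta_cover\<close> restricted to a double coset which is the union of
  the left cosets of \<open>(h(u) y(\<delta> p\<^sup>M\<^sup>-\<^sup>1), 1)\<close>, with \<open>u\<close> running over the unit classes.  In the cover,
  moving \<open>h(p\<^sup>m)\<close> past \<open>h(u)\<close>, \<open>x(s)\<close> and \<open>y(s)\<close> produces no sign, so that the operator acts on \<open>f_v\<close>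
  through the inducing representation, as \<open>T_op\<close> does on \<open>v\<close>.  Since \<open>v\<close> is an eigenvector of the
  torus, the terms of the two sums \<open>T_op\<close> are the \<open>\<rho>(y(n p\<^sup>r\<^sup>-\<^sup>1)) v\<close> with \<open>n\<close> running over the nonzero
  squares and the nonsquares mod \<open>p\<close>.  Together with \<open>v\<close> they add up to the sum over all \<open>n\<close> mod \<open>p\<close>,
  which is conjugate, by the Weyl element or by the generator of \<open>Z_prime\<close>, to a vector invariant under
  \<open>N_level (l - 1)\<close>, hence zero by very cuspidality.
\<close>

section \<open>p-adic integers\<close>

text \<open>The obstacle is the signs of the cover. Coset arguments need \<open>Mp\<close> to be a
  group, so the cocycle identity, and with it bilinearity of the Hilbert symbol, is derived from the
  definition of the symbol by solvability of a quadratic equation. On the Iwahori subgroup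
  \<open>K_level 1\<close> the cocycle is trivial, as the values of the splitting \<open>s0\<close>
  show; this also serves the cases built on \<open>s1\<close>. The four cases are instances of one
  computation, the locale \<open>induced_vector\<close>, with numbers m and r such that M = 2 m + r,
  and with the sign \<open>\<psi>\<close> given by the splitting on the torus. Conjugation by h(p^m)
  divides the parameter of y by p^(2m), so y(\<delta> p^(M-1)) acts as y(\<delta> p^(r-1)). The
  eigencharacter is \<open>\<eta>\<close> times \<open>\<psi>\<close>; hence the Legendre twist
  occurs exactly where the splitting is \<open>s1\<close>. For even l the number r is l (unramified)
  or l + 1 (ramified); for odd l the conjugation by \<open>alpha\<close> raises it by one
  more.\<close>

lemma card_prime_int: "prime (int CARD('p::prime_card))"
  using prime_card[where 'a='p] by simp

lemma Rep_padic_int_range: "0 \<le> Rep_padic_int (x :: 'p::prime_card padic_int) n"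
    "Rep_padic_int x n < int CARD('p) ^ n"
  using Rep_padic_int[of x] by auto

lemma Rep_padic_int_mod_le:
  assumes "m \<le> n"
  shows "Rep_padic_int (x :: 'p::prime_card padic_int) n mod int CARD('p) ^ m = Rep_padic_int x m"
  using padic_residue_mod[of "Rep_padic_int x" m "n - m"] Rep_padic_int[of x] assms by auto

lemma Rep_padic_int_mod [simp]:
  "Rep_padic_int (x :: 'p::prime_card padic_int) n mod int CARD('p) ^ n = Rep_padic_int x n"
  by (rule Rep_padic_int_mod_le) simp

lemma Rep_padic_int_Suc: "[Rep_padic_int (x :: 'p::prime_card padic_int) (Suc n) = Rep_padic_int x n] (mod int CARD('p) ^ n)"
  using Rep_padic_int_mod_le[of n "Suc n" x] by (simp add: cong_def)

lemma padic_int_eqI: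
  assumes "\<And>n. Rep_padic_int x n = Rep_padic_int y n"
  shows "x = (y :: 'p::prime_card padic_int)"
  using assms by (metis Rep_padic_int_inject ext)

lemma padic_int_limit:
  assumes "\<And>n. [a (Suc n) = a n] (mod int CARD('p) ^ n)"
  obtains x :: "'p::prime_card padic_int" where "\<And>n. Rep_padic_int x n = a n mod int CARD('p) ^ n"
proof -
  let ?f = "\<lambda>n. a n mod int CARD('p) ^ n"
  have "?f \<in> {x. \<forall>n. x n \<in> {0..<int CARD('p) ^ n} \<and> x (Suc n) mod int CARD('p) ^ n = x n}"
    using assms mod_Suc_mod[where 'p='p] by (auto simp: cong_def)
  then have "Rep_padic_int (Abs_padic_int ?f :: 'p padic_int) = ?f"
    by (rule Abs_padic_int_inverse)
  then show ?thesis using that by metis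
qed

lemma Rep_padic_int_diff:
  "Rep_padic_int (x - y :: 'p::prime_card padic_int) n = (Rep_padic_int x n - Rep_padic_int y n) mod int CARD('p) ^ n"
  unfolding minus_padic_int_def plus_padic_int.rep_eq uminus_padic_int.rep_eq
  by (metis mod_add_right_eq uminus_add_conv_diff add.commute)

lemma Rep_padic_int_of_nat: "Rep_padic_int (of_nat k :: 'p::prime_card padic_int) n = int k mod int CARD('p) ^ n"
  by (induction k)
    (auto simp: zero_padic_int.rep_eq one_padic_int.rep_eq plus_padic_int.rep_eq mod_add_eq)

lemma Rep_padic_int_of_int: "Rep_padic_int (of_int k :: 'p::prime_card padic_int) n = k mod int CARD('p) ^ n"
proof (cases "0 \<le> k")
  case True
  then show ?thesis using Rep_padic_int_of_nat[of "nat k" n, where 'p='p] by simp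
next
  case False
  then obtain j where "k = - int j" by (metis nle_le nonpos_int_cases)
  then show ?thesis by (simp add: Rep_padic_int_of_nat uminus_padic_int.rep_eq mod_minus_eq)
qed

lemma coprime_Rep_padic_int:
  assumes "Rep_padic_int (x :: 'p::prime_card padic_int) 1 \<noteq> 0"
  shows "coprime (Rep_padic_int x n) (int CARD('p) ^ n)"
proof (cases "n = 0")
  case False
  then have "\<not> int CARD('p) dvd Rep_padic_int x n"
    using Rep_padic_int_mod_le[of 1 n x] assms by (auto simp: dvd_eq_mod_eq_0)
  then have "coprime (int CARD('p)) (Rep_padic_int x n)"
    using card_prime_int[where 'p='p] by (simp add: prime_imp_coprime)
  then show ?thesis by (simp add: coprime_commute)
qed simp

text \<open>An inverse modulo p^n is unique modulo p^n, so inverses chosen independently for each n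
  are automatically compatible and define a p-adic integer.\<close>

lemma padic_int_invertible:
  assumes "Rep_padic_int (x :: 'p::prime_card padic_int) 1 \<noteq> 0"
  shows "\<exists>y. x * y = 1"
proof -
  let ?q = "\<lambda>n. int CARD('p) ^ n" and ?x = "Rep_padic_int x"
  have "\<exists>b. [?x n * b = 1] (mod ?q n)" for n
    using cong_solve_coprime_int[OF coprime_Rep_padic_int[OF assms]] by blast
  then obtain b where b: "\<And>n. [?x n * b n = 1] (mod ?q n)" by metis
  have "[b (Suc n) = b n] (mod ?q n)" for n
  proof -
    have "[?x (Suc n) * b (Suc n) = 1] (mod ?q n)"
      by (rule cong_dvd_modulus[OF b]) simp
    moreover have "[?x (Suc n) * b (Suc n) = ?x n * b (Suc n)] (mod ?q n)"
      by (intro cong_mult Rep_padic_int_Suc cong_refl)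
    ultimately have "[?x n * b (Suc n) = ?x n * b n] (mod ?q n)"
      using b by (meson cong_trans cong_sym)
    then show ?thesis using coprime_Rep_padic_int[OF assms] cong_mult_lcancel by blast
  qed
  then obtain y :: "'p padic_int" where y: "\<And>n. Rep_padic_int y n = b n mod ?q n"
    using padic_int_limit by blast
  have "x * y = 1"
    by (rule padic_int_eqI)
      (use b in \<open>auto simp: times_padic_int.rep_eq one_padic_int.rep_eq y cong_def mod_mult_right_eq\<close>)
  then show ?thesis ..
qed

text \<open>Division by p^n costs n digits of precision: the k-th residue of the quotient comes from
  the (n+k)-th residue of x.\<close>

lemma padic_int_divisible:
  assumes "Rep_padic_int (x :: 'p::prime_card padic_int) n = 0"
  shows "\<exists>y. x = of_nat CARD('p) ^ n * y"
proof -
  let ?q = "\<lambda>n. int CARD('p) ^ n" and ?x = "Rep_padic_int x"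
  define a where "a = (\<lambda>k. ?x (n + k) div ?q n)"
  have a: "?q n * a k = ?x (n + k)" for k
    using Rep_padic_int_mod_le[of n "n + k" x] assms by (auto simp: a_def dvd_eq_mod_eq_0)
  have "[a (Suc k) = a k] (mod ?q k)" for k
  proof -
    have "[?q n * a (Suc k) = ?q n * a k] (mod ?q n * ?q k)"
      unfolding a using Rep_padic_int_Suc[of x "n + k"] by (simp add: power_add)
    then show ?thesis by (simp add: cong_iff_dvd_diff flip: right_diff_distrib)
  qed
  then obtain y :: "'p padic_int" where y: "\<And>k. Rep_padic_int y k = a k mod ?q k"
    using padic_int_limit by blast
  have "x = of_nat CARD('p) ^ n * y"
  proof (rule padic_int_eqI)
    fix k
    have "?x k = ?x (n + k) mod ?q k" by (simp add: Rep_padic_int_mod_le)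
    also have "\<dots> = Rep_padic_int (of_nat CARD('p) ^ n * y) k"
      using Rep_padic_int_of_nat[of "CARD('p) ^ n" k, where 'p='p]
      by (simp add: times_padic_int.rep_eq y mod_mult_eq flip: a)
    finally show "?x k = Rep_padic_int (of_nat CARD('p) ^ n * y) k" .
  qed
  then show ?thesis ..
qed

text \<open>Hensel lifting. The root is kept congruent to the given x mod p so that the roots for
  different n can be glued in \<open>padic_int_sqrt\<close>.\<close>

lemma sqrt_mod_prime_power:
  fixes p a x :: int
  assumes "prime p" "odd p" "\<not> p dvd a" "[x\<^sup>2 = a] (mod p)"
  shows "\<exists>y. [y = x] (mod p) \<and> [y\<^sup>2 = a] (mod p ^ n)"
proof (induction n)
  case 0
  show ?case by (auto intro: exI[of _ x])
next
  case (Suc n)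
  show ?case
  proof (cases "n = 0")
    case True
    then show ?thesis using assms by (auto intro: exI[of _ x])
  next
    case False
    from Suc obtain y where y: "[y = x] (mod p)" "[y\<^sup>2 = a] (mod p ^ n)" by blast
    then obtain k where k: "y\<^sup>2 = a + p ^ n * k"
      by (metis add_diff_cancel_left' cong_iff_dvd_diff diff_add_cancel dvdE add.commute)
    have "[y\<^sup>2 = a] (mod p)" using y(1) assms(4) by (meson cong_pow cong_trans)
    then have "\<not> p dvd y" using assms(1,3)
      by (metis cong_dvd_iff dvd_power power2_eq_square dvd_mult)
    then have "\<not> p dvd 2 * y"
      using assms(1,2) by (metis prime_dvd_mult_iff primes_dvd_imp_eq two_is_prime_nat prime_nat_int_transfer of_nat_numeral dvd_refl)
    then have "coprime (2 * y) p" using assms(1) by (metis coprime_commute prime_imp_coprime)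
    then obtain s where "[2 * y * s = 1] (mod p)" using cong_solve_coprime_int by blast
    then have "[2 * y * s * (- k) = 1 * (- k)] (mod p)" by (rule cong_scalar_right)
    then have "p dvd k + 2 * y * (- k * s)" by (simp add: cong_iff_dvd_diff algebra_simps)
    then obtain j where j: "k + 2 * y * (- k * s) = p * j" by (elim dvdE)
    \<comment> \<open>With s inverse to 2 y mod p, this is the Newton correction: it solves k + 2 y
      t = 0 mod p. The quadratic remainder p^(2n) t^2 is a multiple of p^(n+1) because n >= 1,
      whence the separate case n = 0.\<close>
    let ?t = "- k * s"
    obtain n' where n': "n = Suc n'" using False by (cases n) auto
    have "(y + p ^ n * ?t)\<^sup>2 = a + p ^ n * (k + 2 * y * ?t) + p ^ n * p ^ n * ?t\<^sup>2"
      using k by (simp add: power2_sum algebra_simps power2_eq_square)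
    also have "\<dots> - a = p ^ Suc n * (j + p ^ n' * ?t\<^sup>2)"
      unfolding j by (simp add: n' algebra_simps)
    finally have "[(y + p ^ n * ?t)\<^sup>2 = a] (mod p ^ Suc n)"
      by (simp add: cong_iff_dvd_diff)
    moreover have "[y + p ^ n * ?t = x] (mod p)"
      using y(1) dvd_diff[of p "y - x" "p * p ^ n' * (k * s)"] by (simp add: n' cong_iff_dvd_diff algebra_simps)
    ultimately show ?thesis by blast
  qed
qed

text \<open>Successive approximate roots are both congruent to s mod p, so their sum is 2 s mod p
  and prime to p. Since p^n divides the difference of their squares, it divides their
  difference.\<close>

lemma padic_int_sqrt:
  fixes x :: "'p::prime_card padic_int"
  assumes odd: "odd CARD('p)" and "Rep_padic_int x 1 \<noteq> 0"
    and "[s\<^sup>2 = Rep_padic_int x 1] (mod int CARD('p))"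
  shows "\<exists>y. x = y\<^sup>2"
proof -
  let ?p = "int CARD('p)" and ?x = "Rep_padic_int x"
  have x1: "\<not> ?p dvd ?x n" if "n > 0" for n
    using Rep_padic_int_mod_le[of 1 n x] assms that by (auto simp: dvd_eq_mod_eq_0)
  have s: "[s\<^sup>2 = ?x n] (mod ?p)" if "n > 0" for n
    using Rep_padic_int_mod_le[of 1 n x] Rep_padic_int_mod[of x 1] assms(3) that by (auto simp: cong_def)
  have ex: "\<exists>y. [y = s] (mod ?p) \<and> [y\<^sup>2 = ?x n] (mod ?p ^ n)" for n
  proof (cases "n = 0")
    case False
    then show ?thesis
      using sqrt_mod_prime_power[OF card_prime_int[where 'p='p] _ x1 s] odd by auto
  qed (auto intro: exI[of _ s])
  then obtain b where b: "\<And>n. [b n = s] (mod ?p)" "\<And>n. [(b n)\<^sup>2 = ?x n] (mod ?p ^ n)" by metis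
  have ps: "\<not> ?p dvd s"
    using x1[of 1] s[of 1] by (metis cong_dvd_iff dvd_mult less_numeral_extra(1) power2_eq_square)
  have p2: "\<not> ?p dvd 2"
    using odd card_prime_int[where 'p='p]
    by (metis even_of_nat primes_dvd_imp_eq two_is_prime_nat prime_nat_int_transfer of_nat_numeral dvd_refl)
  have "[b (Suc n) = b n] (mod ?p ^ n)" for n
  proof -
    have "[(b (Suc n))\<^sup>2 = ?x (Suc n)] (mod ?p ^ n)" by (rule cong_dvd_modulus[OF b(2)]) simp
    then have "[(b (Suc n))\<^sup>2 = (b n)\<^sup>2] (mod ?p ^ n)"
      using b(2)[of n] Rep_padic_int_Suc[of x n] by (meson cong_trans cong_sym)
    then have d: "?p ^ n dvd (b (Suc n) - b n) * (b (Suc n) + b n)"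
      by (simp add: cong_iff_dvd_diff power2_eq_square algebra_simps)
    have "[b (Suc n) + b n = s + s] (mod ?p)" by (intro cong_add b)
    then have "\<not> ?p dvd b (Suc n) + b n"
      using ps p2 card_prime_int[where 'p='p] by (metis cong_dvd_iff mult_2 prime_dvd_mult_iff)
    then have "coprime (?p ^ n) (b (Suc n) + b n)"
      using card_prime_int[where 'p='p] by (simp add: prime_imp_coprime)
    with d show ?thesis by (simp add: cong_iff_dvd_diff coprime_dvd_mult_left_iff)
  qed
  then obtain y :: "'p padic_int" where y: "\<And>k. Rep_padic_int y k = b k mod ?p ^ k"
    using padic_int_limit by blast
  have "x = y\<^sup>2"
    by (rule padic_int_eqI)
      (use b(2) in \<open>auto simp: power2_eq_square times_padic_int.rep_eq y cong_def mod_mult_eq\<close>)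
  then show ?thesis ..
qed

section \<open>p-adic numbers\<close>

lemma Zp_closed [simp]:
  "0 \<in> Zp" "1 \<in> Zp" "of_nat n \<in> Zp" "of_int k \<in> Zp"
  "x \<in> Zp \<Longrightarrow> y \<in> Zp \<Longrightarrow> x + y \<in> Zp" "x \<in> Zp \<Longrightarrow> y \<in> Zp \<Longrightarrow> x * y \<in> Zp"
  "x \<in> Zp \<Longrightarrow> y \<in> Zp \<Longrightarrow> x - y \<in> Zp" "x \<in> Zp \<Longrightarrow> - x \<in> Zp" "x \<in> Zp \<Longrightarrow> x ^ n \<in> Zp"
proof -
  show 0: "0 \<in> Zp" "1 \<in> Zp" by (auto simp: Zp_def Zero_fract_def One_fract_def)
  show add: "x + y \<in> Zp" if "x \<in> Zp" "y \<in> Zp" for x y using that by (auto simp: Zp_def)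
  show mult: "x * y \<in> Zp" if "x \<in> Zp" "y \<in> Zp" for x y using that by (auto simp: Zp_def)
  show um: "- x \<in> Zp" if "x \<in> Zp" for x using that by (auto simp: Zp_def)
  show "x - y \<in> Zp" if "x \<in> Zp" "y \<in> Zp" for x y using add[OF that(1) um[OF that(2)]] by simp
  show nat: "of_nat n \<in> Zp" for n by (auto simp: Zp_def of_nat_fract)
  show "of_int k \<in> Zp" for k
    by (cases k rule: int_cases2) (auto simp: nat um)
  show "x ^ n \<in> Zp" if "x \<in> Zp" for x n by (induction n) (auto simp: 0 mult that)
qed

lemma pp_nonzero [simp]: "(pp :: 'p::prime_card qp) \<noteq> 0"
proof
  assume "(pp :: 'p qp) = 0"
  then have "(of_nat CARD('p) :: 'p padic_int) = 0"
    by (simp add: of_nat_fract Zero_fract_def eq_fract)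
  then have "Rep_padic_int (of_nat CARD('p) :: 'p padic_int) 2 = 0" by (simp add: zero_padic_int.rep_eq)
  moreover have "int CARD('p) < int CARD('p) ^ 2"
    using prime_gt_1_nat[OF prime_card[where 'a='p]] by (simp add: power2_eq_square)
  ultimately show False by (simp add: Rep_padic_int_of_nat zero_less_card_finite)
qed

lemma Fract_mem_Zp_units: "Fract (a :: 'p::prime_card padic_int) 1 \<in> Zp_units \<longleftrightarrow> Rep_padic_int a 1 \<noteq> 0"
proof
  assume "Fract a 1 \<in> Zp_units"
  then obtain b where "inverse (Fract a 1) = Fract b 1" "Fract a 1 \<noteq> 0"
    by (auto simp: Zp_units_def Zp_def)
  then have "Fract a 1 * Fract b 1 = 1" by (metis right_inverse)
  then have "a * b = 1" by (simp add: One_fract_def eq_fract)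
  then have "Rep_padic_int (a * b) 1 = 1"
    using prime_gt_1_nat[OF prime_card[where 'a='p]] by (simp add: one_padic_int.rep_eq)
  then show "Rep_padic_int a 1 \<noteq> 0" by (auto simp: times_padic_int.rep_eq)
next
  assume "Rep_padic_int a 1 \<noteq> 0"
  then obtain b where "a * b = 1" using padic_int_invertible by blast
  then have ab: "Fract a 1 * Fract b 1 = 1" by (simp add: One_fract_def)
  then have "Fract a 1 \<noteq> 0" by (metis mult_zero_left zero_neq_one)
  moreover have "inverse (Fract a 1) = Fract b 1" using ab by (rule inverse_unique)
  ultimately show "Fract a 1 \<in> Zp_units" by (simp add: Zp_units_def Zp_def)
qed

lemma Fract_mem_pZ_1: "Fract (a :: 'p::prime_card padic_int) 1 \<in> pZ 1 \<longleftrightarrow> Rep_padic_int a 1 = 0"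
proof
  assume "Fract a 1 \<in> pZ 1"
  then have "\<exists>b. a = of_nat CARD('p) * b"
    by (auto simp: pZ_def Zp_def of_nat_fract eq_fract(1))
  then obtain b where "a = of_nat CARD('p) * b" ..
  then show "Rep_padic_int a 1 = 0" by (simp add: times_padic_int.rep_eq Rep_padic_int_of_nat)
next
  assume "Rep_padic_int a 1 = 0"
  then obtain b where "a = of_nat CARD('p) ^ 1 * b" using padic_int_divisible by blast
  then show "Fract a 1 \<in> pZ 1"
    by (auto simp: pZ_def Zp_def of_nat_fract intro!: image_eqI[of _ _ "Fract b 1"])
qed

lemma Zp_cases:
  assumes "z \<in> Zp"
  obtains "z \<in> Zp_units" | "z \<in> pZ 1"
  using assms Fract_mem_pZ_1 Fract_mem_Zp_units unfolding Zp_def by blast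

lemma Zp_units_imp_Zp [simp]: "u \<in> Zp_units \<Longrightarrow> u \<in> Zp"
  and Zp_units_nonzero [simp]: "u \<in> Zp_units \<Longrightarrow> u \<noteq> 0"
  by (auto simp: Zp_units_def)

lemma zero_not_Zp_units [simp]: "0 \<notin> Zp_units"
  using Zp_units_nonzero by blast

lemma Zp_units_not_pZ: "u \<in> Zp_units \<Longrightarrow> u \<notin> pZ 1"
  using Fract_mem_pZ_1 Fract_mem_Zp_units Zp_units_imp_Zp unfolding Zp_def by blast

lemma Zp_units_closed [simp]:
  "1 \<in> Zp_units" "u \<in> Zp_units \<Longrightarrow> v \<in> Zp_units \<Longrightarrow> u * v \<in> Zp_units"
  "u \<in> Zp_units \<Longrightarrow> inverse u \<in> Zp_units" "u \<in> Zp_units \<Longrightarrow> - u \<in> Zp_units"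
  by (simp_all add: Zp_units_def del: Zp_units_imp_Zp Zp_units_nonzero)

lemma Zp_units_power [simp]: "u \<in> Zp_units \<Longrightarrow> u ^ n \<in> Zp_units"
  by (induction n) auto

lemma pZ_closed [simp]:
  "0 \<in> pZ r" "x \<in> pZ r \<Longrightarrow> y \<in> pZ r \<Longrightarrow> x + y \<in> pZ r" "x \<in> pZ r \<Longrightarrow> - x \<in> pZ r"
  "x \<in> pZ r \<Longrightarrow> y \<in> pZ r \<Longrightarrow> x - y \<in> pZ r"
  "x \<in> pZ r \<Longrightarrow> z \<in> Zp \<Longrightarrow> x * z \<in> pZ r" "x \<in> pZ r \<Longrightarrow> z \<in> Zp \<Longrightarrow> z * x \<in> pZ r"
proof -
  have iff: "y \<in> pZ r \<longleftrightarrow> (\<exists>z\<in>Zp. y = pp powi r * z)" for y by (auto simp: pZ_def)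
  show "0 \<in> pZ r" by (auto simp: pZ_def intro!: image_eqI[of _ _ 0])
  show "x + y \<in> pZ r" if "x \<in> pZ r" "y \<in> pZ r"
    using that unfolding iff by (metis Zp_closed(5) distrib_left)
  show "- x \<in> pZ r" if "x \<in> pZ r"
    using that unfolding iff by (metis Zp_closed(8) mult_minus_right)
  show "x - y \<in> pZ r" if "x \<in> pZ r" "y \<in> pZ r"
    using that unfolding iff by (metis Zp_closed(7) right_diff_distrib)
  show "x * z \<in> pZ r" "z * x \<in> pZ r" if "x \<in> pZ r" "z \<in> Zp"
    using that by (auto simp: pZ_def mult.assoc mult.left_commute)
qed

lemma pZ_0: "pZ 0 = Zp"
  by (simp add: pZ_def)

lemma pp_powi_mem_Zp: "0 \<le> n \<Longrightarrow> (pp :: 'p::prime_card qp) powi n \<in> Zp"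
  by (simp add: power_int_def)

lemma pZ_mult: "x \<in> pZ r \<Longrightarrow> y \<in> pZ s \<Longrightarrow> x * y \<in> pZ (r + s)"
  by (auto simp: pZ_def power_int_add mult.assoc mult.left_commute intro!: imageI)

lemma pZ_mono:
  assumes "s \<le> r" "x \<in> pZ r" shows "x \<in> pZ s"
proof -
  have "pp powi (r - s) \<in> pZ 0" using assms by (simp add: pZ_0 pp_powi_mem_Zp)
  moreover from assms obtain z where z: "z \<in> Zp" "x = pp powi r * z" by (auto simp: pZ_def)
  ultimately have "pp powi s * (pp powi (r - s) * z) \<in> pZ s" by (auto simp: pZ_def pZ_0 intro!: imageI Zp_closed)
  moreover have "pp powi s * (pp powi (r - s) * z) = x"
    by (simp add: z mult.assoc[symmetric] flip: power_int_add)
  ultimately show ?thesis by simp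
qed

lemma pZ_imp_Zp: "0 \<le> r \<Longrightarrow> x \<in> pZ r \<Longrightarrow> x \<in> Zp"
  using pZ_mono[of 0 r x] by (simp add: pZ_0)

lemma pp_powi_mem_pZ: "pp powi r \<in> pZ r"
  by (auto simp: pZ_def intro!: image_eqI[of _ _ 1])

lemma pp_power_mem_pZ: "pp ^ n \<in> pZ (int n)"
  using pp_powi_mem_pZ[of "int n"] by simp

lemma one_plus_pZ_unit: "z \<in> pZ 1 \<Longrightarrow> 1 + z \<in> Zp_units"
proof (rule ccontr)
  assume z: "z \<in> pZ 1" "1 + z \<notin> Zp_units"
  then have "1 + z \<in> pZ 1" using Zp_cases[of "1 + z"] pZ_imp_Zp[of 1 z] by auto
  then have "1 + z - z \<in> pZ 1" using z pZ_closed(4) by blast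
  then show False using Zp_units_not_pZ Zp_units_closed(1) by force
qed

lemma unit_plus_pZ: "u \<in> Zp_units \<Longrightarrow> z \<in> pZ 1 \<Longrightarrow> u + z \<in> Zp_units"
proof -
  assume u: "u \<in> Zp_units" and z: "z \<in> pZ 1"
  have "inverse u * z \<in> pZ 1" using u z by simp
  then have "u * (1 + inverse u * z) \<in> Zp_units" using one_plus_pZ_unit u by (intro Zp_units_closed)
  then show ?thesis using u by (simp add: distrib_left flip: mult.assoc)
qed

text \<open>The valuation is one less than the first index with a nonzero residue; the residue at
  index 0 is always 0.\<close>

lemma padic_int_decomp:
  assumes "a \<noteq> (0 :: 'p::prime_card padic_int)"
  shows "\<exists>n b. a = of_nat CARD('p) ^ n * b \<and> Rep_padic_int b 1 \<noteq> 0"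
proof -
  have "\<exists>n. Rep_padic_int a n \<noteq> 0"
    using assms padic_int_eqI[of a 0] by (auto simp: zero_padic_int.rep_eq)
  define N where "N = (LEAST n. Rep_padic_int a n \<noteq> 0)"
  have N: "Rep_padic_int a N \<noteq> 0" unfolding N_def by (rule LeastI_ex) fact
  have "Rep_padic_int a 0 = 0" using Rep_padic_int_range[of a 0] by simp
  with N obtain n where n: "N = Suc n" by (cases N) auto
  then have "Rep_padic_int a n = 0" unfolding N_def using not_less_Least by (metis lessI)
  then obtain b where b: "a = of_nat CARD('p) ^ n * b" using padic_int_divisible by blast
  have "Rep_padic_int b 1 \<noteq> 0"
  proof
    assume "Rep_padic_int b 1 = 0"
    then obtain c where "b = of_nat CARD('p) ^ 1 * c" using padic_int_divisible by blast
    then have "a = of_nat (CARD('p) ^ N) * c" by (simp add: b n)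
    then have "Rep_padic_int a N = 0"
      using Rep_padic_int_of_nat[of "CARD('p) ^ N" N, where 'p='p] by (simp add: times_padic_int.rep_eq)
    with N show False ..
  qed
  with b show ?thesis by blast
qed

lemma qp_decomp:
  assumes "x \<noteq> (0 :: 'p::prime_card qp)"
  obtains n u where "u \<in> Zp_units" "x = pp powi n * u"
proof -
  obtain a b where ab: "x = Fract a b" "a \<noteq> 0" "b \<noteq> 0"
    using assms by (metis Fract_cases_nonzero)
  obtain n a' where a: "a = of_nat CARD('p) ^ n * a'" "Rep_padic_int a' 1 \<noteq> 0"
    using padic_int_decomp[OF ab(2)] by blast
  obtain m b' where b: "b = of_nat CARD('p) ^ m * b'" "Rep_padic_int b' 1 \<noteq> 0"
    using padic_int_decomp[OF ab(3)] by blast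
  have pw: "pp ^ k = (Fract (of_nat CARD('p) ^ k) 1 :: 'p qp)" for k
    using of_nat_fract[of "CARD('p) ^ k", where 'a="'p padic_int"] by simp
  have "x = Fract a 1 * inverse (Fract b 1)" by (simp add: ab)
  also have "\<dots> = pp ^ n * Fract a' 1 * inverse (pp ^ m * Fract b' 1)"
    by (simp add: a b pw)
  also have "\<dots> = pp powi (int n - int m) * (Fract a' 1 * inverse (Fract b' 1))"
    by (simp add: power_int_diff divide_inverse)
  finally show ?thesis using that a b Fract_mem_Zp_units by (metis Zp_units_closed(2,3))
qed

text \<open>One inequality suffices: uniqueness of the exponent follows by applying it in both
  directions.\<close>

lemma qp_decomp_unique_le:
  assumes "u \<in> Zp_units" "v \<in> Zp_units" "pp powi n * u = pp powi m * v"
  shows "m \<le> n"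
proof (rule ccontr)
  assume "\<not> m \<le> n"
  have "u = pp powi (m - n) * v" using assms(3) by (simp add: power_int_diff field_simps)
  then have "u \<in> pZ (m - n)" using assms(2) by (auto simp: pZ_def)
  then have "u \<in> pZ 1" using pZ_mono[of 1 "m - n"] \<open>\<not> m \<le> n\<close> by simp
  then show False using Zp_units_not_pZ assms(1) by blast
qed

lemma ord_p_eq: "u \<in> Zp_units \<Longrightarrow> ord_p (pp powi n * u) = n"
  unfolding ord_p_def
  by (rule the_equality) (auto dest: qp_decomp_unique_le qp_decomp_unique_le[OF _ _ sym] intro: antisym)

lemma ord_p_unit: "u \<in> Zp_units \<Longrightarrow> ord_p u = 0"
  using ord_p_eq[of u 0] by simp

definition unit_part :: "'p::prime_card qp \<Rightarrow> 'p qp" where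
  "unit_part x = pp powi (- ord_p x) * x"

lemma unit_part_unit: "x \<noteq> 0 \<Longrightarrow> unit_part x \<in> Zp_units"
  by (erule qp_decomp) (auto simp: unit_part_def ord_p_eq power_int_minus simp flip: mult.assoc)

lemma ord_p_unit_part: "pp powi (ord_p x) * unit_part x = x"
  by (simp add: unit_part_def power_int_minus flip: mult.assoc)

lemma ord_p_mult: "x \<noteq> 0 \<Longrightarrow> y \<noteq> 0 \<Longrightarrow> ord_p (x * y) = ord_p x + ord_p y"
proof -
  assume xy: "x \<noteq> 0" "y \<noteq> 0"
  have "x * y = pp powi (ord_p x) * unit_part x * (pp powi (ord_p y) * unit_part y)"
    by (simp only: ord_p_unit_part)
  also have "\<dots> = pp powi (ord_p x + ord_p y) * (unit_part x * unit_part y)"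
    by (simp add: power_int_add)
  finally show ?thesis using ord_p_eq unit_part_unit xy by (metis Zp_units_closed(2))
qed

lemma unit_part_mult: "x \<noteq> 0 \<Longrightarrow> y \<noteq> 0 \<Longrightarrow> unit_part (x * y) = unit_part x * unit_part y"
  by (simp add: unit_part_def ord_p_mult power_int_diff power_int_minus divide_inverse)

lemma unit_if_square_unit:
  assumes "y\<^sup>2 \<in> Zp_units" shows "y \<in> Zp_units"
proof -
  have y0: "y \<noteq> 0" using assms by auto
  have "ord_p (y\<^sup>2) = 2 * ord_p y" using y0 by (simp add: power2_eq_square ord_p_mult)
  then have "ord_p y = 0" using ord_p_unit[OF assms] by simp
  then show ?thesis using unit_part_unit[OF y0] by (simp add: unit_part_def)
qed

subsection \<open>Residues and squares\<close>

lemma of_int_fract: "(of_int k :: 'a::idom fract) = Fract (of_int k) 1"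
  by (cases k rule: int_cases2) (auto simp: of_nat_fract)

lemma of_int_mem_pZ_1: "(of_int k :: 'p::prime_card qp) \<in> pZ 1 \<longleftrightarrow> int CARD('p) dvd k"
  by (simp add: of_int_fract Fract_mem_pZ_1 Rep_padic_int_of_int dvd_eq_mod_eq_0)

lemma residue_exists:
  assumes "z \<in> Zp"
  shows "\<exists>!n. 0 \<le> n \<and> n < int CARD('p) \<and> z - of_int n \<in> (pZ 1 :: 'p::prime_card qp set)"
proof -
  from assms obtain a where z: "z = Fract a 1" by (auto simp: Zp_def)
  let ?n = "Rep_padic_int a 1"
  have "z - of_int ?n = Fract (a - of_int ?n) 1" by (simp add: z of_int_fract)
  moreover have "Rep_padic_int (a - of_int ?n) 1 = 0"
    by (simp add: Rep_padic_int_diff Rep_padic_int_of_int mod_diff_right_eq)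
  ultimately have 1: "z - of_int ?n \<in> pZ 1" by (simp add: Fract_mem_pZ_1)
  show ?thesis
  proof (rule ex1I)
    show "0 \<le> ?n \<and> ?n < int CARD('p) \<and> z - of_int ?n \<in> pZ 1"
      using 1 Rep_padic_int_range[of a 1] by simp
    fix m assume m: "0 \<le> m \<and> m < int CARD('p) \<and> z - of_int m \<in> pZ 1"
    have "(z - of_int ?n) - (z - of_int m) \<in> pZ 1" using 1 m pZ_closed(4) by blast
    then have "int CARD('p) dvd m - ?n" by (simp flip: of_int_mem_pZ_1[where 'p='p])
    then have "m mod int CARD('p) = ?n mod int CARD('p)" by (simp add: mod_eq_dvd_iff)
    then show "m = ?n" using m Rep_padic_int_range[of a 1] by simp
  qed
qed

lemma residue_spec:
  assumes "z \<in> Zp"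
  shows "0 \<le> residue z" "residue z < int CARD('p)" "z - of_int (residue z) \<in> (pZ 1 :: 'p::prime_card qp set)"
  using theI'[OF residue_exists[OF assms]] unfolding residue_def by auto

lemma residue_cong:
  assumes "z - of_int n \<in> (pZ 1 :: 'p::prime_card qp set)"
  shows "residue z = n mod int CARD('p)"
proof -
  have z: "z \<in> Zp"
    using pZ_imp_Zp[OF _ assms] Zp_closed(5)[of "z - of_int n" "of_int n"] by simp
  have "(z - of_int n) - (z - of_int (residue z)) \<in> pZ 1"
    using assms residue_spec(3)[OF z] pZ_closed(4) by blast
  then have "int CARD('p) dvd residue z - n" by (simp flip: of_int_mem_pZ_1[where 'p='p])
  then have "residue z mod int CARD('p) = n mod int CARD('p)" by (simp add: mod_eq_dvd_iff)
  then show ?thesis using residue_spec[OF z] by simp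
qed

lemma residue_eq_iff:
  assumes "z \<in> Zp" "w \<in> Zp"
  shows "residue z = residue w \<longleftrightarrow> z - w \<in> (pZ 1 :: 'p::prime_card qp set)"
proof
  assume "residue z = residue w"
  moreover have "(z - of_int (residue z)) - (w - of_int (residue w)) \<in> pZ 1"
    using residue_spec(3)[OF assms(1)] residue_spec(3)[OF assms(2)] pZ_closed(4) by blast
  ultimately show "z - w \<in> pZ 1" by simp
next
  assume "z - w \<in> pZ 1"
  then have "(z - w) + (w - of_int (residue w)) \<in> pZ 1"
    using residue_spec(3)[OF assms(2)] pZ_closed(2) by blast
  then have "residue z = residue w mod int CARD('p)" by (intro residue_cong) simp
  then show "residue z = residue w" using residue_spec[OF assms(2)] by simp
qed

lemma residue_of_int: "residue (of_int n :: 'p::prime_card qp) = n mod int CARD('p)"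
  by (rule residue_cong) simp

lemma residue_mult:
  assumes "z \<in> Zp" "w \<in> Zp"
  shows "residue (z * w :: 'p::prime_card qp) = residue z * residue w mod int CARD('p)"
proof (rule residue_cong)
  have "(z - of_int (residue z)) * w + of_int (residue z) * (w - of_int (residue w)) \<in> pZ 1"
    using assms by (simp add: residue_spec(3))
  then show "z * w - of_int (residue z * residue w) \<in> pZ 1" by (simp add: algebra_simps)
qed

lemma residue_eq_0_iff: "z \<in> Zp \<Longrightarrow> residue z = 0 \<longleftrightarrow> z \<in> (pZ 1 :: 'p::prime_card qp set)"
  using residue_eq_iff[of z 0] residue_of_int[of 0, where 'p='p] by simp

lemma not_dvd_residue_unit: "u \<in> Zp_units \<Longrightarrow> \<not> int CARD('p) dvd residue (u :: 'p::prime_card qp)"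
  using residue_spec[of u] residue_eq_0_iff[of u] Zp_units_not_pZ[of u]
  by (auto dest: zdvd_imp_le)

text \<open>Bridge from \<open>QuadRes\<close> on integers to the p-adic form in which
  \<open>lam\<close> is assumed to be a nonsquare.\<close>

lemma legendre_p_eq_1_iff:
  assumes "u \<in> Zp_units"
  shows "legendre_p u = 1 \<longleftrightarrow> (\<exists>x\<in>Zp. u - x\<^sup>2 \<in> (pZ 1 :: 'p::prime_card qp set))"
proof -
  have "legendre_p u = 1 \<longleftrightarrow> QuadRes (int CARD('p)) (residue u)"
    using not_dvd_residue_unit[OF assms] by (simp add: legendre_p_def Legendre_def cong_0_iff)
  also have "\<dots> \<longleftrightarrow> (\<exists>x\<in>Zp. u - x\<^sup>2 \<in> pZ 1)"
  proof
    assume "QuadRes (int CARD('p)) (residue u)"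
    then obtain y where "[y\<^sup>2 = residue u] (mod int CARD('p))" by (auto simp: QuadRes_def)
    then have "residue u mod int CARD('p) = residue ((of_int y)\<^sup>2 :: 'p qp)"
      using residue_of_int[of "y\<^sup>2", where 'p='p] by (simp add: cong_def)
    then have "residue u = residue ((of_int y)\<^sup>2 :: 'p qp)" using residue_spec[of u] assms by simp
    then have "u - (of_int y)\<^sup>2 \<in> pZ 1" using assms residue_eq_iff[of u "(of_int y)\<^sup>2"] by simp
    then show "\<exists>x\<in>Zp. u - x\<^sup>2 \<in> pZ 1" by (meson Zp_closed(4))
  next
    assume "\<exists>x\<in>Zp. u - x\<^sup>2 \<in> pZ 1"
    then obtain x where x: "x \<in> Zp" "u - x\<^sup>2 \<in> pZ 1" by blast
    then have "residue u = residue (x * x)"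
      using assms residue_eq_iff[of u "x * x"] by (simp add: power2_eq_square)
    then have "residue u = residue x * residue x mod int CARD('p)" using x residue_mult by metis
    then have "[(residue x)\<^sup>2 = residue u] (mod int CARD('p))" by (simp add: cong_def power2_eq_square)
    then show "QuadRes (int CARD('p)) (residue u)" by (auto simp: QuadRes_def)
  qed
  finally show ?thesis .
qed

lemma legendre_p_values: "u \<in> Zp_units \<Longrightarrow> legendre_p u = 1 \<or> legendre_p (u :: 'p::prime_card qp) = - 1"
  using not_dvd_residue_unit[of u] by (auto simp: legendre_p_def Legendre_def cong_0_iff)

lemma legendre_p_cong:
  assumes "u \<in> Zp" "v \<in> Zp" "u - v \<in> pZ 1"
  shows "legendre_p u = legendre_p v"
  using assms residue_eq_iff[of u v] by (simp add: legendre_p_def)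

text \<open>A value of type \<open>itself\<close> makes the type variable \<open>'p\<close>, and
  with it the prime, a parameter of the locale.\<close>

locale odd_prime =
  fixes prime_type :: "'p::prime_card itself"
  assumes odd_p: "odd CARD('p)"
begin

lemma p_gt_2: "2 < CARD('p)"
  using odd_p prime_ge_2_nat[OF prime_card[where 'a='p]] by (cases "CARD('p) = 2") auto

text \<open>Euler's criterion gives the identity modulo p. Both sides are 1 or -1, so they differ by
  at most 2, which is less than p.\<close>

lemma legendre_p_mult:
  assumes "u \<in> Zp_units" "v \<in> (Zp_units :: 'p qp set)"
  shows "legendre_p (u * v) = legendre_p u * legendre_p v"
proof -
  let ?p = "int CARD('p)" and ?e = "(CARD('p) - 1) div 2"
  have eul: "[legendre_p x = residue x ^ ?e] (mod ?p)" for x :: "'p qp"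
    unfolding legendre_p_def using euler_criterion[OF prime_card p_gt_2] by simp
  have "[residue (u * v) = residue u * residue v] (mod ?p)"
    using assms by (simp add: residue_mult cong_def)
  then have "[residue (u * v) ^ ?e = residue u ^ ?e * residue v ^ ?e] (mod ?p)"
    by (metis cong_pow power_mult_distrib)
  then have "[legendre_p (u * v) = legendre_p u * legendre_p v] (mod ?p)"
    using eul by (meson cong_mult cong_sym cong_trans)
  then have d: "?p dvd legendre_p (u * v) - legendre_p u * legendre_p v"
    by (simp add: cong_iff_dvd_diff)
  have "\<bar>legendre_p (u * v) - legendre_p u * legendre_p v\<bar> \<le> 2"
    using legendre_p_values[of u] legendre_p_values[of v] legendre_p_values[of "u * v"] assms by auto
  then show ?thesis
    using dvd_imp_le_int[OF _ d] p_gt_2 by (cases "legendre_p (u * v) - legendre_p u * legendre_p v = 0") auto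
qed

text \<open>One direction is Hensel lifting. In the other, y is an arbitrary p-adic number, but a
  square root of a unit is a unit and hence integral.\<close>

lemma unit_square_iff:
  assumes "u \<in> (Zp_units :: 'p qp set)"
  shows "(\<exists>y. u = y\<^sup>2) \<longleftrightarrow> legendre_p u = 1"
proof
  assume "legendre_p u = 1"
  then obtain x where x: "x \<in> Zp" "u - x\<^sup>2 \<in> pZ 1" using legendre_p_eq_1_iff assms by blast
  from Zp_units_imp_Zp[OF assms] obtain a where a: "u = Fract a 1" unfolding Zp_def by blast
  from x obtain b where b: "x = Fract b 1" by (auto simp: Zp_def)
  have "Rep_padic_int (a - b * b) 1 = 0"
    using x by (simp add: a b power2_eq_square Fract_mem_pZ_1)
  then have "int CARD('p) dvd (Rep_padic_int a 1 - Rep_padic_int b 1 * Rep_padic_int b 1)"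
    by (simp add: Rep_padic_int_diff times_padic_int.rep_eq mod_diff_right_eq dvd_eq_mod_eq_0)
  then have "[(Rep_padic_int b 1)\<^sup>2 = Rep_padic_int a 1] (mod int CARD('p))"
    by (simp add: cong_iff_dvd_diff power2_eq_square dvd_diff_commute)
  then obtain c where "a = c\<^sup>2"
    using padic_int_sqrt[OF odd_p, of a] assms Fract_mem_Zp_units[of a] a by blast
  then have "u = (Fract c 1)\<^sup>2" by (simp add: a power2_eq_square)
  then show "\<exists>y. u = y\<^sup>2" ..
next
  assume "\<exists>y. u = y\<^sup>2"
  then obtain y where y: "u = y\<^sup>2" ..
  then have "y \<in> Zp_units" using assms unit_if_square_unit by blast
  then show "legendre_p u = 1" using legendre_p_eq_1_iff[OF assms] y by (auto intro!: bexI[of _ y])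
qed

lemma one_plus_pZ_square: "z \<in> (pZ 1 :: 'p qp set) \<Longrightarrow> \<exists>y. y \<noteq> 0 \<and> 1 + z = y\<^sup>2"
proof -
  assume z: "z \<in> (pZ 1 :: 'p qp set)"
  have "legendre_p (1 + z) = 1"
    using z one_plus_pZ_unit[OF z] legendre_p_eq_1_iff[of "1 + z"] by (auto intro!: bexI[of _ 1])
  then obtain y where "1 + z = y\<^sup>2" using unit_square_iff one_plus_pZ_unit[OF z] by blast
  then show ?thesis using Zp_units_nonzero[OF one_plus_pZ_unit[OF z]] by (intro exI[of _ y]) auto
qed

lemma square_iff:
  assumes "x \<noteq> (0 :: 'p qp)"
  shows "(\<exists>y. x = y\<^sup>2) \<longleftrightarrow> even (ord_p x) \<and> legendre_p (unit_part x) = 1"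
proof
  assume "\<exists>y. x = y\<^sup>2"
  then obtain y where y: "x = y\<^sup>2" "y \<noteq> 0" using assms by auto
  then have "ord_p x = 2 * ord_p y" "unit_part x = (unit_part y)\<^sup>2"
    by (auto simp: power2_eq_square ord_p_mult unit_part_mult)
  then show "even (ord_p x) \<and> legendre_p (unit_part x) = 1"
    using unit_square_iff[OF unit_part_unit[OF assms]] by auto
next
  assume "even (ord_p x) \<and> legendre_p (unit_part x) = 1"
  then obtain n y where "ord_p x = 2 * n" "unit_part x = y\<^sup>2"
    using unit_square_iff[OF unit_part_unit[OF assms]] by (auto elim!: evenE)
  then have "x = (pp powi n * y)\<^sup>2"
    using ord_p_unit_part[of x] by (simp add: power_mult_distrib power_int_mult mult.commute[of 2])
  then show "\<exists>y. x = y\<^sup>2" ..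
qed

end

section \<open>The Hilbert symbol\<close>

lemma hilbert_eq_1_iff:
  "hilbert a b = 1 \<longleftrightarrow> (\<exists>x y z. (x, y, z) \<noteq> (0, 0, 0) \<and> z\<^sup>2 = a * x\<^sup>2 + b * y\<^sup>2)"
  by (simp add: hilbert_def)

lemma hilbert_values: "hilbert a b = 1 \<or> hilbert a b = - 1"
  by (simp add: hilbert_def)

lemma hilbert_square_eq_1 [simp]: "hilbert a b * hilbert a b = 1" "hilbert a b * (hilbert a b * k) = k"
  using hilbert_values[of a b] by auto

lemma hilbert_commute: "hilbert a b = hilbert b a"
proof -
  have "hilbert b a = 1" if "hilbert a b = 1" for a b :: "'a qp"
    using that unfolding hilbert_eq_1_iff by (metis add.commute prod.inject)
  then show ?thesis using hilbert_values by metis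
qed

lemma hilbert_sum_square: "a + b = z\<^sup>2 \<Longrightarrow> hilbert a b = 1"
  unfolding hilbert_eq_1_iff by (intro exI[of _ 1] exI[of _ z]) auto

lemma hilbert_square_left: "hilbert (t\<^sup>2) b = 1"
  unfolding hilbert_eq_1_iff by (intro exI[of _ 1] exI[of _ 0] exI[of _ t]) auto

lemma hilbert_square_right: "hilbert b (t\<^sup>2) = 1"
  using hilbert_square_left hilbert_commute by metis

lemma hilbert_one [simp]: "hilbert 1 b = 1" "hilbert b 1 = 1"
  using hilbert_square_left[of 1] hilbert_square_right[of _ 1] by auto

lemma hilbert_mult_square:
  assumes "t \<noteq> 0" shows "hilbert a (b * t\<^sup>2) = hilbert a b"
proof -
  have *: "hilbert a (b * t\<^sup>2) = 1" if "hilbert a b = 1" "t \<noteq> 0" for b t :: "'a qp"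
  proof -
    from that obtain x y z where "(x, y, z) \<noteq> (0, 0, 0)" "z\<^sup>2 = a * x\<^sup>2 + b * y\<^sup>2"
      unfolding hilbert_eq_1_iff by blast
    then show ?thesis unfolding hilbert_eq_1_iff using that(2)
      by (intro exI[of _ x] exI[of _ "y / t"] exI[of _ z]) (auto simp: power_divide)
  qed
  have "hilbert a b = 1" if "hilbert a (b * t\<^sup>2) = 1"
    using *[OF that, of "inverse t"] assms by (simp add: power_inverse mult.assoc)
  with * assms show ?thesis using hilbert_values by metis
qed

text \<open>For nonsquare a the symbol is the norm symbol of the extension by sqrt a: a nontrivial
  solution with y = 0 would give a = (z/x)^2, so y can be divided out.\<close>

lemma hilbert_norm:
  assumes "\<not> (\<exists>t. a = t\<^sup>2)" "hilbert a b = 1"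
  shows "\<exists>z x. b = z\<^sup>2 - a * x\<^sup>2"
proof -
  from assms obtain x y z where nz: "(x, y, z) \<noteq> (0, 0, 0)" and e: "z\<^sup>2 = a * x\<^sup>2 + b * y\<^sup>2"
    unfolding hilbert_eq_1_iff by blast
  have y: "y \<noteq> 0"
  proof
    assume y: "y = 0"
    show False
    proof (cases "x = 0")
      case False
      then have "(z / x)\<^sup>2 = a" using e y by (simp add: power_divide)
      then show ?thesis using assms(1) by blast
    qed (use nz e y in auto)
  qed
  have "b = (z\<^sup>2 - a * x\<^sup>2) / y\<^sup>2" using e y by simp
  also have "\<dots> = (z / y)\<^sup>2 - a * (x / y)\<^sup>2" by (simp add: power_divide diff_divide_distrib)
  finally show ?thesis by blast
qed

lemma hilbert_one_mult:
  assumes "hilbert a b = 1" "hilbert a c = 1"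
  shows "hilbert a (b * c) = 1"
proof (cases "\<exists>t. a = t\<^sup>2")
  case True
  then show ?thesis using hilbert_square_left by blast
next
  case False
  obtain z x z' x' where bc: "b = z\<^sup>2 - a * x\<^sup>2" "c = z'\<^sup>2 - a * x'\<^sup>2"
    using hilbert_norm[OF False assms(1)] hilbert_norm[OF False assms(2)] by blast
  \<comment> \<open>Multiplicativity of the norm, from (z + x sqrt a)(z' + x' sqrt a). The
    coefficient 1 of b c makes the solution nontrivial.\<close>
  have "(z * z' + a * x * x')\<^sup>2 = a * (z * x' + x * z')\<^sup>2 + b * c * 1\<^sup>2"
    unfolding bc by (simp add: power2_eq_square algebra_simps)
  then show ?thesis unfolding hilbert_eq_1_iff by (metis prod.inject zero_neq_one)
qed

lemma hilbert_mult_if_one: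
  assumes "hilbert a b = 1" "b \<noteq> 0"
  shows "hilbert a (b * c) = hilbert a c"
proof -
  have "hilbert a (b * c) = 1" if "hilbert a c = 1" using that assms hilbert_one_mult by blast
  moreover have "hilbert a c = 1" if "hilbert a (b * c) = 1"
  proof -
    have "hilbert a (c * b\<^sup>2) = 1"
      using hilbert_one_mult[OF assms(1) that] by (simp add: power2_eq_square mult_ac)
    then show ?thesis using assms(2) by (simp add: hilbert_mult_square)
  qed
  ultimately show ?thesis using hilbert_values by metis
qed

section \<open>Bilinearity of the Hilbert symbol for odd p\<close>

context odd_prime
begin

text \<open>With the least non-residue \<open>n\<close>, the residue \<open>n - 1\<close> is a square \<open>s\<^sup>2\<close>, hence
  \<open>a (s\<^sup>2 + 1)\<close> is a square for every non-square unit \<open>a\<close>.\<close>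

lemma hilbert_nonsquare_unit_self:
  assumes a: "a \<in> (Zp_units :: 'p qp set)" "legendre_p a = - 1"
  shows "hilbert a a = 1"
proof -
  let ?P = "\<lambda>n::nat. \<exists>u::'p qp. u \<in> Zp_units \<and> u - of_nat n \<in> pZ 1 \<and> legendre_p u = - 1"
  have "a - of_nat (nat (residue a)) \<in> pZ 1" using residue_spec[of a] a(1) by simp
  with a have ex: "?P (nat (residue a))" by blast
  define n where "n = (LEAST n. ?P n)"
  from LeastI[of ?P, OF ex] obtain u :: "'p qp" where u: "u \<in> Zp_units" "u - of_nat n \<in> pZ 1" "legendre_p u = - 1"
    unfolding n_def by blast
  have "n \<noteq> 0" using u(1,2) Zp_units_not_pZ[of u] by (cases n) auto
  then obtain k where k: "n = Suc k" by (cases n) auto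
  obtain s where s: "s \<in> Zp" "of_nat k - s\<^sup>2 \<in> (pZ 1 :: 'p qp set)"
  proof -
    have kz: "of_nat k \<in> (Zp :: 'p qp set)" by simp
    then show ?thesis
    proof (cases rule: Zp_cases)
      case 1
      then have "\<not> ?P k" using not_less_Least[of k ?P] k unfolding n_def by simp
      then have "legendre_p (of_nat k :: 'p qp) = 1" using 1 legendre_p_values[OF 1] pZ_closed(1) by (metis diff_self)
      then show ?thesis using that legendre_p_eq_1_iff[OF 1] by blast
    next
      case 2
      then show ?thesis using that[of 0] by simp
    qed
  qed
  have "(u - of_nat n) + (of_nat k - s\<^sup>2) \<in> pZ 1" using u(2) s(2) by (rule pZ_closed(2))
  then have us: "u - (s\<^sup>2 + 1) \<in> pZ 1" by (simp add: k algebra_simps)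
  have "- (u - (s\<^sup>2 + 1)) \<in> pZ 1" using us by (rule pZ_closed)
  then have unit: "s\<^sup>2 + 1 \<in> Zp_units" using unit_plus_pZ[OF u(1)] by fastforce
  then have "legendre_p (s\<^sup>2 + 1) = - 1" using legendre_p_cong[OF _ _ us] u s by simp
  then have "legendre_p (a * (s\<^sup>2 + 1)) = 1" using legendre_p_mult[OF a(1) unit] a(2) by simp
  then obtain z where "a * (s\<^sup>2 + 1) = z\<^sup>2" using unit_square_iff[of "a * (s\<^sup>2 + 1)"] a(1) unit by auto
  then have "z\<^sup>2 = a * s\<^sup>2 + a * 1\<^sup>2" by (simp add: algebra_simps)
  then show ?thesis unfolding hilbert_eq_1_iff by (metis prod.inject zero_neq_one)
qed

text \<open>Two nonsquare units differ by a square factor, so the symbol of a and b is that of a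
  with itself, treated just before.\<close>

lemma hilbert_units:
  assumes "a \<in> Zp_units" "b \<in> (Zp_units :: 'p qp set)"
  shows "hilbert a b = 1"
proof (cases "legendre_p a = 1 \<or> legendre_p b = 1")
  case True
  then show ?thesis
    using unit_square_iff assms hilbert_square_left hilbert_square_right by metis
next
  case False
  then have l: "legendre_p a = - 1" "legendre_p b = - 1" using legendre_p_values assms by blast+
  then have "legendre_p (a * b) = 1" using legendre_p_mult assms by simp
  then obtain t where t: "a * b = t\<^sup>2" using unit_square_iff[of "a * b"] assms by auto
  have "t \<noteq> 0" using t Zp_units_nonzero[OF assms(1)] Zp_units_nonzero[OF assms(2)] by auto
  have "hilbert a b = hilbert a (b * a\<^sup>2)" using assms by (simp add: hilbert_mult_square)
  also have "b * a\<^sup>2 = a * t\<^sup>2" using t by (simp add: power2_eq_square mult_ac)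
  also have "hilbert a (a * t\<^sup>2) = hilbert a a" using \<open>t \<noteq> 0\<close> by (rule hilbert_mult_square)
  finally show ?thesis using hilbert_nonsquare_unit_self assms l by simp
qed

text \<open>Bilinearity of the symbol follows from this because there are only four square
  classes, told apart by the parity of the valuation and the Legendre symbol of the unit part.\<close>

lemma hilbert_norm_nonsquare:
  assumes "a \<noteq> (0 :: 'p qp)" "\<not> (\<exists>t. a = t\<^sup>2)"
  obtains n where "n \<noteq> 0" "hilbert a n = 1" "\<not> (\<exists>t. n = t\<^sup>2)"
proof (cases "even (ord_p a)")
  case True
  let ?u = "unit_part a"
  have u: "?u \<in> Zp_units" using assms(1) by (rule unit_part_unit)
  obtain m where m: "ord_p a = 2 * m" using True by (auto elim: evenE)
  have "(pp :: 'p qp) powi (2 * m) = (pp powi m)\<^sup>2" by (simp add: power_int_mult mult.commute[of 2])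
  then have a: "a = ?u * (pp powi m)\<^sup>2" using ord_p_unit_part[of a] by (simp add: m mult.commute)
  have "\<not> (\<exists>t. ?u = t\<^sup>2)"
  proof
    assume "\<exists>t. ?u = t\<^sup>2"
    then obtain t where "?u = t\<^sup>2" ..
    then have "a = (t * pp powi m)\<^sup>2" using a by (simp add: power_mult_distrib)
    then show False using assms(2) by blast
  qed
  moreover have "hilbert a ?u = hilbert ?u (?u * (pp powi m)\<^sup>2)" using a hilbert_commute by metis
  then have "hilbert a ?u = hilbert ?u ?u" using hilbert_mult_square[of "pp powi m"] by simp
  then have "hilbert a ?u = 1" using hilbert_units[OF u u] by simp
  ultimately show ?thesis using that Zp_units_nonzero[OF u] by blast
next
  case False
  have "hilbert a (- a) = 1" using hilbert_sum_square[of a "- a" 0] by simp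
  moreover have "(- 1 :: 'p qp) \<in> Zp_units" by simp
  then have "ord_p (- 1 * a) = ord_p a"
    using ord_p_mult[of "- 1 :: 'p qp" a] ord_p_unit[of "- 1 :: 'p qp"] assms(1) by simp
  then have "\<not> (\<exists>t. - a = t\<^sup>2)" using square_iff[of "- a"] False assms(1) by simp
  ultimately show ?thesis using that[of "- a"] assms(1) by simp
qed

text \<open>Only the case where both factors are -1 is left. The group of square classes has order
  4, so the classes of 1 and n form a subgroup of index 2, on which the symbol with a is trivial. As
  b and c lie outside it, b c lies inside: b c or n b c is a square.\<close>

lemma hilbert_mult_right:
  assumes "a \<noteq> 0" "b \<noteq> 0" "c \<noteq> (0 :: 'p qp)"
  shows "hilbert a (b * c) = hilbert a b * hilbert a c"
proof (cases "hilbert a b = 1 \<or> hilbert a c = 1")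
  case True
  then show ?thesis
    using hilbert_mult_if_one[of a b c] hilbert_mult_if_one[of a c b] assms by (auto simp: mult.commute)
next
  case False
  have "\<not> (\<exists>t. a = t\<^sup>2)" using False hilbert_square_left by blast
  with assms(1) obtain n where n: "n \<noteq> 0" "hilbert a n = 1" "\<not> (\<exists>t. n = t\<^sup>2)"
    by (rule hilbert_norm_nonsquare)
  have nb: "\<not> (\<exists>t. n * b = t\<^sup>2)" "\<not> (\<exists>t. n * c = t\<^sup>2)" "\<not> (\<exists>t. b = t\<^sup>2)" "\<not> (\<exists>t. c = t\<^sup>2)"
    using False hilbert_mult_if_one[OF n(2,1)] hilbert_square_right by metis+
  have L: "legendre_p (unit_part x) = 1 \<or> legendre_p (unit_part x) = - 1" if "x \<noteq> 0" for x :: "'p qp"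
    using that legendre_p_values unit_part_unit by blast
  have "(\<exists>t. b * c = t\<^sup>2) \<or> (\<exists>t. n * (b * c) = t\<^sup>2)"
    using n(3) nb L[of n] L[of b] L[of c] assms n(1)
    by (auto simp: square_iff ord_p_mult unit_part_mult legendre_p_mult unit_part_unit)
  then have "hilbert a (b * c) = 1"
    using hilbert_mult_if_one[OF n(2,1), of "b * c"] hilbert_square_right by metis
  then show ?thesis using False hilbert_values[of a b] hilbert_values[of a c] by auto
qed

lemma hilbert_mult_left:
  assumes "a \<noteq> 0" "b \<noteq> 0" "c \<noteq> (0 :: 'p qp)"
  shows "hilbert (a * b) c = hilbert a c * hilbert b c"
  using hilbert_mult_right[of c a b] assms by (metis hilbert_commute)

end

section \<open>Matrices\<close>

lemma mat2_nth [simp]: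
  "mat2 a b c d $ 1 $ 1 = a" "mat2 a b c d $ 1 $ 2 = b" "mat2 a b c d $ 2 $ 1 = c" "mat2 a b c d $ 2 $ 2 = d"
  by (simp_all add: mat2_def)

lemma mat2_eqI:
  assumes "A $ 1 $ 1 = B $ 1 $ 1" "A $ 1 $ 2 = B $ 1 $ 2" "A $ 2 $ 1 = B $ 2 $ 1" "A $ 2 $ 2 = B $ 2 $ 2"
  shows "A = (B :: 'p::prime_card mat2)"
  using assms by (simp add: vec_eq_iff forall_2)

lemma mat2_eta: "mat2 (A $ 1 $ 1) (A $ 1 $ 2) (A $ 2 $ 1) (A $ 2 $ 2) = A"
  by (rule mat2_eqI) simp_all

lemma mat2_eq_iff: "mat2 a b c d = mat2 a' b' c' d' \<longleftrightarrow> a = a' \<and> b = b' \<and> c = c' \<and> d = d'"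
  by (metis mat2_nth)

lemma matmul_nth:
  "((A :: 'p::prime_card mat2) ** B) $ i $ j = A $ i $ 1 * B $ 1 $ j + A $ i $ 2 * B $ 2 $ j"
  by (simp add: matrix_matrix_mult_def sum_2)

lemma mat2_mult [simp]:
  "mat2 a b c d ** mat2 a' b' c' d' = mat2 (a * a' + b * c') (a * b' + b * d') (c * a' + d * c') (c * b' + d * d')"
  by (rule mat2_eqI) (simp_all add: matmul_nth)

lemma mat_1_eq: "(mat 1 :: 'p::prime_card mat2) = mat2 1 0 0 1"
  by (rule mat2_eqI) (simp_all add: mat_def)

lemma det_mat2 [simp]: "det (mat2 a b c d) = a * d - b * c"
  by (simp add: det_2)

lemma mem_SL2: "A \<in> carrier SL2 \<longleftrightarrow> A $ 1 $ 1 * A $ 2 $ 2 - A $ 1 $ 2 * A $ 2 $ 1 = 1"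
  by (simp add: SL2_def det_2)

lemma mat2_mem_SL2 [simp]: "mat2 a b c d \<in> carrier SL2 \<longleftrightarrow> a * d - b * c = 1"
  by (simp add: mem_SL2)

lemma SL2_mult [simp]: "A \<in> carrier SL2 \<Longrightarrow> B \<in> carrier SL2 \<Longrightarrow> A ** B \<in> carrier SL2"
  by (simp add: SL2_def det_mul)

lemma SL2_one [simp]: "mat 1 \<in> carrier SL2"
  by (simp add: SL2_def)

text \<open>The adjugate, an explicit polynomial formula for the inverse on
  \<open>SL2\<close>.\<close>

definition adj2 :: "'p::prime_card mat2 \<Rightarrow> 'p mat2" where
  "adj2 A = mat2 (A $ 2 $ 2) (- A $ 1 $ 2) (- A $ 2 $ 1) (A $ 1 $ 1)"

lemma adj2_mem_SL2: "A \<in> carrier SL2 \<Longrightarrow> adj2 A \<in> carrier SL2"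
  by (simp add: adj2_def mem_SL2 mult.commute)

lemma adj2_mult:
  assumes "A \<in> carrier SL2" shows "adj2 A ** A = mat 1" "A ** adj2 A = mat 1"
  using assms by (auto intro!: mat2_eqI simp: adj2_def matmul_nth mem_SL2 mat_1_eq algebra_simps)

lemma xm_ym_hm_SL2 [simp]:
  "xm s \<in> carrier SL2" "ym s \<in> carrier SL2" "t \<noteq> 0 \<Longrightarrow> hm t \<in> carrier SL2"
  by (simp_all add: xm_def ym_def hm_def)

lemma xm_mult: "xm s ** xm t = xm (s + t)"
  and ym_mult: "ym s ** ym t = ym (s + t)"
  and hm_mult: "hm u ** hm v = hm (u * v)"
  and hm_xm: "t \<noteq> 0 \<Longrightarrow> hm t ** xm s = xm (s * t\<^sup>2) ** hm t"
  and hm_ym: "t \<noteq> 0 \<Longrightarrow> hm t ** ym s = ym (s / t\<^sup>2) ** hm t"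
  by (simp_all add: xm_def ym_def hm_def mat2_eq_iff field_simps power2_eq_square)

lemma xm_0 [simp]: "xm 0 = mat 1" and ym_0 [simp]: "ym 0 = mat 1" and hm_1 [simp]: "hm 1 = mat 1"
  by (simp_all add: xm_def ym_def hm_def mat_1_eq)

section \<open>The cocycle\<close>

lemma tau_entry_nonzero: "A \<in> carrier SL2 \<Longrightarrow> tau_entry A \<noteq> 0"
  by (auto simp: tau_entry_def mem_SL2)

lemma tau_entry_upper_left:
  assumes "g $ 2 $ 1 = 0" "g $ 2 $ 2 \<noteq> 0"
  shows "tau_entry (g ** h) = g $ 2 $ 2 * tau_entry h"
  using assms by (simp add: tau_entry_def matmul_nth)

text \<open>An identity up to squares is enough for Hilbert symbols. The square accounts for
  \<open>tau_entry\<close> being the lower right entry when the lower left one vanishes.\<close>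

lemma tau_entry_upper_right:
  assumes "h $ 2 $ 1 = 0" "h \<in> carrier SL2"
  shows "\<exists>e. tau_entry (g ** h) = tau_entry g * h $ 1 $ 1 * e\<^sup>2"
proof (cases "g $ 2 $ 1 = 0")
  case True
  have "tau_entry (g ** h) = tau_entry g * h $ 1 $ 1 * (h $ 2 $ 2)\<^sup>2"
    using assms True by (simp add: tau_entry_def matmul_nth mem_SL2 power2_eq_square)
  then show ?thesis ..
next
  case False
  then have "tau_entry (g ** h) = tau_entry g * h $ 1 $ 1 * 1\<^sup>2"
    using assms by (auto simp: tau_entry_def matmul_nth mem_SL2)
  then show ?thesis ..
qed

text \<open>This symbol is the quotient of the two sides of the cocycle identity for
  the Hilbert symbols of \<open>tau_entry\<close>; when no lower left entry vanishes it is trivial by the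
  Pluecker relation between the bottom rows.\<close>

lemma hilbert_tau_entry:
  assumes g: "g1 \<in> carrier SL2" "g2 \<in> carrier SL2" "g3 \<in> carrier SL2"
  defines "A \<equiv> tau_entry g1" and "B \<equiv> tau_entry g2" and "C \<equiv> tau_entry g3"
    and "D \<equiv> tau_entry (g1 ** g2)" and "E \<equiv> tau_entry (g2 ** g3)" and "F \<equiv> tau_entry (g1 ** g2 ** g3)"
  shows "hilbert (B * F * D * E) (A * C * D * E) = 1"
proof -
  consider "g1 $ 2 $ 1 = 0" | "g3 $ 2 $ 1 = 0" | "g2 $ 2 $ 1 = 0"
    | "g1 $ 2 $ 1 \<noteq> 0" "g2 $ 2 $ 1 \<noteq> 0" "g3 $ 2 $ 1 \<noteq> 0" by blast
  then show ?thesis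
  proof cases
    case 1
    then have "g1 $ 2 $ 2 \<noteq> 0" using g by (auto simp: mem_SL2)
    then have "D = g1 $ 2 $ 2 * B" "F = g1 $ 2 $ 2 * E"
      using 1 by (simp_all add: D_def F_def B_def E_def tau_entry_upper_left flip: matrix_mul_assoc)
    then have "B * F * D * E = (g1 $ 2 $ 2 * B * E)\<^sup>2" by (simp add: power2_eq_square)
    then show ?thesis using hilbert_square_left by metis
  next
    case 2
    obtain e f where "E = B * g3 $ 1 $ 1 * e\<^sup>2" "F = D * g3 $ 1 $ 1 * f\<^sup>2"
      using tau_entry_upper_right[OF 2 g(3)] unfolding E_def F_def B_def D_def by blast
    then have "B * F * D * E = (B * D * g3 $ 1 $ 1 * e * f)\<^sup>2" by (simp add: power2_eq_square)
    then show ?thesis using hilbert_square_left by metis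
  next
    case 3
    obtain e where e: "D = A * g2 $ 1 $ 1 * e\<^sup>2"
      using tau_entry_upper_right[OF 3 g(2)] unfolding A_def D_def by blast
    have d: "g2 $ 2 $ 2 \<noteq> 0" "g2 $ 1 $ 1 * g2 $ 2 $ 2 = 1" using 3 g by (auto simp: mem_SL2)
    then have "E = g2 $ 2 $ 2 * C" using 3 by (simp add: E_def C_def tau_entry_upper_left)
    then have "A * C * D * E = (g2 $ 1 $ 1 * g2 $ 2 $ 2) * (A * C * e)\<^sup>2" using e by (simp add: power2_eq_square)
    then have "A * C * D * E = (A * C * e)\<^sup>2" using d by simp
    then show ?thesis using hilbert_square_right by metis
  next
    case 4
    let ?c12 = "(g1 ** g2) $ 2 $ 1" and ?c23 = "(g2 ** g3) $ 2 $ 1" and ?c = "(g1 ** g2 ** g3) $ 2 $ 1"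
    have ABC: "A = g1 $ 2 $ 1" "B = g2 $ 2 $ 1" "C = g3 $ 2 $ 1" using 4 by (simp_all add: A_def B_def C_def tau_entry_def)
    have "B * ?c + A * C - ?c12 * ?c23 = A * C * (1 - (g2 $ 1 $ 1 * g2 $ 2 $ 2 - g2 $ 1 $ 2 * g2 $ 2 $ 1))"
      by (simp add: ABC matmul_nth algebra_simps)
    then have raw: "B * ?c + A * C = ?c12 * ?c23" using g(2) by (simp add: mem_SL2)
    have DEF: "?c12 \<noteq> 0 \<Longrightarrow> D = ?c12" "?c23 \<noteq> 0 \<Longrightarrow> E = ?c23" "?c \<noteq> 0 \<Longrightarrow> F = ?c"
      by (simp_all add: D_def E_def F_def tau_entry_def)
    show ?thesis
    proof (cases "?c12 = 0 \<or> ?c23 = 0")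
      case True
      then have "?c \<noteq> 0" using raw 4 ABC by auto
      \<comment> \<open>Where a lower left entry vanishes, D or E is the lower right one and the
        Pluecker relation says nothing about it. But now the two arguments of the symbol are
        opposite whatever D and E are.\<close>
      then have "B * F + A * C = 0" using True raw DEF by auto
      then have "(B * F + A * C) * D * E = 0\<^sup>2" by simp
      then have "B * F * D * E + A * C * D * E = 0\<^sup>2" by (simp add: distrib_right)
      then show ?thesis by (rule hilbert_sum_square)
    next
      case False
      show ?thesis
      proof (cases "?c = 0")
        case True
        then have "A * C * D * E = (D * E)\<^sup>2" using raw DEF False by (simp add: power2_eq_square)
        then show ?thesis using hilbert_square_right by metis
      next
        case c: False
        then have "(B * F + A * C) * D * E = (D * E)\<^sup>2" using raw DEF False by (simp add: power2_eq_square)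
        then have "B * F * D * E + A * C * D * E = (D * E)\<^sup>2" by (simp add: distrib_right)
        then show ?thesis by (rule hilbert_sum_square)
      qed
    qed
  qed
qed

lemma s_p_values: "s_p g = 1 \<or> s_p g = - 1"
  using hilbert_values by (auto simp: s_p_def)

lemma s_p_square [simp]: "s_p g * s_p g = 1" "s_p g * (s_p g * k) = k"
  using s_p_values[of g] by auto

lemma cocycle_values: "cocycle g h = 1 \<or> cocycle g h = - 1"
  using hilbert_values[of "tau_entry (g ** h) * tau_entry g" "tau_entry (g ** h) * tau_entry h"]
    s_p_values[of g] s_p_values[of h] s_p_values[of "g ** h"]
  unfolding cocycle_def by (elim disjE) simp_all

context odd_prime
begin

text \<open>The \<open>s_p\<close> factors form a coboundary: both sides carry the same four of
  them, the others being squared away. The remaining four symbols collapse by bilinearity to the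
  single one of \<open>hilbert_tau_entry\<close>.\<close>

lemma cocycle_identity:
  assumes g: "g1 \<in> carrier SL2" "g2 \<in> carrier SL2" "g3 \<in> (carrier SL2 :: 'p mat2 set)"
  shows "cocycle g1 g2 * cocycle (g1 ** g2) g3 = cocycle g1 (g2 ** g3) * cocycle g2 g3"
proof -
  define A B C D E F where "A = tau_entry g1" "B = tau_entry g2" "C = tau_entry g3"
    "D = tau_entry (g1 ** g2)" "E = tau_entry (g2 ** g3)" "F = tau_entry (g1 ** g2 ** g3)"
  note defs = this
  have nz: "A \<noteq> 0" "B \<noteq> 0" "C \<noteq> 0" "D \<noteq> 0" "E \<noteq> 0" "F \<noteq> 0"
    using g tau_entry_nonzero unfolding defs by (auto intro!: tau_entry_nonzero)
  have "hilbert (D * A) (D * B) * hilbert (F * D) (F * C) * (hilbert (F * A) (F * E) * hilbert (E * B) (E * C))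
      = hilbert (B * F * D * E) (A * C * D * E)"
    using nz by (simp add: hilbert_mult_left hilbert_mult_right mult_ac hilbert_commute)
  also have "\<dots> = 1" using hilbert_tau_entry[OF g] unfolding defs .
  finally have *: "hilbert (D * A) (D * B) * hilbert (F * D) (F * C) = hilbert (F * A) (F * E) * hilbert (E * B) (E * C)"
    by (metis zmult_eq_1_iff)
  have "cocycle g1 g2 * cocycle (g1 ** g2) g3 =
      (hilbert (D * A) (D * B) * hilbert (F * D) (F * C)) * (s_p g1 * s_p g2 * s_p g3 * s_p (g1 ** g2 ** g3))"
    unfolding cocycle_def defs by (simp add: mult_ac)
  moreover have "cocycle g1 (g2 ** g3) * cocycle g2 g3 =
      (hilbert (F * A) (F * E) * hilbert (E * B) (E * C)) * (s_p g1 * s_p g2 * s_p g3 * s_p (g1 ** g2 ** g3))"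
    unfolding cocycle_def defs by (simp add: mult_ac matrix_mul_assoc)
  ultimately show ?thesis using * by simp
qed

lemma cocycle_one:
  assumes "g \<in> (carrier SL2 :: 'p mat2 set)"
  shows "cocycle (mat 1) g = 1" "cocycle g (mat 1) = 1"
proof -
  have "tau_entry (mat 1 :: 'p mat2) = 1" "s_p (mat 1 :: 'p mat2) = 1"
    by (simp_all add: tau_entry_def s_p_def mat_1_eq)
  then show "cocycle (mat 1) g = 1" "cocycle g (mat 1) = 1"
    by (simp_all add: cocycle_def matrix_mul_lid matrix_mul_rid
        hilbert_square_left[of "tau_entry g", unfolded power2_eq_square]
        hilbert_square_right[of _ "tau_entry g", unfolded power2_eq_square])
qed

lemma Mp_simps:
  "(g, e) \<otimes>\<^bsub>Mp\<^esub> (h, e') = (g ** h, e * e' * cocycle g h)"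
  "\<one>\<^bsub>Mp\<^esub> = (mat 1, 1)"
  "(g, e) \<in> carrier Mp \<longleftrightarrow> g \<in> carrier SL2 \<and> (e = 1 \<or> e = - 1)"
  by (auto simp: Mp_def cover_preimage_def)

lemma group_Mp: "group (Mp :: ('p mat2 \<times> int) monoid)"
proof (rule groupI)
  fix x y z :: "'p mat2 \<times> int"
  obtain g e g' e' g'' e'' where xyz: "x = (g, e)" "y = (g', e')" "z = (g'', e'')" by (metis surj_pair)
  assume x: "x \<in> carrier Mp"
  have x': "g \<in> carrier SL2" "e = 1 \<or> e = - 1" using x by (auto simp: xyz Mp_simps)
  show "\<one>\<^bsub>Mp\<^esub> \<otimes>\<^bsub>Mp\<^esub> x = x"
    using x' by (simp add: xyz Mp_simps cocycle_one matrix_mul_lid)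
  show "\<exists>y\<in>carrier Mp. y \<otimes>\<^bsub>Mp\<^esub> x = \<one>\<^bsub>Mp\<^esub>"
    using x' adj2_mem_SL2[OF x'(1)] adj2_mult[OF x'(1)] cocycle_values[of "adj2 g" g]
    by (intro bexI[of _ "(adj2 g, e * cocycle (adj2 g) g)"]) (auto simp: xyz Mp_simps)
  assume y: "y \<in> carrier Mp"
  have y': "g' \<in> carrier SL2" "e' = 1 \<or> e' = - 1" using y by (auto simp: xyz Mp_simps)
  show "x \<otimes>\<^bsub>Mp\<^esub> y \<in> carrier Mp"
    using x' y' cocycle_values[of g g'] by (auto simp: xyz Mp_simps)
  assume z: "z \<in> carrier Mp"
  then have z': "g'' \<in> carrier SL2" by (auto simp: xyz Mp_simps)
  show "x \<otimes>\<^bsub>Mp\<^esub> y \<otimes>\<^bsub>Mp\<^esub> z = x \<otimes>\<^bsub>Mp\<^esub> (y \<otimes>\<^bsub>Mp\<^esub> z)"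
    using cocycle_identity[OF x'(1) y'(1) z'] by (simp add: xyz Mp_simps matrix_mul_assoc mult_ac)
qed (simp add: Mp_simps)

end

section \<open>Congruence subgroups of the cover\<close>

lemma mem_K_zero: "A \<in> K_zero \<longleftrightarrow> A \<in> carrier SL2 \<and> A $ 1 $ 1 \<in> Zp \<and> A $ 1 $ 2 \<in> Zp \<and> A $ 2 $ 1 \<in> Zp \<and> A $ 2 $ 2 \<in> Zp"
  by (auto simp: K_zero_def forall_2)

lemma mem_K_level: "A \<in> K_level r \<longleftrightarrow> A \<in> carrier SL2 \<and> A $ 1 $ 1 \<in> Zp \<and> A $ 1 $ 2 \<in> Zp \<and> A $ 2 $ 1 \<in> pZ (int r) \<and> A $ 2 $ 2 \<in> Zp"
  using pZ_imp_Zp[of "int r"] by (auto simp: K_level_def mem_K_zero)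

lemma K_level_mult [simp]: "A \<in> K_level r \<Longrightarrow> B \<in> K_level r \<Longrightarrow> A ** B \<in> K_level r"
  by (simp add: mem_K_level matmul_nth pZ_imp_Zp[of "int r"])

lemma K_level_adj2 [simp]: "A \<in> K_level r \<Longrightarrow> adj2 A \<in> K_level r"
  by (auto simp: mem_K_level adj2_mem_SL2) (auto simp: adj2_def)

lemma K_level_one [simp]: "mat 1 \<in> K_level r"
  by (simp add: mem_K_level) (simp add: mat_1_eq)

lemma K_level_mono: "r \<le> r' \<Longrightarrow> A \<in> K_level r' \<Longrightarrow> A \<in> K_level r"
  by (auto simp: mem_K_level intro: pZ_mono[of "int r" "int r'"])

lemma Zp_units_factor:
  assumes "x \<in> Zp" "y \<in> Zp" "x * y \<in> Zp_units"
  shows "x \<in> Zp_units" "y \<in> Zp_units"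
proof -
  have *: "x \<in> Zp_units" if "x \<in> Zp" "y \<in> Zp" "x * y \<in> Zp_units" for x y :: "'a qp"
  proof (rule ccontr)
    assume "x \<notin> Zp_units"
    then have "x \<in> pZ 1" using that(1) Zp_cases by blast
    then have "x * y \<in> pZ 1" using that(2) by simp
    then show False using Zp_units_not_pZ that(3) by blast
  qed
  show "x \<in> Zp_units" "y \<in> Zp_units" using *[of x y] *[of y x] assms by (simp_all add: mult.commute)
qed

lemma K_level_diag_units:
  assumes "A \<in> K_level r" "r \<ge> 1"
  shows "A $ 1 $ 1 \<in> Zp_units" "A $ 2 $ 2 \<in> Zp_units"
proof -
  have A: "A $ 1 $ 1 * A $ 2 $ 2 = 1 + A $ 1 $ 2 * A $ 2 $ 1" "A $ 2 $ 1 \<in> pZ 1"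
    using assms pZ_mono[of 1 "int r"] by (auto simp: mem_K_level mem_SL2 algebra_simps)
  then have "A $ 1 $ 1 * A $ 2 $ 2 \<in> Zp_units"
    using assms(1) one_plus_pZ_unit[of "A $ 1 $ 2 * A $ 2 $ 1"] by (simp add: mem_K_level)
  then show "A $ 1 $ 1 \<in> Zp_units" "A $ 2 $ 2 \<in> Zp_units"
    using Zp_units_factor assms(1) by (auto simp: mem_K_level)
qed

text \<open>Gaussian elimination with the upper left entry as pivot, a unit because r >= 1. The
  splittings and the invariance of vectors are known on these three factors, so statements about
  \<open>K_level r\<close> are checked there.\<close>

lemma iwahori_decomp:
  assumes "A \<in> K_level r" "r \<ge> 1"
  obtains s u t where "s \<in> pZ (int r)" "u \<in> Zp_units" "t \<in> Zp" "A = ym s ** hm u ** xm t"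
proof -
  let ?u = "A $ 1 $ 1"
  have u: "?u \<in> Zp_units" using K_level_diag_units assms by blast
  have u0: "?u \<noteq> 0" using u by simp
  show ?thesis
  proof (rule that)
    show "A $ 2 $ 1 * inverse ?u \<in> pZ (int r)" "inverse ?u * A $ 1 $ 2 \<in> Zp"
      using assms u by (simp_all add: mem_K_level)
    show "?u \<in> Zp_units" by (rule u)
    have "A $ 2 $ 2 = A $ 2 $ 1 * (inverse ?u * A $ 1 $ 2) + inverse ?u"
      using assms(1) u0 by (simp add: mem_K_level mem_SL2 field_simps)
    then show "A = ym (A $ 2 $ 1 * inverse ?u) ** hm ?u ** xm (inverse ?u * A $ 1 $ 2)"
      using u0 by (intro mat2_eqI) (simp_all add: ym_def hm_def xm_def mult.assoc)
  qed
qed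

lemma ym_mem_K_level: "s \<in> pZ (int r) \<Longrightarrow> ym s \<in> K_level r"
  and xm_mem_K_level: "t \<in> Zp \<Longrightarrow> xm t \<in> K_level r"
  and hm_mem_K_level: "u \<in> Zp_units \<Longrightarrow> hm u \<in> K_level r"
  by (auto simp: mem_K_level) (auto simp: ym_def xm_def hm_def)

lemma K_level_subset_K_zero: "K_level r \<subseteq> K_zero"
  by (auto simp: K_level_def)

lemma hilbert_mult_square_left: "t \<noteq> 0 \<Longrightarrow> hilbert (a * t\<^sup>2) b = hilbert a b"
  using hilbert_mult_square[of t b a] by (metis hilbert_commute)

lemma hilbert_inverse: "u \<noteq> 0 \<Longrightarrow> hilbert x (inverse u) = hilbert x u"
  using hilbert_mult_square[of "inverse u" x u] by (simp add: power2_eq_square flip: mult.assoc)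

lemma is_splittingD:
  assumes "is_splitting K s" "k \<in> K"
  shows "s k = 1 \<or> s k = - 1"
    and "k' \<in> K \<Longrightarrow> s (k ** k') = s k * s k' * cocycle k k'"
  using assms unfolding is_splitting_def hom_def
  by (auto simp: Mp_def SL2_def cover_preimage_def Pi_iff)

context odd_prime
begin

lemma hilbert_unit_even_ord:
  assumes "u \<in> (Zp_units :: 'p qp set)" "s \<noteq> 0" "even (ord_p s)"
  shows "hilbert u s = 1"
proof -
  obtain m where m: "ord_p s = 2 * m" using assms(3) by (auto elim: evenE)
  have "(pp :: 'p qp) powi (2 * m) = (pp powi m)\<^sup>2" by (simp add: power_int_mult mult.commute[of 2])
  then have "s = unit_part s * (pp powi m)\<^sup>2" using ord_p_unit_part[of s] by (simp add: m mult.commute)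
  then have "hilbert u s = hilbert u (unit_part s)" using hilbert_mult_square[of "pp powi m" u "unit_part s"] by simp
  then show ?thesis using assms by (simp add: hilbert_units unit_part_unit)
qed

lemma s_p_hm [simp]: "s_p (hm t) = 1" and s_p_xm [simp]: "s_p (xm t) = 1" and s_p_ym [simp]: "s_p (ym t) = 1"
  by (simp_all add: s_p_def hm_def xm_def ym_def)

text \<open>The \<open>tau_entry\<close> part contributes the symbol of u and s. It is trivial when
  s has even valuation; otherwise the \<open>s_p\<close> of the product is the same symbol and
  cancels it.\<close>

lemma cocycle_ym_hm:
  assumes "u \<in> (Zp_units :: 'p qp set)"
  shows "cocycle (ym s) (hm u) = 1"
proof (cases "s = 0")
  case True
  then show ?thesis using assms by (simp add: cocycle_one)
next
  case False
  have u0: "u \<noteq> 0" using assms by simp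
  have "hilbert (s * u * s) (s * u * inverse u) = hilbert (u * s\<^sup>2) s"
    using u0 by (simp add: power2_eq_square mult_ac)
  also have "\<dots> = hilbert u s" using False by (rule hilbert_mult_square_left)
  finally have 1: "cocycle (ym s) (hm u) = hilbert u s * s_p (ym s ** hm u)"
    using False u0 by (simp add: cocycle_def tau_entry_def matmul_nth) (simp add: ym_def hm_def)
  show ?thesis
  proof (cases "even (ord_p s)")
    case True
    then have "even (ord_p (s * u))" using False u0 assms by (simp add: ord_p_mult ord_p_unit)
    then have "s_p (ym s ** hm u) = 1" by (simp add: s_p_def ym_def hm_def)
    with 1 show ?thesis using True False assms by (simp add: hilbert_unit_even_ord)
  next
    case odd: False
    then have "odd (ord_p (s * u))" using False u0 assms by (simp add: ord_p_mult ord_p_unit)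
    then have "s_p (ym s ** hm u) = hilbert (s * u) (inverse u)" using False u0 by (simp add: s_p_def ym_def hm_def)
    also have "\<dots> = hilbert s u * hilbert u u" using False u0 by (simp add: hilbert_inverse hilbert_mult_left)
    also have "\<dots> = hilbert u s" using assms by (simp add: hilbert_units hilbert_commute)
    finally show ?thesis using 1 by simp
  qed
qed

text \<open>Multiplication by x(t) keeps the lower left entry and multiplies the lower right one by
  1 + s u^2 t, a square by Hensel lifting as s is in pZ. So neither \<open>tau_entry\<close> nor
  \<open>s_p\<close> changes when s is nonzero.\<close>

lemma cocycle_ym_hm_xm:
  assumes "s \<in> pZ 1" "u \<in> (Zp_units :: 'p qp set)" "t \<in> Zp"
  shows "cocycle (ym s ** hm u) (xm t) = 1"
proof -
  have u0: "u \<noteq> 0" using assms by simp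
  let ?g = "mat2 u 0 (s * u) (inverse u)" and ?h = "mat2 u (u * t) (s * u) (s * u * t + inverse u)"
  have g: "ym s ** hm u = ?g" "?g ** xm t = ?h" by (simp_all add: ym_def hm_def xm_def)
  show ?thesis
  proof (cases "s = 0")
    case True
    then show ?thesis
      unfolding g by (simp add: cocycle_def g) (use u0 assms in \<open>simp add: tau_entry_def s_p_def hilbert_units xm_def\<close>)
  next
    case False
    define w where "w = 1 + s * u\<^sup>2 * t"
    have "s * u\<^sup>2 * t \<in> pZ 1" using assms by simp
    then obtain y where y: "y \<noteq> 0" "w = y\<^sup>2" unfolding w_def using one_plus_pZ_square by blast
    have d: "s * u * t + inverse u = inverse u * y\<^sup>2"
      unfolding y(2)[symmetric] w_def using u0 by (simp add: power2_eq_square field_simps)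
    have "s_p ?h = s_p ?g"
      using u0 False y(1) by (simp add: s_p_def d hilbert_mult_square)
    moreover have "tau_entry ?h = s * u" "tau_entry ?g = s * u" "tau_entry (xm t) = 1"
      using u0 False by (simp_all add: tau_entry_def xm_def)
    ultimately show ?thesis
      unfolding g cocycle_def by (simp add: hilbert_square_left[of "s * u", unfolded power2_eq_square])
  qed
qed

section \<open>Moving the torus past itself and past the two unipotent subgroups in the
  cover\<close>

lemma cocycle_hm_hm: "t \<noteq> 0 \<Longrightarrow> u \<noteq> 0 \<Longrightarrow> cocycle (hm t) (hm u) = cocycle (hm u) (hm t)"
  by (simp add: cocycle_def hm_mult mult.commute hilbert_commute)

lemma cocycle_hm_xm:
  assumes "t \<noteq> (0 :: 'p qp)"
  shows "cocycle (hm t) (xm s) = 1" "cocycle (xm s') (hm t) = 1"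
proof -
  have "tau_entry (hm t) = inverse t" "tau_entry (xm r) = 1" "tau_entry (hm t ** xm r) = inverse t" 
    "tau_entry (xm r ** hm t) = inverse t" "s_p (hm t ** xm r) = 1" "s_p (xm r ** hm t) = 1" for r
    using assms by (simp_all add: tau_entry_def s_p_def hm_def xm_def)
  then show "cocycle (hm t) (xm s) = 1" "cocycle (xm s') (hm t) = 1"
    by (simp_all add: cocycle_def hilbert_square_left[unfolded power2_eq_square] hilbert_square_right[unfolded power2_eq_square])
qed

text \<open>The two products are the same matrix and r / t^2 is in the square class of r, so both
  sides reduce to the symbol of t and r times one common \<open>s_p\<close>. Equality of the two
  signs is the claim, not that they are 1.\<close>

lemma cocycle_hm_ym:
  assumes "t \<noteq> (0 :: 'p qp)"
  shows "cocycle (hm t) (ym r) = cocycle (ym (r / t\<^sup>2)) (hm t)"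
proof (cases "r = 0")
  case True
  then show ?thesis using assms by (simp add: cocycle_one)
next
  case False
  let ?r = "r / t\<^sup>2"
  have tau: "tau_entry (hm t) = inverse t" "tau_entry (ym r) = r" "tau_entry (ym ?r) = ?r"
    "tau_entry (hm t ** ym r) = r / t" "tau_entry (ym ?r ** hm t) = r / t"
    using assms False by (simp_all add: tau_entry_def hm_def ym_def field_simps power2_eq_square)
  have "hilbert (r / t * inverse t) (r / t * r) = hilbert (r * (inverse t)\<^sup>2) (inverse t * r\<^sup>2)"
    by (simp add: power2_eq_square divide_inverse mult_ac)
  also have "\<dots> = hilbert r t"
    using assms False by (simp add: hilbert_mult_square hilbert_mult_square_left hilbert_inverse)
  also have "\<dots> = hilbert t r" by (rule hilbert_commute)
  also have "\<dots> = hilbert (inverse t) r" using assms by (metis hilbert_commute hilbert_inverse)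
  also have "\<dots> = hilbert (inverse t * (r * inverse t)\<^sup>2) (r * (inverse t)\<^sup>2)"
    using assms False by (simp add: hilbert_mult_square hilbert_mult_square_left)
  also have "\<dots> = hilbert (r / t * ?r) (r / t * inverse t)"
    by (simp add: power2_eq_square divide_inverse mult_ac)
  finally show ?thesis
    using assms by (simp add: cocycle_def tau hm_ym)
qed

end

text \<open>\<open>s0\<close> is a parameter for all four cases because its values yield
  \<open>cocycle_K_level\<close>, on which the character \<open>eta_cover\<close> and the coset
  computations rest.\<close>

locale eta_setting = odd_prime prime_type for prime_type :: "'p::prime_card itself" +
  fixes \<eta> :: "'p qp \<Rightarrow> complex" and s0 :: "'p mat2 \<Rightarrow> int"
  assumes eta: "\<eta> = (\<lambda>_. 1) \<or> \<eta> = (\<lambda>u. of_int (legendre_p u))"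
    and s0: "is_s_zero s0"
begin

text \<open>A splitting is multiplicative up to the cocycle; on the Iwahori factors
  \<open>s0\<close> is 1, and the cocycles between them are 1 by the two computations above.\<close>

lemma s0_K_level:
  assumes "A \<in> (K_level 1 :: 'p mat2 set)"
  shows "s0 A = 1"
proof -
  have split: "is_splitting K_zero s0" using s0 by (simp add: is_s_zero_def)
  obtain s u t where A: "s \<in> pZ (int 1)" "u \<in> Zp_units" "t \<in> Zp" "A = ym s ** hm u ** xm t"
    using assms by (rule iwahori_decomp) simp
  have K: "ym s \<in> K_level 1" "hm u \<in> K_level 1" "xm t \<in> K_level 1"
    using A ym_mem_K_level hm_mem_K_level xm_mem_K_level by blast+
  then have K0: "ym s \<in> K_zero" "hm u \<in> K_zero" "xm t \<in> K_zero" "ym s ** hm u \<in> K_zero"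
    using K_level_subset_K_zero K_level_mult by blast+
  have "s0 (ym s) = 1" "s0 (hm u) = 1" "s0 (xm t) = 1"
    using s0 A pZ_imp_Zp[of 1 s] by (auto simp: is_s_zero_def)
  moreover have "cocycle (ym s) (hm u) = 1" "cocycle (ym s ** hm u) (xm t) = 1"
    using A by (simp_all add: cocycle_ym_hm cocycle_ym_hm_xm)
  ultimately show ?thesis
    using A(4) is_splittingD(2)[OF split K0(4) K0(3)] is_splittingD(2)[OF split K0(1) K0(2)] by simp
qed

text \<open>Where a splitting is constantly 1, its multiplicativity says that the cocycle is
  1.\<close>

lemma cocycle_K_level: "A \<in> (K_level 1 :: 'p mat2 set) \<Longrightarrow> B \<in> K_level 1 \<Longrightarrow> cocycle A B = 1"
  using is_splittingD(2)[of K_zero s0 A B] s0 s0_K_level[of A] s0_K_level[of B] s0_K_level[of "A ** B"]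
    K_level_subset_K_zero[of 1] by (auto simp: is_s_zero_def)

lemma eta_values: "u \<in> Zp_units \<Longrightarrow> \<eta> u = 1 \<or> \<eta> u = - 1"
  using eta legendre_p_values[of u] by auto

lemma eta_mult: "u \<in> Zp_units \<Longrightarrow> v \<in> Zp_units \<Longrightarrow> \<eta> (u * v) = \<eta> u * \<eta> v"
  using eta by (auto simp: legendre_p_mult)

lemma eta_cong: "u \<in> Zp \<Longrightarrow> v \<in> Zp \<Longrightarrow> u - v \<in> pZ 1 \<Longrightarrow> \<eta> u = \<eta> v"
  using eta legendre_p_cong[of u v] by auto

lemma eta_one: "\<eta> 1 = 1"
  using eta_mult[of 1 1] eta_values[of 1] by auto

lemma eta_inverse: "u \<in> Zp_units \<Longrightarrow> \<eta> (inverse u) = \<eta> u"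
  using eta_mult[of u "inverse u"] eta_values[of u] eta_values[of "inverse u"] eta_one by auto

section \<open>The inverse images of the congruence subgroups and their genuine character\<close>

abbreviation Kt :: "nat \<Rightarrow> ('p mat2 \<times> int) set" where
  "Kt r \<equiv> cover_preimage (K_level r)"

lemma mem_Kt: "(A, e) \<in> Kt r \<longleftrightarrow> A \<in> K_level r \<and> (e = 1 \<or> e = - 1)"
  by (auto simp: cover_preimage_def)

lemma K_level_SL2: "A \<in> K_level r \<Longrightarrow> A \<in> carrier SL2"
  by (simp add: mem_K_level)

lemma subgroup_Kt: "subgroup (Kt r) Mp"
proof (rule group.subgroupI[OF group_Mp])
  show "Kt r \<subseteq> carrier Mp" by (auto simp: mem_Kt Mp_simps K_level_SL2)
  have "(mat 1, 1) \<in> Kt r" by (simp add: mem_Kt)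
  then show "Kt r \<noteq> {}" by blast
  show mult: "a \<otimes>\<^bsub>Mp\<^esub> b \<in> Kt r" if "a \<in> Kt r" "b \<in> Kt r" for a b
    using that cocycle_values[of "fst a" "fst b"] by (cases a, cases b) (auto simp: mem_Kt Mp_simps)
  fix a assume a: "a \<in> Kt r"
  obtain A e where A: "a = (A, e)" "A \<in> K_level r" "e = 1 \<or> e = - 1" using a by (cases a) (auto simp: mem_Kt)
  let ?b = "(adj2 A, e * cocycle (adj2 A) A)"
  have b: "?b \<in> Kt r" using A cocycle_values[of "adj2 A" A] by (auto simp: mem_Kt)
  have "?b \<otimes>\<^bsub>Mp\<^esub> a = \<one>\<^bsub>Mp\<^esub>"
    using A adj2_mult(1)[OF K_level_SL2[OF A(2)]] cocycle_values[of "adj2 A" A] by (auto simp: Mp_simps)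
  then have "inv\<^bsub>Mp\<^esub> a = ?b"
    using group.inv_equality[OF group_Mp] a b \<open>Kt r \<subseteq> carrier Mp\<close> by blast
  then show "inv\<^bsub>Mp\<^esub> a \<in> Kt r" using b by simp
qed

lemma Kt_carrier: "a \<in> Kt r \<Longrightarrow> a \<in> carrier Mp"
  using subgroup.subset[OF subgroup_Kt] by blast

lemma Kt_mono: "r \<le> r' \<Longrightarrow> a \<in> Kt r' \<Longrightarrow> a \<in> Kt r"
  by (cases a) (auto simp: mem_Kt intro: K_level_mono)

text \<open>Lower right entries multiply up to a term in pZ, coming from the lower left entry of the
  first matrix, and \<open>\<eta>\<close> depends only on the residue mod p.\<close>

lemma eta_cover_mult:
  assumes "a \<in> Kt 1" "b \<in> Kt 1"
  shows "eta_cover \<eta> (a \<otimes>\<^bsub>Mp\<^esub> b) = eta_cover \<eta> a * eta_cover \<eta> b"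
proof -
  obtain A e B e' where ab: "a = (A, e)" "b = (B, e')" by (metis surj_pair)
  have AB: "A \<in> K_level 1" "B \<in> K_level 1" using assms by (auto simp: ab mem_Kt)
  have u: "A $ 2 $ 2 \<in> Zp_units" "B $ 2 $ 2 \<in> Zp_units" using K_level_diag_units AB by auto
  have "\<eta> ((A ** B) $ 2 $ 2) = \<eta> (A $ 2 $ 2 * B $ 2 $ 2)"
  proof (rule eta_cong)
    show "(A ** B) $ 2 $ 2 - A $ 2 $ 2 * B $ 2 $ 2 \<in> pZ 1"
      using AB by (simp add: matmul_nth mem_K_level)
    show "(A ** B) $ 2 $ 2 \<in> Zp" using K_level_mult[OF AB] by (simp only: mem_K_level)
  qed (use u in simp)
  then show ?thesis
    using eta_mult[OF u] cocycle_K_level[OF AB] by (simp add: ab Mp_simps eta_cover_def)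
qed

lemma eta_cover_values:
  assumes "a \<in> Kt 1" shows "eta_cover \<eta> a = 1 \<or> eta_cover \<eta> a = - 1"
  using assms eta_values K_level_diag_units(2)[of _ 1] by (cases a) (fastforce simp: mem_Kt eta_cover_def)

section \<open>The operators\<close>

definition y0 :: "nat \<Rightarrow> 'p qp \<Rightarrow> 'p mat2 \<times> int" where
  "y0 M \<delta> = (ym (\<delta> * pp ^ (M - 1)), 1)"

lemma y0_mem:
  assumes "\<delta> \<in> Zp" shows "y0 M \<delta> \<in> Kt (M - 1)"
  using pZ_closed(6)[OF pp_power_mem_pZ assms] by (simp add: y0_def mem_Kt ym_mem_K_level)

definition dcoset :: "nat \<Rightarrow> 'p qp \<Rightarrow> ('p mat2 \<times> int) set" where
  "dcoset M \<delta> = Kt M <#>\<^bsub>Mp\<^esub> {y0 M \<delta>} <#>\<^bsub>Mp\<^esub> Kt M"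

lemma mem_dcoset: "g \<in> dcoset M \<delta> \<longleftrightarrow> (\<exists>k\<in>Kt M. \<exists>k'\<in>Kt M. g = k \<otimes>\<^bsub>Mp\<^esub> y0 M \<delta> \<otimes>\<^bsub>Mp\<^esub> k')"
  by (auto simp: dcoset_def set_mult_def)

lemma dcoset_subset: "\<delta> \<in> Zp \<Longrightarrow> M \<ge> 1 \<Longrightarrow> dcoset M \<delta> \<subseteq> Kt (M - 1)"
  unfolding subset_iff mem_dcoset
  using y0_mem[of \<delta> M] Kt_mono[of "M - 1" M] subgroup.m_closed[OF subgroup_Kt[of "M - 1"]]
  by (metis diff_le_self)

lemma dcoset_mult_iff:
  assumes "k \<in> Kt M" "k' \<in> Kt M" "g \<in> carrier Mp" "\<delta> \<in> Zp"
  shows "k \<otimes>\<^bsub>Mp\<^esub> g \<otimes>\<^bsub>Mp\<^esub> k' \<in> dcoset M \<delta> \<longleftrightarrow> g \<in> dcoset M \<delta>"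
proof -
  interpret Mp: group "Mp :: ('p mat2 \<times> int) monoid" by (rule group_Mp)
  have y: "y0 M \<delta> \<in> carrier Mp" using y0_mem[OF assms(4)] Kt_carrier by blast
  have *: "k \<otimes>\<^bsub>Mp\<^esub> g \<otimes>\<^bsub>Mp\<^esub> k' \<in> dcoset M \<delta>" if k: "k \<in> Kt M" "k' \<in> Kt M" and "g \<in> dcoset M \<delta>" for k k' g
  proof -
    from that obtain l l' where l: "l \<in> Kt M" "l' \<in> Kt M" "g = l \<otimes>\<^bsub>Mp\<^esub> y0 M \<delta> \<otimes>\<^bsub>Mp\<^esub> l'" by (auto simp: mem_dcoset)
    have "k \<otimes>\<^bsub>Mp\<^esub> g \<otimes>\<^bsub>Mp\<^esub> k' = (k \<otimes>\<^bsub>Mp\<^esub> l) \<otimes>\<^bsub>Mp\<^esub> y0 M \<delta> \<otimes>\<^bsub>Mp\<^esub> (l' \<otimes>\<^bsub>Mp\<^esub> k')"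
      using k l y Kt_carrier by (simp add: Mp.m_assoc)
    then show ?thesis using k l subgroup.m_closed[OF subgroup_Kt] unfolding mem_dcoset by blast
  qed
  show ?thesis
  proof
    assume "k \<otimes>\<^bsub>Mp\<^esub> g \<otimes>\<^bsub>Mp\<^esub> k' \<in> dcoset M \<delta>"
    then have "inv\<^bsub>Mp\<^esub> k \<otimes>\<^bsub>Mp\<^esub> (k \<otimes>\<^bsub>Mp\<^esub> g \<otimes>\<^bsub>Mp\<^esub> k') \<otimes>\<^bsub>Mp\<^esub> inv\<^bsub>Mp\<^esub> k' \<in> dcoset M \<delta>"
      using * assms subgroup.m_inv_closed[OF subgroup_Kt] by blast
    moreover have "inv\<^bsub>Mp\<^esub> k \<otimes>\<^bsub>Mp\<^esub> (k \<otimes>\<^bsub>Mp\<^esub> g \<otimes>\<^bsub>Mp\<^esub> k') \<otimes>\<^bsub>Mp\<^esub> inv\<^bsub>Mp\<^esub> k' = g"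
      using assms Kt_carrier by (simp add: Mp.m_assoc Mp.inv_solve_left')
    ultimately show "g \<in> dcoset M \<delta>" by simp
  qed (use * assms in blast)
qed

text \<open>The character \<open>eta_cover\<close> of \<open>Kt M\<close> extends to \<open>Kt 1\<close>, which contains the double coset, and is
  trivial at \<open>y0\<close>; so it (being real) is the function that transforms as prescribed.\<close>

lemma V_fun_eq:
  assumes M: "M \<ge> 2" and \<delta>: "\<delta> \<in> Zp"
  shows "V_fun \<eta> M \<delta> = (\<lambda>g. if g \<in> dcoset M \<delta> then eta_cover \<eta> g else 0)" (is "_ = ?F")
proof -
  have Kt1: "k \<in> Kt 1" if "k \<in> Kt M" for k using that Kt_mono[of 1 M] M by auto
  have W1: "g \<in> Kt 1" if "g \<in> dcoset M \<delta>" for g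
    using subsetD[OF dcoset_subset[OF \<delta>, of M] that] M by (intro Kt_mono[of 1 "M - 1" g]) auto
  have cnj: "cnj (eta_cover \<eta> k) = eta_cover \<eta> k" if "k \<in> Kt M" for k
    using eta_cover_values[OF Kt1[OF that]] by auto
  have y1: "y0 M \<delta> \<in> Kt 1" using y0_mem[OF \<delta>, of M] Kt_mono[of 1 "M - 1"] M by auto
  have yW: "y0 M \<delta> \<in> dcoset M \<delta>"
  proof -
    interpret Mp: group "Mp :: ('p mat2 \<times> int) monoid" by (rule group_Mp)
    have "y0 M \<delta> = \<one>\<^bsub>Mp\<^esub> \<otimes>\<^bsub>Mp\<^esub> y0 M \<delta> \<otimes>\<^bsub>Mp\<^esub> \<one>\<^bsub>Mp\<^esub>" using y1 Kt_carrier by simp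
    then show ?thesis unfolding mem_dcoset using subgroup.one_closed[OF subgroup_Kt] by blast
  qed
  have eta_y: "eta_cover \<eta> (y0 M \<delta>) = 1" by (simp add: eta_cover_def y0_def ym_def eta_one)
  have m: "eta_cover \<eta> (k \<otimes>\<^bsub>Mp\<^esub> g \<otimes>\<^bsub>Mp\<^esub> k') = eta_cover \<eta> k * eta_cover \<eta> k' * eta_cover \<eta> g"
    if "k \<in> Kt 1" "k' \<in> Kt 1" "g \<in> Kt 1" for k k' g
    using that subgroup.m_closed[OF subgroup_Kt] by (simp add: eta_cover_mult)
  show ?thesis
    unfolding V_fun_def Let_def
  proof (fold y0_def, fold dcoset_def, rule the_equality)
    show "(\<forall>g. ?F g \<noteq> 0 \<longrightarrow> g \<in> dcoset M \<delta>) \<and> ?F (y0 M \<delta>) = 1 \<and>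
       (\<forall>k\<in>Kt M. \<forall>k'\<in>Kt M. \<forall>g\<in>carrier Mp.
          ?F (k \<otimes>\<^bsub>Mp\<^esub> g \<otimes>\<^bsub>Mp\<^esub> k') = cnj (eta_cover \<eta> k) * cnj (eta_cover \<eta> k') * ?F g)"
      using yW eta_y W1 Kt1 by (simp add: dcoset_mult_iff \<delta> cnj m)
  next
    fix F :: "'p mat2 \<times> int \<Rightarrow> complex"
    assume F: "(\<forall>g. F g \<noteq> 0 \<longrightarrow> g \<in> dcoset M \<delta>) \<and> F (y0 M \<delta>) = 1 \<and>
       (\<forall>k\<in>Kt M. \<forall>k'\<in>Kt M. \<forall>g\<in>carrier Mp.
          F (k \<otimes>\<^bsub>Mp\<^esub> g \<otimes>\<^bsub>Mp\<^esub> k') = cnj (eta_cover \<eta> k) * cnj (eta_cover \<eta> k') * F g)"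
    show "F = ?F"
    proof
      fix g
      show "F g = ?F g"
      proof (cases "g \<in> dcoset M \<delta>")
        case True
        then obtain k k' where k: "k \<in> Kt M" "k' \<in> Kt M" "g = k \<otimes>\<^bsub>Mp\<^esub> y0 M \<delta> \<otimes>\<^bsub>Mp\<^esub> k'"
          unfolding mem_dcoset by blast
        have "F g = eta_cover \<eta> k * eta_cover \<eta> k'"
          using F k y1 Kt_carrier by (simp add: cnj)
        also have "\<dots> = eta_cover \<eta> g" using k y1 Kt1 m eta_y by simp
        finally show ?thesis using True by simp
      next
        case False
        then have "F g = 0" using F by blast
        then show ?thesis using False by simp
      qed
    qed
  qed
qed

end

subsection \<open>Classes of units\<close>

lemma sqrt_one_squares: "t \<in> sqrt_one \<Longrightarrow> t\<^sup>2 - 1 \<in> pZ 1"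
proof -
  assume "t \<in> sqrt_one"
  then obtain e z where t: "t = e * (1 + z)" "e = 1 \<or> e = - 1" "z \<in> pZ 1" by (auto simp: sqrt_one_def)
  then have "t\<^sup>2 - 1 = z * (2 + z)" by (auto simp: power2_eq_square algebra_simps)
  moreover have "of_int 2 + z \<in> Zp" using t(3) pZ_imp_Zp[of 1 z] by (intro Zp_closed) auto
  ultimately show ?thesis using t(3) by simp
qed

lemma one_mem_sqrt_one: "1 \<in> sqrt_one"
  by (force simp: sqrt_one_def)

text \<open>If p divides (u - v)(u + v), then u is v or -v mod p, and \<open>sqrt_one\<close>
  contains -1. Thus unit classes are told apart by u^2 mod p.\<close>

lemma unit_class_eqI:
  assumes "u \<in> Zp_units" "v \<in> Zp_units" "u\<^sup>2 - v\<^sup>2 \<in> pZ 1"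
  shows "(*) u ` sqrt_one = (*) v ` sqrt_one"
proof -
  have *: "(*) u ` sqrt_one \<subseteq> (*) v ` sqrt_one"
    if uv: "u \<in> Zp_units" "v \<in> Zp_units" "u\<^sup>2 - v\<^sup>2 \<in> pZ 1" for u v :: "'a qp"
  proof -
    have "(u - v) * (u + v) \<in> pZ 1" using uv(3) by (simp add: power2_eq_square algebra_simps)
    moreover have "u - v \<in> Zp" "u + v \<in> Zp" using uv by simp_all
    ultimately have "u - v \<in> pZ 1 \<or> u + v \<in> pZ 1"
      using Zp_units_not_pZ Zp_units_closed(2) Zp_cases by metis
    then obtain e where e: "e = 1 \<or> e = - 1" "u - e * v \<in> pZ 1" by force
    have v0: "v \<noteq> 0" using uv by simp
    define z where "z = e * inverse v * (u - e * v)"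
    have z: "z \<in> pZ 1" unfolding z_def using e uv by (intro pZ_closed(6)) auto
    have ee: "e * (e * x) = x" for x using e(1) by auto
    have u: "u = v * (e * (1 + z))" using v0 by (simp add: z_def algebra_simps ee)
    show ?thesis
    proof
      fix x assume "x \<in> (*) u ` sqrt_one"
      then obtain f y where x: "x = u * (f * (1 + y))" "f = 1 \<or> f = - 1" "y \<in> pZ 1"
        by (auto simp: sqrt_one_def)
      have "z + y + z * y \<in> pZ 1" using z x(3) pZ_imp_Zp[of 1 y] by simp
      moreover have "x = v * (e * f * (1 + (z + y + z * y)))" using x(1) u by (simp add: algebra_simps)
      moreover have "e * f \<in> {1, - 1}" using e(1) x(2) by auto
      ultimately show "x \<in> (*) v ` sqrt_one" unfolding sqrt_one_def by blast
    qed
  qed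
  have "v\<^sup>2 - u\<^sup>2 \<in> pZ 1" using pZ_closed(3)[OF assms(3)] by simp
  then show ?thesis using *[OF assms] *[OF assms(2,1)] by blast
qed

text \<open>The same choice of representative as in \<open>T_op\<close>, so that sums over classes
  can be compared term by term.\<close>

definition class_rep :: "'p::prime_card qp set \<Rightarrow> 'p qp" where
  "class_rep C = (SOME u. u \<in> C)"

lemma class_rep_mem:
  assumes "u \<in> Zp_units"
  shows "class_rep ((*) u ` sqrt_one) \<in> Zp_units" "(class_rep ((*) u ` sqrt_one))\<^sup>2 - u\<^sup>2 \<in> pZ 1"
proof -
  let ?C = "(*) u ` sqrt_one"
  have "u \<in> ?C" using one_mem_sqrt_one by (force intro: image_eqI[of _ _ 1])
  then have "class_rep ?C \<in> ?C" unfolding class_rep_def by (rule someI)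
  then obtain t where t: "t \<in> sqrt_one" "class_rep ?C = u * t" by blast
  then have "t \<in> Zp_units" using one_plus_pZ_unit[THEN Zp_units_closed(4)] one_plus_pZ_unit by (fastforce simp: sqrt_one_def)
  then show "class_rep ?C \<in> Zp_units" using t assms by simp
  have "(class_rep ?C)\<^sup>2 - u\<^sup>2 = u\<^sup>2 * (t\<^sup>2 - 1)"
    unfolding t(2) by (simp add: power_mult_distrib algebra_simps)
  then show "(class_rep ?C)\<^sup>2 - u\<^sup>2 \<in> pZ 1" using sqrt_one_squares[OF t(1)] assms by simp
qed

lemma class_rep_unit: "C \<in> unit_classes \<Longrightarrow> class_rep C \<in> Zp_units"
  using class_rep_mem(1) by (auto simp: unit_classes_def)

lemma class_rep_inj:
  assumes "C \<in> unit_classes" "C' \<in> unit_classes" "(class_rep C)\<^sup>2 - (class_rep C')\<^sup>2 \<in> pZ 1"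
  shows "C = C'"
proof -
  have *: "(*) (class_rep C) ` sqrt_one = C" if "C \<in> unit_classes" for C :: "'a qp set"
  proof -
    from that obtain u where "u \<in> Zp_units" "C = (*) u ` sqrt_one" by (auto simp: unit_classes_def)
    then show ?thesis using class_rep_mem[of u] unit_class_eqI[of "class_rep C" u] by simp
  qed
  have "C = (*) (class_rep C) ` sqrt_one" by (rule *[OF assms(1), symmetric])
  also have "\<dots> = (*) (class_rep C') ` sqrt_one"
    by (rule unit_class_eqI[OF class_rep_unit[OF assms(1)] class_rep_unit[OF assms(2)] assms(3)])
  also have "\<dots> = C'" by (rule *[OF assms(2)])
  finally show ?thesis .
qed

lemma class_rep_surj:
  assumes "u \<in> Zp_units"
  obtains C where "C \<in> unit_classes" "(class_rep C)\<^sup>2 - u\<^sup>2 \<in> pZ 1"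
  using that[of "(*) u ` sqrt_one"] class_rep_mem(2)[OF assms] assms by (simp add: unit_classes_def)

lemma T_op_alt: "T_op sc ch \<rho> r \<delta> v = (\<Sum>C\<in>unit_classes.
    sc (inverse (ch (class_rep C))) (\<rho> (hm (class_rep C) ** ym (\<delta> * pp ^ (r - 1))) v))"
  by (simp add: T_op_def class_rep_def Let_def)

lemma pZ_cancel:
  assumes "\<delta> \<in> (Zp_units :: 'p::prime_card qp set)" "\<delta> * pp ^ n * z \<in> pZ (int n + 1)"
  shows "z \<in> pZ 1"
proof -
  obtain x where "x \<in> Zp" "\<delta> * pp ^ n * z = pp powi (int n + 1) * x" using assms(2) by (auto simp: pZ_def)
  then have x: "x \<in> Zp" "pp ^ n * (\<delta> * z) = pp ^ n * (pp * x)" by (simp_all add: power_int_add mult_ac)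
  then have "\<delta> * z = pp * x" by simp
  then have "z = pp * (x * inverse \<delta>)" using assms(1) by (simp add: field_simps)
  then show ?thesis using x assms(1) by (auto simp: pZ_def intro!: image_eqI[of _ _ "x * inverse \<delta>"])
qed

subsection \<open>The sum over cosets\<close>

context eta_setting
begin

text \<open>\<open>Kt r\<close> contains both signs over each matrix, which absorbs the cocycle;
  cosets in the cover are thus cosets of matrices.\<close>

lemma l_coset_Kt:
  assumes "e = 1 \<or> e = - 1"
  shows "(A, e) <#\<^bsub>Mp\<^esub> Kt r = (**) A ` K_level r \<times> {1, - 1}"
proof
  show "(A, e) <#\<^bsub>Mp\<^esub> Kt r \<subseteq> (**) A ` K_level r \<times> {1, - 1}"
  proof
    fix x assume "x \<in> (A, e) <#\<^bsub>Mp\<^esub> Kt r"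
    then obtain y where y: "y \<in> Kt r" "x = (A, e) \<otimes>\<^bsub>Mp\<^esub> y" by (auto simp: l_coset_def)
    obtain k f where "y = (k, f)" by fastforce
    then have k: "k \<in> K_level r" "f = 1 \<or> f = - 1" "x = (A ** k, e * f * cocycle A k)"
      using y by (auto simp: mem_Kt Mp_simps)
    then show "x \<in> (**) A ` K_level r \<times> {1, - 1}" using assms cocycle_values[of A k] by auto
  qed
  show "(**) A ` K_level r \<times> {1, - 1} \<subseteq> (A, e) <#\<^bsub>Mp\<^esub> Kt r"
  proof
    fix x :: "'p mat2 \<times> int" assume "x \<in> (**) A ` K_level r \<times> {1, - 1}"
    then obtain k f where k: "k \<in> K_level r" "f = 1 \<or> f = - 1" "x = (A ** k, f)" by auto
    have "x = (A, e) \<otimes>\<^bsub>Mp\<^esub> (k, e * f * cocycle A k)"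
      using assms k cocycle_values[of A k] by (auto simp: Mp_simps)
    moreover have "(k, e * f * cocycle A k) \<in> Kt r"
      using assms k cocycle_values[of A k] by (auto simp: mem_Kt)
    ultimately show "x \<in> (A, e) <#\<^bsub>Mp\<^esub> Kt r" by (auto simp: l_coset_def)
  qed
qed

lemma l_coset_K_level_eqI:
  assumes "A \<in> carrier SL2" "adj2 A ** B \<in> K_level r"
  shows "(**) A ` K_level r = (**) B ` K_level r"
proof -
  have B: "B = A ** (adj2 A ** B)" using adj2_mult[OF assms(1)] by (simp add: matrix_mul_assoc matrix_mul_lid)
  have "adj2 A ** B \<in> carrier SL2" using assms(2) by (rule K_level_SL2)
  then have A: "A = B ** adj2 (adj2 A ** B)"
    using B adj2_mult(2)[of "adj2 A ** B"] by (metis matrix_mul_assoc matrix_mul_rid)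
  have "(**) B ` K_level r \<subseteq> (**) A ` K_level r"
  proof
    fix x assume "x \<in> (**) B ` K_level r"
    then obtain k where "k \<in> K_level r" "x = B ** k" by blast
    then have "x = A ** (adj2 A ** B ** k)" "adj2 A ** B ** k \<in> K_level r"
      using B assms(2) by (auto simp: matrix_mul_assoc)
    then show "x \<in> (**) A ` K_level r" by blast
  qed
  moreover have "(**) A ` K_level r \<subseteq> (**) B ` K_level r"
  proof
    fix x assume "x \<in> (**) A ` K_level r"
    then obtain k where "k \<in> K_level r" "x = A ** k" by blast
    then have "x = B ** (adj2 (adj2 A ** B) ** k)" "adj2 (adj2 A ** B) ** k \<in> K_level r"
      using A assms(2) by (auto simp: matrix_mul_assoc)
    then show "x \<in> (**) B ` K_level r" by blast
  qed
  ultimately show ?thesis by blast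
qed

abbreviation hy :: "nat \<Rightarrow> 'p qp \<Rightarrow> 'p qp \<Rightarrow> 'p mat2" where
  "hy M \<delta> u \<equiv> hm u ** ym (\<delta> * pp ^ (M - 1))"

lemma hy_mem:
  assumes "M \<ge> 2" "\<delta> \<in> Zp" "u \<in> Zp_units"
  shows "(hy M \<delta> u, 1) \<in> dcoset M \<delta>" "hy M \<delta> u \<in> K_level 1" "(hy M \<delta> u, 1) = (hm u, 1) \<otimes>\<^bsub>Mp\<^esub> y0 M \<delta>"
proof -
  interpret Mp: group "Mp :: ('p mat2 \<times> int) monoid" by (rule group_Mp)
  have "y0 M \<delta> \<in> Kt 1" using y0_mem[OF assms(2), of M] Kt_mono[of 1 "M - 1"] assms(1) by auto
  then have y: "ym (\<delta> * pp ^ (M - 1)) \<in> K_level 1" "y0 M \<delta> \<in> carrier Mp"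
    using Kt_carrier by (auto simp: y0_def mem_Kt)
  have h: "hm u \<in> K_level 1" "(hm u, 1) \<in> Kt M" using assms(3) hm_mem_K_level by (auto simp: mem_Kt)
  show 1: "(hy M \<delta> u, 1) = (hm u, 1) \<otimes>\<^bsub>Mp\<^esub> y0 M \<delta>"
    using cocycle_K_level[OF h(1) y(1)] by (simp add: y0_def Mp_simps)
  have "(hy M \<delta> u, 1) = (hm u, 1) \<otimes>\<^bsub>Mp\<^esub> y0 M \<delta> \<otimes>\<^bsub>Mp\<^esub> \<one>\<^bsub>Mp\<^esub>"
    unfolding 1 using h(2) y(2) Kt_carrier by (intro Mp.r_one[symmetric]) auto
  then show "(hy M \<delta> u, 1) \<in> dcoset M \<delta>"
    unfolding mem_dcoset using h(2) subgroup.one_closed[OF subgroup_Kt] by blast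
  show "hy M \<delta> u \<in> K_level 1" using h y by simp
qed

definition hy_coset :: "nat \<Rightarrow> 'p qp \<Rightarrow> 'p qp set \<Rightarrow> ('p mat2 \<times> int) set" where
  "hy_coset M \<delta> C = (hy M \<delta> (class_rep C), 1) <#\<^bsub>Mp\<^esub> Kt M"

text \<open>Put r = \<delta> p^(M-1). The lower left entry of the inverse of \<open>hy\<close> at u
  times \<open>hy\<close> at v is r (u/v - v/u). As \<delta> is a unit, it lies in p^M only if u^2 =
  v^2 mod p, that is, if the classes agree. For surjectivity, the right factor of a double coset
  element disappears into the coset, and the left factor matters only through the square of its
  lower right entry mod p.\<close>

lemma hy_coset_bij:
  assumes M: "M \<ge> 2" and \<delta>: "\<delta> \<in> Zp_units"
  shows "bij_betw (hy_coset M \<delta>) unit_classes {C \<in> lcosets\<^bsub>Mp\<^esub> (Kt M). \<exists>g\<in>C. V_fun \<eta> M \<delta> g \<noteq> 0}"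
proof -
  let ?r = "\<delta> * pp ^ (M - 1)"
  have \<delta>Z: "\<delta> \<in> Zp" using \<delta> by simp
  have r: "?r \<in> pZ (int M - 1)" using pZ_closed(6)[OF pp_power_mem_pZ \<delta>Z, of "M - 1"] M by (simp add: of_nat_diff)
  have entries: "hy M \<delta> u = mat2 u 0 (inverse u * ?r) (inverse u)" for u
    by (simp add: hm_def ym_def)
  have W: "V_fun \<eta> M \<delta> g \<noteq> 0 \<longleftrightarrow> g \<in> dcoset M \<delta>" for g
  proof -
    have "eta_cover \<eta> g \<noteq> 0" if "g \<in> dcoset M \<delta>"
      using subsetD[OF dcoset_subset[OF \<delta>Z, of M] that] M eta_cover_values[of g] Kt_mono[of 1 "M - 1" g] by auto
    then show ?thesis using V_fun_eq[OF M \<delta>Z] by simp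
  qed
  have SL: "hy M \<delta> u \<in> carrier SL2" if "u \<in> Zp_units" for u
    using hy_mem(2)[OF M \<delta>Z that] K_level_SL2 by blast
  show ?thesis
  proof (rule bij_betw_imageI)
    show "inj_on (hy_coset M \<delta>) unit_classes"
    proof (rule inj_onI)
      fix C C' assume C: "C \<in> unit_classes" "C' \<in> unit_classes" "hy_coset M \<delta> C = hy_coset M \<delta> C'"
      let ?u = "class_rep C" and ?v = "class_rep C'"
      have uv: "?u \<in> Zp_units" "?v \<in> Zp_units" using C class_rep_unit by auto
      have uv0: "?u \<noteq> 0" "?v \<noteq> 0" using uv by auto
      have "(**) (hy M \<delta> ?u) ` K_level M = (**) (hy M \<delta> ?v) ` K_level M"
        using C(3) K_level_one[of M] by (auto simp: hy_coset_def l_coset_Kt times_eq_iff)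
      moreover have "hy M \<delta> ?v \<in> (**) (hy M \<delta> ?v) ` K_level M"
        using K_level_one by (force intro: image_eqI[of _ _ "mat 1"] simp: matrix_mul_rid)
      ultimately obtain k where k: "k \<in> K_level M" "hy M \<delta> ?v = hy M \<delta> ?u ** k" by blast
      then have "adj2 (hy M \<delta> ?u) ** hy M \<delta> ?v = k"
        using adj2_mult(1)[OF SL[OF uv(1)]] by (simp add: matrix_mul_assoc matrix_mul_lid)
      then have "(adj2 (hy M \<delta> ?u) ** hy M \<delta> ?v) $ 2 $ 1 \<in> pZ (int M)" using k by (simp add: mem_K_level)
      moreover have "(adj2 (hy M \<delta> ?u) ** hy M \<delta> ?v) $ 2 $ 1 = ?r * (inverse ?v * ?u - inverse ?u * ?v)"
        unfolding entries adj2_def by (simp add: algebra_simps)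
      moreover have "int M = int (M - 1) + 1" using M by simp
      ultimately have "?r * (inverse ?v * ?u - inverse ?u * ?v) \<in> pZ (int (M - 1) + 1)" by (simp only:)
      then have "inverse ?v * ?u - inverse ?u * ?v \<in> pZ 1" using pZ_cancel[OF \<delta>] by blast
      then have "(?u * ?v) * (inverse ?v * ?u - inverse ?u * ?v) \<in> pZ 1" using uv by simp
      also have "(?u * ?v) * (inverse ?v * ?u - inverse ?u * ?v) = ?u\<^sup>2 - ?v\<^sup>2"
        using uv0 by (simp add: power2_eq_square field_simps)
      finally show "C = C'" using C class_rep_inj by blast
    qed
    show "hy_coset M \<delta> ` unit_classes = {C \<in> lcosets\<^bsub>Mp\<^esub> (Kt M). \<exists>g\<in>C. V_fun \<eta> M \<delta> g \<noteq> 0}"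
    proof (intro equalityI subsetI)
      fix X assume "X \<in> hy_coset M \<delta> ` unit_classes"
      then obtain C where C: "C \<in> unit_classes" "X = hy_coset M \<delta> C" by blast
      let ?u = "class_rep C"
      have u: "?u \<in> Zp_units" using C class_rep_unit by auto
      have "(hy M \<delta> ?u, 1) \<in> carrier Mp" using SL[OF u] by (simp add: Mp_simps)
      then have "X \<in> lcosets\<^bsub>Mp\<^esub> (Kt M)" using C unfolding hy_coset_def LCOSETS_def by blast
      moreover have "(hy M \<delta> ?u, 1) \<in> X"
        using C K_level_one by (force simp: hy_coset_def l_coset_Kt intro: image_eqI[of _ _ "mat 1"] simp: matrix_mul_rid)
      ultimately show "X \<in> {C \<in> lcosets\<^bsub>Mp\<^esub> (Kt M). \<exists>g\<in>C. V_fun \<eta> M \<delta> g \<noteq> 0}"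
        using hy_mem(1)[OF M \<delta>Z u] W by blast
    next
      fix X assume "X \<in> {C \<in> lcosets\<^bsub>Mp\<^esub> (Kt M). \<exists>g\<in>C. V_fun \<eta> M \<delta> g \<noteq> 0}"
      then obtain x g where x: "x \<in> carrier Mp" "X = x <#\<^bsub>Mp\<^esub> Kt M" "g \<in> X" "g \<in> dcoset M \<delta>"
        unfolding LCOSETS_def W by blast
      obtain B e where B: "x = (B, e)" "B \<in> carrier SL2" "e = 1 \<or> e = - 1" using x(1) by (cases x) (auto simp: Mp_simps)
      obtain k k' where k: "k \<in> Kt M" "k' \<in> Kt M" "g = k \<otimes>\<^bsub>Mp\<^esub> y0 M \<delta> \<otimes>\<^bsub>Mp\<^esub> k'"
        using x(4) unfolding mem_dcoset by blast
      obtain A f A' f' where A: "k = (A, f)" "k' = (A', f')" "A \<in> K_level M" "A' \<in> K_level M"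
        using k by (cases k, cases k') (auto simp: mem_Kt)
      let ?Y = "A ** ym ?r"
      have "fst g = ?Y ** A'" by (simp add: k A y0_def Mp_simps)
      moreover obtain l where l: "l \<in> K_level M" "fst g = B ** l" using x B by (auto simp: l_coset_Kt)
      ultimately have "adj2 B ** ?Y ** A' = l"
        using adj2_mult(1)[OF B(2)] by (metis matrix_mul_assoc matrix_mul_lid)
      then have "adj2 B ** ?Y = l ** adj2 A'"
        using adj2_mult(2)[OF K_level_SL2[OF A(4)]] by (metis matrix_mul_assoc matrix_mul_rid)
      then have "adj2 B ** ?Y \<in> K_level M" using l A by simp
      then have BY: "(**) B ` K_level M = (**) ?Y ` K_level M" by (rule l_coset_K_level_eqI[OF B(2)])
      let ?a = "A $ 1 $ 1" and ?b = "A $ 1 $ 2" and ?c = "A $ 2 $ 1" and ?d = "A $ 2 $ 2"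
      have d: "?d \<in> Zp_units" "?a \<in> Zp_units" using K_level_diag_units[OF A(3)] M by auto
      have AM: "?b \<in> Zp" "?c \<in> pZ (int M)" "?a * ?d = 1 + ?b * ?c" using A(3) by (auto simp: mem_K_level mem_SL2 algebra_simps)
      \<comment> \<open>\<open>hy\<close> at u has lower right entry 1/u and \<open>?Y\<close> has
        d, so u must be 1/d up to sign mod p.\<close>
      obtain C where C: "C \<in> unit_classes" "(class_rep C)\<^sup>2 - (inverse ?d)\<^sup>2 \<in> pZ 1"
        using class_rep_surj Zp_units_closed(3)[OF d(1)] by blast
      let ?u = "class_rep C"
      have u: "?u \<in> Zp_units" using C class_rep_unit by auto
      have ud0: "?u \<noteq> 0" "?d \<noteq> 0" using u d by auto
      have "adj2 (hy M \<delta> ?u) ** ?Y \<in> K_level M"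
        unfolding mem_K_level
      proof (intro conjI)
        have Y1: "?Y \<in> K_level 1"
        proof (rule K_level_mult)
          show "A \<in> K_level 1" using K_level_mono[of 1 M A] A(3) M by simp
          show "ym ?r \<in> K_level 1"
            using y0_mem[OF \<delta>Z, of M] M unfolding y0_def mem_Kt by (intro K_level_mono[of 1 "M - 1"]) auto
        qed
        have "adj2 (hy M \<delta> ?u) ** ?Y \<in> K_level 1" using hy_mem(2)[OF M \<delta>Z u] Y1 by simp
        then show "adj2 (hy M \<delta> ?u) ** ?Y \<in> carrier SL2" "(adj2 (hy M \<delta> ?u) ** ?Y) $ 1 $ 1 \<in> Zp"
          "(adj2 (hy M \<delta> ?u) ** ?Y) $ 1 $ 2 \<in> Zp" "(adj2 (hy M \<delta> ?u) ** ?Y) $ 2 $ 2 \<in> Zp"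
          by (simp_all only: mem_K_level)
        have Y: "?Y $ 1 $ 1 = ?a + ?b * ?r" "?Y $ 2 $ 1 = ?c + ?d * ?r" by (simp_all add: matmul_nth ym_def)
        \<comment> \<open>The entry is regrouped into three terms, each in p^M: a multiple of c, a
          multiple of r^2, and r times u^2 d - a up to a unit, where u^2 d - a is in pZ because a =
          1/d and u^2 = 1/d^2 mod p.\<close>
        have "(adj2 (hy M \<delta> ?u) ** ?Y) $ 2 $ 1 = ?u * (?c + ?d * ?r) - inverse ?u * ?r * (?a + ?b * ?r)"
          unfolding matmul_nth[of "adj2 (hy M \<delta> ?u)"] Y unfolding entries adj2_def by simp
        also have "\<dots> = ?u * ?c - inverse ?u * ?b * (?r * ?r) + inverse ?u * ?r * (?u\<^sup>2 * ?d - ?a)"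
          using ud0 by (simp add: power2_eq_square algebra_simps)
        also have "?u\<^sup>2 * ?d - ?a = ?d * (?u\<^sup>2 - (inverse ?d)\<^sup>2) - inverse ?d * (?b * ?c)"
        proof -
          have a: "?a = inverse ?d * (1 + ?b * ?c)" unfolding AM(3)[symmetric] using ud0 by simp
          have dd: "?d * (inverse ?d)\<^sup>2 = inverse ?d" using ud0 by (simp add: power2_eq_square)
          have "?u\<^sup>2 * ?d - ?a = ?d * ?u\<^sup>2 - ?d * (inverse ?d)\<^sup>2 - inverse ?d * (?b * ?c)"
            unfolding a dd by (simp add: algebra_simps)
          then show ?thesis by (simp only: right_diff_distrib)
        qed
        finally have e: "(adj2 (hy M \<delta> ?u) ** ?Y) $ 2 $ 1 = ?u * ?c - inverse ?u * ?b * (?r * ?r)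
          + inverse ?u * (?r * (?d * (?u\<^sup>2 - (inverse ?d)\<^sup>2) - inverse ?d * (?b * ?c)))"
          by (simp add: mult.assoc)
        have "?c \<in> pZ 1" using AM(2) pZ_mono[of 1 "int M"] M by simp
        then have "?d * (?u\<^sup>2 - (inverse ?d)\<^sup>2) - inverse ?d * (?b * ?c) \<in> pZ 1"
          using C(2) d AM(1) by (intro pZ_closed(4)) auto
        then have 1: "?r * (?d * (?u\<^sup>2 - (inverse ?d)\<^sup>2) - inverse ?d * (?b * ?c)) \<in> pZ (int M)"
          using pZ_mult[OF r] by fastforce
        \<comment> \<open>Here M >= 2 enters: 2 (M - 1) >= M.\<close>
        have 2: "?r * ?r \<in> pZ (int M)"
          using pZ_mult[OF r r] pZ_mono[of "int M" "int M - 1 + (int M - 1)"] M by simp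
        show "(adj2 (hy M \<delta> ?u) ** ?Y) $ 2 $ 1 \<in> pZ (int M)"
          unfolding e using AM u
          by (intro pZ_closed(2)[OF pZ_closed(4)[OF _ pZ_closed(6)[OF 2]] pZ_closed(6)[OF 1]]) simp_all
      qed
      then have "(**) (hy M \<delta> ?u) ` K_level M = (**) ?Y ` K_level M"
        by (rule l_coset_K_level_eqI[OF SL[OF u]])
      then have "X = hy_coset M \<delta> C" using BY B x(2) by (simp add: hy_coset_def l_coset_Kt)
      then show "X \<in> hy_coset M \<delta> ` unit_classes" using C by blast
    qed
  qed
qed

text \<open>\<open>conv_act\<close> evaluates at an unspecified element of each coset. Replacing it
  by the standard one changes both \<open>V_fun\<close> and f by the same value of
  \<open>eta_cover\<close>, which is 1 or -1, so the product is unchanged.\<close>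

lemma V_op_eq:
  fixes f :: "'p mat2 \<times> int \<Rightarrow> 'v::ab_group_add"
  assumes M: "M \<ge> 2" and \<delta>: "\<delta> \<in> Zp_units" and sc: "vector_space sc"
    and f: "\<And>x k. x \<in> carrier Mp \<Longrightarrow> k \<in> Kt M \<Longrightarrow> f (x \<otimes>\<^bsub>Mp\<^esub> k) = sc (eta_cover \<eta> k) (f x)"
    and x: "x \<in> carrier Mp"
  shows "V_op sc \<eta> M \<delta> f x = (\<Sum>C\<in>unit_classes. sc (\<eta> (class_rep C)) (f (x \<otimes>\<^bsub>Mp\<^esub> (hy M \<delta> (class_rep C), 1))))"
proof -
  interpret sc: vector_space sc by (rule sc)
  interpret Mp: group "Mp :: ('p mat2 \<times> int) monoid" by (rule group_Mp)
  have \<delta>Z: "\<delta> \<in> Zp" using \<delta> by simp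
  have tm: "sc (V_fun \<eta> M \<delta> g) (f (x \<otimes>\<^bsub>Mp\<^esub> g)) = sc (\<eta> (class_rep C)) (f (x \<otimes>\<^bsub>Mp\<^esub> (hy M \<delta> (class_rep C), 1)))"
    if C: "C \<in> unit_classes" and g: "g = (SOME g. g \<in> hy_coset M \<delta> C)" for C g
  proof -
    let ?u = "class_rep C" let ?X = "(hy M \<delta> ?u, 1 :: int)"
    have u: "?u \<in> Zp_units" using C by (rule class_rep_unit)
    have X: "?X \<in> dcoset M \<delta>" "?X \<in> Kt 1"
      using hy_mem(1,2)[OF M \<delta>Z u] by (simp_all only: mem_Kt simp_thms)
    then have Xc: "?X \<in> carrier Mp" using Kt_carrier by blast
    have "\<one>\<^bsub>Mp\<^esub> \<in> Kt M" by (rule subgroup.one_closed[OF subgroup_Kt])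
    then have "hy_coset M \<delta> C \<noteq> {}" unfolding hy_coset_def l_coset_def by blast
    then have "g \<in> hy_coset M \<delta> C" unfolding g by (simp add: some_in_eq)
    then obtain k where k: "k \<in> Kt M" "g = ?X \<otimes>\<^bsub>Mp\<^esub> k" by (auto simp: hy_coset_def l_coset_def)
    have k1: "k \<in> Kt 1" using k(1) Kt_mono[of 1 M] M by auto
    then have kc: "k \<in> carrier Mp" using Kt_carrier by blast
    have "\<one>\<^bsub>Mp\<^esub> \<otimes>\<^bsub>Mp\<^esub> ?X \<otimes>\<^bsub>Mp\<^esub> k \<in> dcoset M \<delta>"
      using X k dcoset_mult_iff[OF \<open>\<one>\<^bsub>Mp\<^esub> \<in> Kt M\<close> k(1) Xc \<delta>Z] by blast
    then have gW: "g \<in> dcoset M \<delta>" using Xc k by simp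
    have "eta_cover \<eta> g = \<eta> ?u * eta_cover \<eta> k"
      using eta_cover_mult[OF X(2) k1] k(2) eta_inverse[OF u] by (simp add: eta_cover_def hm_def ym_def)
    then have V: "V_fun \<eta> M \<delta> g = \<eta> ?u * eta_cover \<eta> k" using V_fun_eq[OF M \<delta>Z] gW by simp
    have "f (x \<otimes>\<^bsub>Mp\<^esub> g) = sc (eta_cover \<eta> k) (f (x \<otimes>\<^bsub>Mp\<^esub> ?X))"
      using f[of "x \<otimes>\<^bsub>Mp\<^esub> ?X" k] x Xc k kc by (simp add: Mp.m_assoc)
    then show ?thesis using V eta_cover_values[OF k1] by auto
  qed
  have "V_op sc \<eta> M \<delta> f x = (\<Sum>C \<in> {C \<in> lcosets\<^bsub>Mp\<^esub> (Kt M). \<exists>g\<in>C. V_fun \<eta> M \<delta> g \<noteq> 0}.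
      (let g = (SOME g. g \<in> C) in sc (V_fun \<eta> M \<delta> g) (f (x \<otimes>\<^bsub>Mp\<^esub> g))))"
    by (simp add: V_op_def conv_act_def)
  also have "\<dots> = (\<Sum>C\<in>unit_classes. (let g = (SOME g. g \<in> hy_coset M \<delta> C) in sc (V_fun \<eta> M \<delta> g) (f (x \<otimes>\<^bsub>Mp\<^esub> g))))"
    by (rule sum.reindex_bij_betw[OF hy_coset_bij[OF M \<delta>], symmetric])
  also have "\<dots> = (\<Sum>C\<in>unit_classes. sc (\<eta> (class_rep C)) (f (x \<otimes>\<^bsub>Mp\<^esub> (hy M \<delta> (class_rep C), 1))))"
    by (rule sum.cong) (simp_all only: Let_def tm)
  finally show ?thesis .
qed

end

section \<open>Vectors in the compactly induced representation\<close>

lemma pp_power_square: "((pp :: 'p::prime_card qp) ^ m)\<^sup>2 = pp powi (2 * int m)"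
  by (metis power_mult mult.commute power_int_of_nat of_nat_mult of_nat_numeral)

lemma divide_pp_power_square:
  assumes "r \<in> pZ n" shows "r / (pp ^ m)\<^sup>2 \<in> pZ (n - 2 * int m)"
proof -
  have "r * pp powi (- (2 * int m)) \<in> pZ (n + - (2 * int m))" by (rule pZ_mult[OF assms pp_powi_mem_pZ])
  then show ?thesis unfolding pp_power_square by (simp add: power_int_minus divide_inverse)
qed

text \<open>Common form of the four cases. Since h(p^m) multiplies the parameter of x by p^(2m) and
  divides that of y by p^(2m), it carries the factors x, h, y of \<open>K_level M\<close> to those
  on which v is assumed fixed or an eigenvector. The larger range of y in \<open>yK\<close> is for
  the conjugate of \<open>y0\<close>, which need not fix v. The sign \<open>\<psi>\<close> is the
  splitting on the torus.\<close>

locale induced_vector = eta_setting prime_type \<eta> s0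
  for prime_type :: "'p::prime_card itself" and \<eta> :: "'p qp \<Rightarrow> complex" and s0 :: "'p mat2 \<Rightarrow> int" +
  fixes sc :: "complex \<Rightarrow> 'v::ab_group_add \<Rightarrow> 'v" and K :: "'p mat2 set" and s :: "'p mat2 \<Rightarrow> int"
    and \<rho> :: "'p mat2 \<Rightarrow> 'v \<Rightarrow> 'v" and m M :: nat and \<psi> :: "'p qp \<Rightarrow> int" and v :: 'v
  assumes sc: "vector_space sc"
    and K_SL: "K \<subseteq> carrier SL2"
    and K_mult: "\<And>k k'. k \<in> K \<Longrightarrow> k' \<in> K \<Longrightarrow> k ** k' \<in> K"
    and K_adj: "\<And>k. k \<in> K \<Longrightarrow> adj2 k \<in> K"
    and split: "is_splitting K s"
    and lin: "\<And>k. k \<in> K \<Longrightarrow> Vector_Spaces.linear sc sc (\<rho> k)"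
    and rho_mult: "\<And>k k' w. k \<in> K \<Longrightarrow> k' \<in> K \<Longrightarrow> \<rho> (k ** k') w = \<rho> k (\<rho> k' w)"
    and M: "M \<ge> 2"
    and yK: "\<And>t. t \<in> pZ (int M - 1 - 2 * int m) \<Longrightarrow> ym t \<in> K \<and> s (ym t) = 1"
    and xK: "\<And>t. t \<in> pZ (2 * int m) \<Longrightarrow> xm t \<in> K \<and> s (xm t) = 1"
    and hK: "\<And>u. u \<in> Zp_units \<Longrightarrow> hm u \<in> K \<and> s (hm u) = \<psi> u"
    and v_y: "\<And>t. t \<in> pZ (int M - 2 * int m) \<Longrightarrow> \<rho> (ym t) v = v"
    and v_x: "\<And>t. t \<in> pZ (2 * int m) \<Longrightarrow> \<rho> (xm t) v = v"
    and v_h: "\<And>u. u \<in> Zp_units \<Longrightarrow> \<rho> (hm u) v = sc (\<eta> u * of_int (\<psi> u)) v"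
begin

sublocale sc: vector_space sc by (rule sc)

sublocale Mp: group "Mp :: ('p mat2 \<times> int) monoid" by (rule group_Mp)

abbreviation hp :: "'p mat2" where "hp \<equiv> hm (pp ^ m)"

abbreviation f :: "'v \<Rightarrow> 'p mat2 \<times> int \<Rightarrow> 'v" where
  "f \<equiv> f_vec sc K (genuine_lift sc s \<rho>) m"

lemma hp_SL: "hp \<in> carrier SL2"
  by simp

lemma mem_K_SL: "k \<in> K \<Longrightarrow> k \<in> carrier SL2"
  using K_SL by blast

lemma hp_cancel: "k ** hp = k' ** hp \<Longrightarrow> k = k'"
  using adj2_mult(2)[OF hp_SL] by (metis matrix_mul_assoc matrix_mul_rid)

lemma hp_carrier: "(hp, 1) \<in> carrier Mp"
  by (simp add: Mp_simps)

text \<open>The cocycle in the definition of \<open>f_vec\<close> cancels the one from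
  multiplication in the cover, so on this coset the function is the genuine lift applied to
  w.\<close>

lemma f_at:
  assumes "k \<in> K"
  shows "f w ((k, e) \<otimes>\<^bsub>Mp\<^esub> (hp, 1)) = sc (of_int (e * s k)) (\<rho> k w)"
proof -
  have the: "(THE k'. k' \<in> K \<and> k ** hp = k' ** hp) = k"
    using assms hp_cancel by (intro the_equality) auto
  have "\<exists>k'\<in>K. k ** hp = k' ** hp" using assms by blast
  then have "f w ((k, e) \<otimes>\<^bsub>Mp\<^esub> (hp, 1)) = sc (of_int (cocycle k hp * (e * cocycle k hp))) (sc (of_int (s k)) (\<rho> k w))"
    by (simp add: f_vec_def Mp_simps the genuine_lift_def Let_def)
  also have "cocycle k hp * (e * cocycle k hp) = e" using cocycle_values[of k hp] by auto
  finally show ?thesis by simp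
qed

lemma f_outside: "\<not> (\<exists>k\<in>K. g = k ** hp) \<Longrightarrow> f w (g, e) = 0"
  by (simp add: f_vec_def)

lemma carrier_cases:
  assumes "x \<in> carrier Mp"
  obtains k e where "k \<in> K" "e = 1 \<or> e = - 1" "x = (k, e) \<otimes>\<^bsub>Mp\<^esub> (hp, 1)"
    | "\<not> (\<exists>k\<in>K. fst x = k ** hp)"
proof (cases "\<exists>k\<in>K. fst x = k ** hp")
  case True
  then obtain k where k: "k \<in> K" "fst x = k ** hp" by blast
  obtain e where e: "x = (k ** hp, e)" "e = 1 \<or> e = - 1" using assms k by (cases x) (auto simp: Mp_simps)
  have "x = (k, e * cocycle k hp) \<otimes>\<^bsub>Mp\<^esub> (hp, 1)"
    using e cocycle_values[of k hp] by (auto simp: Mp_simps)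
  moreover have "e * cocycle k hp = 1 \<or> e * cocycle k hp = - 1" using e cocycle_values[of k hp] by auto
  ultimately show ?thesis using that(1) k by blast
qed (use that in blast)

text \<open>Says that (hp, 1) conjugates (k, e) to (k', e) with the same sign, written without
  inverses.\<close>

definition conj_hp :: "'p mat2 \<Rightarrow> 'p mat2 \<Rightarrow> bool" where
  "conj_hp k k' \<longleftrightarrow> k \<in> carrier SL2 \<and> k' \<in> K \<and> hp ** k = k' ** hp \<and> cocycle hp k = cocycle k' hp"

lemma conj_hp_Mp:
  assumes "conj_hp k k'"
  shows "(hp, 1) \<otimes>\<^bsub>Mp\<^esub> (k, e) = (k', e) \<otimes>\<^bsub>Mp\<^esub> (hp, 1)"
  using assms by (simp add: conj_hp_def Mp_simps)

lemma shift:
  assumes "conj_hp k k'" "\<kappa> \<in> K" "\<epsilon> = 1 \<or> \<epsilon> = - 1" "e = 1 \<or> e = - 1"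
  shows "(\<kappa>, \<epsilon>) \<otimes>\<^bsub>Mp\<^esub> (hp, 1) \<otimes>\<^bsub>Mp\<^esub> (k, e) = (\<kappa> ** k', \<epsilon> * e * cocycle \<kappa> k') \<otimes>\<^bsub>Mp\<^esub> (hp, 1)"
proof -
  have k: "(k, e) \<in> carrier Mp" "(k', e) \<in> carrier Mp" "(\<kappa>, \<epsilon>) \<in> carrier Mp"
    using assms by (auto simp: conj_hp_def Mp_simps mem_K_SL)
  have "(\<kappa>, \<epsilon>) \<otimes>\<^bsub>Mp\<^esub> (hp, 1) \<otimes>\<^bsub>Mp\<^esub> (k, e) = (\<kappa>, \<epsilon>) \<otimes>\<^bsub>Mp\<^esub> (k', e) \<otimes>\<^bsub>Mp\<^esub> (hp, 1)"
    using k hp_carrier conj_hp_Mp[OF assms(1)] by (simp add: Mp.m_assoc)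
  then show ?thesis by (simp add: Mp_simps(1)[of \<kappa>])
qed

lemma f_shift:
  assumes "conj_hp k k'" "\<kappa> \<in> K" "\<epsilon> = 1 \<or> \<epsilon> = - 1" "e = 1 \<or> e = - 1"
  shows "f w ((\<kappa>, \<epsilon>) \<otimes>\<^bsub>Mp\<^esub> (hp, 1) \<otimes>\<^bsub>Mp\<^esub> (k, e)) = sc (of_int (\<epsilon> * s \<kappa> * (e * s k'))) (\<rho> \<kappa> (\<rho> k' w))"
proof -
  have k': "k' \<in> K" using assms by (simp add: conj_hp_def)
  have "f w ((\<kappa>, \<epsilon>) \<otimes>\<^bsub>Mp\<^esub> (hp, 1) \<otimes>\<^bsub>Mp\<^esub> (k, e)) =
      sc (of_int (\<epsilon> * e * cocycle \<kappa> k' * s (\<kappa> ** k'))) (\<rho> \<kappa> (\<rho> k' w))"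
    using shift[OF assms] f_at[OF K_mult[OF assms(2) k']] rho_mult[OF assms(2) k'] by simp
  also have "\<epsilon> * e * cocycle \<kappa> k' * s (\<kappa> ** k') = \<epsilon> * s \<kappa> * (e * s k')"
    using is_splittingD(2)[OF split assms(2) k'] cocycle_values[of \<kappa> k'] by auto
  finally show ?thesis .
qed

text \<open>Translation by k preserves the complement of the coset K hp, as k' normalizes back into
  K. The second conclusion lets the first be applied after another translation, as needed for h(u)
  followed by y.\<close>

lemma f_shift_outside:
  assumes "conj_hp k k'" "\<not> (\<exists>k\<in>K. fst x = k ** hp)"
  shows "f w (x \<otimes>\<^bsub>Mp\<^esub> (k, e)) = 0" "\<not> (\<exists>\<kappa>\<in>K. fst (x \<otimes>\<^bsub>Mp\<^esub> (k, e)) = \<kappa> ** hp)"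
proof -
  obtain g a where x: "x = (g, a)" by fastforce
  have k: "k \<in> carrier SL2" "k' \<in> K" "hp ** k = k' ** hp" using assms by (simp_all add: conj_hp_def)
  have "hp ** adj2 k = adj2 k' ** hp"
  proof -
    have "hp ** adj2 k = adj2 k' ** (k' ** hp) ** adj2 k"
      using adj2_mult(1)[OF mem_K_SL[OF k(2)]] by (simp add: matrix_mul_assoc matrix_mul_lid)
    also have "\<dots> = adj2 k' ** hp ** (k ** adj2 k)" using k(3) by (metis matrix_mul_assoc)
    finally show ?thesis using adj2_mult(2)[OF k(1)] by (simp add: matrix_mul_rid)
  qed
  then have "g = (\<kappa> ** adj2 k') ** hp" if "g ** k = \<kappa> ** hp" for \<kappa>
    using that adj2_mult(2)[OF k(1)] by (metis matrix_mul_assoc matrix_mul_rid)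
  then have no: "\<not> (\<exists>\<kappa>\<in>K. g ** k = \<kappa> ** hp)" using assms(2) K_mult K_adj k(2) by (metis x fst_conv)
  then show "\<not> (\<exists>\<kappa>\<in>K. fst (x \<otimes>\<^bsub>Mp\<^esub> (k, e)) = \<kappa> ** hp)" by (simp add: x Mp_simps)
  show "f w (x \<otimes>\<^bsub>Mp\<^esub> (k, e)) = 0" using no by (simp add: x Mp_simps f_outside)
qed

lemma f_eigen:
  assumes "conj_hp k k'" "\<rho> k' v = sc \<mu> v" "x \<in> carrier Mp" "e = 1 \<or> e = - 1"
  shows "f v (x \<otimes>\<^bsub>Mp\<^esub> (k, e)) = sc (of_int (e * s k') * \<mu>) (f v x)"
  using assms(3)
proof (cases rule: carrier_cases)
  case (1 \<kappa> \<epsilon>)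
  interpret lin: Vector_Spaces.linear sc sc "\<rho> \<kappa>" using lin 1 by blast
  show ?thesis
    using f_shift[OF assms(1) 1(1,2) assms(4)] f_at[OF 1(1)] assms(2) 1(3)
    by (simp add: lin.scale mult_ac)
next
  case 2
  obtain g a where x: "x = (g, a)" by fastforce
  show ?thesis using f_shift_outside[OF assms(1) 2] f_outside 2 by (simp add: x)
qed

lemma conj_hp_ym: "r \<in> pZ (int M - 1) \<Longrightarrow> conj_hp (ym r) (ym (r / (pp ^ m)\<^sup>2))"
  and conj_hp_ym_mem: "r \<in> pZ (int M) \<Longrightarrow> r / (pp ^ m)\<^sup>2 \<in> pZ (int M - 2 * int m)"
  and conj_hp_xm: "t \<in> Zp \<Longrightarrow> conj_hp (xm t) (xm (t * (pp ^ m)\<^sup>2))"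
  and conj_hp_xm_mem: "t \<in> Zp \<Longrightarrow> t * (pp ^ m)\<^sup>2 \<in> pZ (2 * int m)"
  and conj_hp_hm: "u \<in> Zp_units \<Longrightarrow> conj_hp (hm u) (hm u)"
proof -
  show "conj_hp (ym r) (ym (r / (pp ^ m)\<^sup>2))" if "r \<in> pZ (int M - 1)"
    using yK[OF divide_pp_power_square[OF that]] unfolding conj_hp_def
    by (simp add: hm_ym cocycle_hm_ym)
  show "r / (pp ^ m)\<^sup>2 \<in> pZ (int M - 2 * int m)" if "r \<in> pZ (int M)" using that by (rule divide_pp_power_square)
  show x: "t * (pp ^ m)\<^sup>2 \<in> pZ (2 * int m)" if "t \<in> Zp" for t :: "'p qp"
    unfolding pp_power_square using pp_powi_mem_pZ that by (rule pZ_closed(6))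
  show "conj_hp (xm t) (xm (t * (pp ^ m)\<^sup>2))" if "t \<in> Zp"
    using xK[OF x[OF that]] unfolding conj_hp_def
    by (simp add: hm_xm cocycle_hm_xm)
  show "conj_hp (hm u) (hm u)" if "u \<in> Zp_units"
    using hK[OF that] that unfolding conj_hp_def
    by (simp add: hm_mult mult.commute cocycle_hm_hm)
qed

text \<open>This is the hypothesis that \<open>V_op_eq\<close> makes on f. The sign
  \<open>\<psi> u\<close> arises twice, from the splitting and from the eigencharacter of v, and
  cancels. What remains is \<open>\<eta> u\<close>, and the lower right entry is 1/u mod p, where
  \<open>\<eta>\<close> has the same value since it is quadratic.\<close>

lemma f_equivariant:
  assumes x: "x \<in> carrier Mp" and k: "k \<in> Kt M"
  shows "f v (x \<otimes>\<^bsub>Mp\<^esub> k) = sc (eta_cover \<eta> k) (f v x)"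
proof -
  obtain A e where A: "k = (A, e)" "A \<in> K_level M" "e = 1 \<or> e = - 1" using k by (cases k) (auto simp: mem_Kt)
  obtain r u t where d: "r \<in> pZ (int M)" "u \<in> Zp_units" "t \<in> Zp" "A = ym r ** hm u ** xm t"
    using iwahori_decomp[OF A(2)] M by (metis one_le_numeral order_trans)
  have r1: "r \<in> pZ (int 1)" using pZ_mono[of 1 "int M" r] d(1) M by simp
  have r': "r \<in> pZ (int M - 1)" using pZ_mono[of "int M - 1" "int M" r] d(1) by simp
  have K1: "ym r \<in> K_level 1" "hm u \<in> K_level 1" "xm t \<in> K_level 1"
    using r1 d ym_mem_K_level hm_mem_K_level xm_mem_K_level by blast+
  have c: "(ym r, 1) \<in> carrier Mp" "(hm u, 1) \<in> carrier Mp" "(xm t, e) \<in> carrier Mp"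
    using A(3) d by (simp_all add: Mp_simps)
  have k: "k = (ym r, 1) \<otimes>\<^bsub>Mp\<^esub> (hm u, 1) \<otimes>\<^bsub>Mp\<^esub> (xm t, e)"
    using K1 by (simp add: A d Mp_simps cocycle_K_level)
  have "f v (x \<otimes>\<^bsub>Mp\<^esub> k) = f v (x \<otimes>\<^bsub>Mp\<^esub> (ym r, 1) \<otimes>\<^bsub>Mp\<^esub> (hm u, 1) \<otimes>\<^bsub>Mp\<^esub> (xm t, e))"
    using x c k by (simp add: Mp.m_assoc)
  also have "\<dots> = sc (of_int e) (f v (x \<otimes>\<^bsub>Mp\<^esub> (ym r, 1) \<otimes>\<^bsub>Mp\<^esub> (hm u, 1)))"
    using f_eigen[OF conj_hp_xm[OF d(3)], of 1 _ e] v_x[OF conj_hp_xm_mem[OF d(3)]] xK[OF conj_hp_xm_mem[OF d(3)]] x c A(3)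
    by simp
  also have "f v (x \<otimes>\<^bsub>Mp\<^esub> (ym r, 1) \<otimes>\<^bsub>Mp\<^esub> (hm u, 1)) = sc (of_int (\<psi> u) * (\<eta> u * of_int (\<psi> u))) (f v (x \<otimes>\<^bsub>Mp\<^esub> (ym r, 1)))"
    using f_eigen[OF conj_hp_hm[OF d(2)] v_h[OF d(2)], of "x \<otimes>\<^bsub>Mp\<^esub> (ym r, 1)" 1] hK[OF d(2)] x c by simp
  also have "of_int (\<psi> u) * (\<eta> u * of_int (\<psi> u)) = \<eta> u"
    using is_splittingD(1)[OF split, of "hm u"] hK[OF d(2)] by auto
  also have "f v (x \<otimes>\<^bsub>Mp\<^esub> (ym r, 1)) = f v x"
    using f_eigen[OF conj_hp_ym[OF r'], of 1 x 1] v_y[OF conj_hp_ym_mem[OF d(1)]]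
      yK[OF pZ_mono[OF _ conj_hp_ym_mem[OF d(1)]]] x by simp
  finally have "f v (x \<otimes>\<^bsub>Mp\<^esub> k) = sc (of_int e * \<eta> u) (f v x)" by simp
  moreover have "eta_cover \<eta> k = of_int e * \<eta> u"
  proof -
    have u0: "u \<noteq> 0" using d by simp
    have "A $ 2 $ 2 = r * u * t + inverse u" by (simp add: d ym_def hm_def xm_def)
    moreover have "r * u * t \<in> pZ 1" using r1 d by simp
    moreover have "A $ 2 $ 2 \<in> Zp" using A(2) by (simp add: mem_K_level)
    ultimately have "\<eta> (A $ 2 $ 2) = \<eta> (inverse u)" using d by (intro eta_cong) auto
    then show ?thesis using eta_inverse[OF d(2)] by (simp add: A eta_cover_def)
  qed
  ultimately show ?thesis by simp
qed

text \<open>On K hp, translation by h(u) and then by y is moved across hp and becomes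
  \<open>\<rho>\<close> of the conjugates acting on v, inside \<open>\<rho> \<kappa>\<close>;
  linearity takes \<open>\<rho> \<kappa>\<close> out of the sum. Elsewhere both sides
  vanish.\<close>

lemma V_op_f:
  assumes \<delta>: "\<delta> \<in> Zp_units" and x: "x \<in> carrier Mp"
  shows "V_op sc \<eta> M \<delta> (f v) x =
    f (\<Sum>C\<in>unit_classes. sc (\<eta> (class_rep C) * of_int (\<psi> (class_rep C)))
        (\<rho> (hm (class_rep C) ** ym (\<delta> * pp ^ (M - 1) / (pp ^ m)\<^sup>2)) v)) x"
    (is "_ = f ?S x")
proof -
  let ?r = "\<delta> * pp ^ (M - 1)" and ?r' = "\<delta> * pp ^ (M - 1) / (pp ^ m)\<^sup>2"
  have \<delta>Z: "\<delta> \<in> Zp" using \<delta> by simp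
  have r: "?r \<in> pZ (int M - 1)"
    using pZ_closed(6)[OF pp_power_mem_pZ \<delta>Z, of "M - 1"] M by (simp add: of_nat_diff)
  have cy: "conj_hp (ym ?r) (ym ?r')" using r by (rule conj_hp_ym)
  then have yK': "ym ?r' \<in> K" by (simp add: conj_hp_def)
  have sy: "s (ym ?r') = 1"
    using yK[OF divide_pp_power_square[OF r]] by blast
  have V: "V_op sc \<eta> M \<delta> (f v) x =
      (\<Sum>C\<in>unit_classes. sc (\<eta> (class_rep C)) (f v (x \<otimes>\<^bsub>Mp\<^esub> (hy M \<delta> (class_rep C), 1))))"
    using V_op_eq[OF M \<delta> sc f_equivariant x] .
  have split_hy: "x \<otimes>\<^bsub>Mp\<^esub> (hy M \<delta> u, 1) = x \<otimes>\<^bsub>Mp\<^esub> (hm u, 1) \<otimes>\<^bsub>Mp\<^esub> (ym ?r, 1)" if u: "u \<in> Zp_units" for u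
  proof -
    have "(hm u, 1) \<in> carrier Mp" "(ym ?r, 1) \<in> carrier Mp" using u by (simp_all add: Mp_simps)
    then show ?thesis using hy_mem(3)[OF M \<delta>Z u] x by (simp add: y0_def Mp.m_assoc)
  qed
  from x show ?thesis
  proof (cases rule: carrier_cases)
    case (1 \<kappa> \<epsilon>)
    interpret lin: Vector_Spaces.linear sc sc "\<rho> \<kappa>" using lin 1 by blast
    have "f v (x \<otimes>\<^bsub>Mp\<^esub> (hy M \<delta> u, 1)) = sc (of_int (\<epsilon> * s \<kappa>)) (\<rho> \<kappa> (sc (of_int (\<psi> u)) (\<rho> (hm u ** ym ?r') v)))"
      if u: "u \<in> Zp_units" for u
    proof -
      have ch: "conj_hp (hm u) (hm u)" using u by (rule conj_hp_hm)
      have hK': "hm u \<in> K" "s (hm u) = \<psi> u" using hK[OF u] by auto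
      let ?\<kappa> = "\<kappa> ** hm u" and ?\<epsilon> = "\<epsilon> * cocycle \<kappa> (hm u)"
      have k2: "?\<kappa> \<in> K" "?\<epsilon> = 1 \<or> ?\<epsilon> = - 1" using K_mult 1 hK' cocycle_values[of \<kappa> "hm u"] by auto
      have "x \<otimes>\<^bsub>Mp\<^esub> (hm u, 1) = (?\<kappa>, ?\<epsilon>) \<otimes>\<^bsub>Mp\<^esub> (hp, 1)" using shift[OF ch 1(1,2), of 1] 1(3) by simp
      then have "f v (x \<otimes>\<^bsub>Mp\<^esub> (hy M \<delta> u, 1)) = sc (of_int (?\<epsilon> * s ?\<kappa> * (1 * s (ym ?r')))) (\<rho> ?\<kappa> (\<rho> (ym ?r') v))"
        using f_shift[OF cy k2, of 1 v] split_hy[OF u] by simp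
      also have "?\<epsilon> * s ?\<kappa> * (1 * s (ym ?r')) = \<epsilon> * s \<kappa> * \<psi> u"
        using is_splittingD(2)[OF split 1(1) hK'(1)] hK' sy cocycle_values[of \<kappa> "hm u"] by auto
      also have "\<rho> ?\<kappa> (\<rho> (ym ?r') v) = \<rho> \<kappa> (\<rho> (hm u ** ym ?r') v)"
        using rho_mult 1(1) hK'(1) yK' by simp
      finally show ?thesis by (simp add: lin.scale)
    qed
    then have "V_op sc \<eta> M \<delta> (f v) x = (\<Sum>C\<in>unit_classes. sc (\<eta> (class_rep C))
        (sc (of_int (\<epsilon> * s \<kappa>)) (\<rho> \<kappa> (sc (of_int (\<psi> (class_rep C))) (\<rho> (hm (class_rep C) ** ym ?r') v)))))"
      unfolding V by (intro sum.cong refl) (simp add: class_rep_unit)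
    also have "\<dots> = sc (of_int (\<epsilon> * s \<kappa>)) (\<rho> \<kappa> ?S)"
      unfolding lin.sum sc.scale_sum_right by (intro sum.cong refl) (simp add: lin.scale mult_ac)
    also have "\<dots> = f ?S x" using f_at[OF 1(1)] 1(3) by simp
    finally show ?thesis .
  next
    case 2
    have "f v (x \<otimes>\<^bsub>Mp\<^esub> (hy M \<delta> u, 1)) = 0" if u: "u \<in> Zp_units" for u
      unfolding split_hy[OF u] by (rule f_shift_outside(1)[OF cy f_shift_outside(2)[OF conj_hp_hm[OF u] 2]])
    then have "V_op sc \<eta> M \<delta> (f v) x = 0"
      unfolding V by (intro sum.neutral ballI) (simp add: class_rep_unit)
    moreover have "f ?S x = 0" using f_outside 2 by (cases x) simp
    ultimately show ?thesis by simp
  qed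
qed

lemma f_add: "x \<in> carrier Mp \<Longrightarrow> f (w + w') x = f w x + f w' x"
proof (erule carrier_cases)
  fix k e assume k: "k \<in> K" "x = (k, e) \<otimes>\<^bsub>Mp\<^esub> (hp, 1)"
  interpret lin: Vector_Spaces.linear sc sc "\<rho> k" using lin k by blast
  show "f (w + w') x = f w x + f w' x" by (simp add: k f_at lin.add sc.scale_right_distrib)
next
  assume "\<not> (\<exists>k\<in>K. fst x = k ** hp)"
  then show "f (w + w') x = f w x + f w' x" by (cases x) (simp add: f_outside)
qed

end

section \<open>Sums over residues\<close>

text \<open>Adding z and reducing is an injective self-map of the finite set of residues, hence a
  permutation.\<close>

lemma sum_residues_shift:
  fixes G :: "'p::prime_card qp \<Rightarrow> 'v::ab_group_add"
  assumes G: "\<And>x y. x \<in> Zp \<Longrightarrow> y \<in> Zp \<Longrightarrow> x - y \<in> pZ 1 \<Longrightarrow> G x = G y" and z: "z \<in> Zp"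
  shows "(\<Sum>n\<in>{0..<int CARD('p)}. G (z + of_int n)) = (\<Sum>n\<in>{0..<int CARD('p)}. G (of_int n))"
proof -
  let ?N = "{0..<int CARD('p)}" and ?h = "\<lambda>n. residue (z + of_int n)"
  have Z: "z + of_int n \<in> Zp" for n using z by simp
  have inj: "inj_on ?h ?N"
  proof (rule inj_onI)
    fix n k assume nk: "n \<in> ?N" "k \<in> ?N" "?h n = ?h k"
    then have "(of_int (n - k) :: 'p qp) \<in> pZ 1" using residue_eq_iff[OF Z Z] by simp
    then have "n mod int CARD('p) = k mod int CARD('p)" unfolding of_int_mem_pZ_1 by (simp add: mod_eq_dvd_iff)
    then show "n = k" using nk by simp
  qed
  have sub: "?h ` ?N \<subseteq> ?N" using residue_spec(1,2)[OF Z] by auto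
  then have "?h ` ?N = ?N" using inj by (simp add: card_image card_subset_eq)
  then have "(\<Sum>n\<in>?N. G (of_int n)) = (\<Sum>n\<in>?N. G (of_int (?h n)))"
    using sum.reindex[OF inj, of "\<lambda>n. G (of_int n)"] by simp
  also have "\<dots> = (\<Sum>n\<in>?N. G (z + of_int n))"
    using residue_spec(3)[OF Z, THEN pZ_closed(3)] by (intro sum.cong refl G) (auto simp: z)
  finally show ?thesis ..
qed

context odd_prime
begin

text \<open>The division by u^2 comes from moving h(u) past y. The Legendre symbol of \<delta> / u^2
  is that of \<delta>, which keeps the two images apart. Conversely, if x and \<delta> have the same
  symbol, then \<delta> / x is a square y^2, and the class of y is sent to the residue of x.\<close>

lemma residues_square_classes:
  assumes lam: "lam \<in> (Zp_units :: 'p qp set)" "\<not> (\<exists>x\<in>Zp. lam - x\<^sup>2 \<in> pZ 1)"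
  defines "r \<equiv> (\<lambda>\<delta> C. residue (\<delta> / (class_rep C)\<^sup>2) :: int)"
  shows "inj_on (r 1) (unit_classes :: 'p qp set set)" "inj_on (r lam) (unit_classes :: 'p qp set set)"
    "{0..<int CARD('p)} = insert 0 (r 1 ` (unit_classes :: 'p qp set set) \<union> r lam ` unit_classes)"
    "0 \<notin> r 1 ` (unit_classes :: 'p qp set set) \<union> r lam ` unit_classes"
    "r 1 ` (unit_classes :: 'p qp set set) \<inter> r lam ` unit_classes = {}"
proof -
  let ?U = "unit_classes :: 'p qp set set"
  have legl: "legendre_p lam = - 1" using legendre_p_values[OF lam(1)] legendre_p_eq_1_iff[OF lam(1)] lam(2) by blast
  have leg1: "legendre_p (1 :: 'p qp) = 1" using legendre_p_mult[of 1 1] legendre_p_values[of "1 :: 'p qp"] by auto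
  have unit: "\<delta> / (class_rep C)\<^sup>2 \<in> Zp_units" if "\<delta> \<in> Zp_units" "C \<in> ?U" for \<delta> C
    using that class_rep_unit[OF that(2)] by (simp add: divide_inverse flip: power_inverse)
  have leg: "legendre_p (\<delta> / (class_rep C)\<^sup>2) = legendre_p \<delta>" if "\<delta> \<in> Zp_units" "C \<in> ?U" for \<delta> C
  proof -
    have c: "inverse (class_rep C) \<in> Zp_units" using class_rep_unit[OF that(2)] by simp
    have "\<delta> / (class_rep C)\<^sup>2 = \<delta> * (inverse (class_rep C) * inverse (class_rep C))"
      by (simp add: divide_inverse power2_eq_square)
    then show ?thesis using that c legendre_p_mult[OF that(1) Zp_units_closed(2)[OF c c]] legendre_p_mult[OF c c]
        legendre_p_values[OF c] by auto
  qed
  have inj: "inj_on (r \<delta>) ?U" if \<delta>: "\<delta> \<in> Zp_units" for \<delta>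
  proof (rule inj_onI)
    fix C C' assume C: "C \<in> ?U" "C' \<in> ?U" "r \<delta> C = r \<delta> C'"
    let ?u = "class_rep C" and ?v = "class_rep C'"
    have u: "?u \<in> Zp_units" "?v \<in> Zp_units" using C class_rep_unit by blast+
    have "\<delta> / ?u\<^sup>2 - \<delta> / ?v\<^sup>2 \<in> pZ 1" using C(3) residue_eq_iff[OF unit[OF \<delta> C(1), THEN Zp_units_imp_Zp] unit[OF \<delta> C(2), THEN Zp_units_imp_Zp]]
      unfolding r_def by simp
    then have "(- inverse \<delta> * ?u\<^sup>2 * ?v\<^sup>2) * (\<delta> / ?u\<^sup>2 - \<delta> / ?v\<^sup>2) \<in> pZ 1" using u \<delta> by (intro pZ_closed(6)) auto
    moreover have "(- inverse \<delta> * ?u\<^sup>2 * ?v\<^sup>2) * (\<delta> / ?u\<^sup>2 - \<delta> / ?v\<^sup>2) = ?u\<^sup>2 - ?v\<^sup>2" using u \<delta>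
      by (simp add: field_simps)
    ultimately show "C = C'" using class_rep_inj[OF C(1,2)] by simp
  qed
  show "inj_on (r 1) ?U" "inj_on (r lam) ?U" using inj lam(1) by auto
  have nz: "r \<delta> C \<noteq> 0" if "\<delta> \<in> Zp_units" "C \<in> ?U" for \<delta> C
    using residue_eq_0_iff[OF unit[OF that, THEN Zp_units_imp_Zp]] Zp_units_not_pZ[OF unit[OF that]] unfolding r_def by blast
  show "0 \<notin> r 1 ` ?U \<union> r lam ` ?U" using nz lam(1) by force
  show "r 1 ` ?U \<inter> r lam ` ?U = {}"
  proof (rule ccontr)
    assume "r 1 ` ?U \<inter> r lam ` ?U \<noteq> {}"
    then obtain C C' where C: "C \<in> ?U" "C' \<in> ?U" "r 1 C = r lam C'" by auto
    then have "legendre_p (1 / (class_rep C)\<^sup>2) = legendre_p (lam / (class_rep C')\<^sup>2)"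
      by (simp add: legendre_p_def r_def)
    then have "legendre_p (1 :: 'p qp) = legendre_p lam" using C leg lam(1) by simp
    then show False using legl leg1 by simp
  qed
  have surj: "\<exists>C\<in>?U. r \<delta> C = residue x" if \<delta>: "\<delta> \<in> Zp_units" and x: "x \<in> Zp_units" "legendre_p x = legendre_p \<delta>" for \<delta> x :: "'p qp"
  proof -
    have "legendre_p (\<delta> * inverse x) = 1"
      using \<delta> x legendre_p_mult[of x "inverse x * \<delta>"] legendre_p_mult[of \<delta> "inverse x"] legendre_p_values[of \<delta>]
      by (auto simp: mult_ac)
    then obtain y where y: "\<delta> * inverse x = y\<^sup>2" using unit_square_iff[of "\<delta> * inverse x"] \<delta> x by auto
    have "y\<^sup>2 \<in> Zp_units" using \<delta> x by (simp flip: y)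
    then have yu: "y \<in> Zp_units" by (rule unit_if_square_unit)
    then obtain C where C: "C \<in> ?U" "(class_rep C)\<^sup>2 - y\<^sup>2 \<in> pZ 1" by (rule class_rep_surj)
    let ?c = "class_rep C"
    have c: "?c \<in> Zp_units" using C class_rep_unit by blast
    have "(- \<delta> * inverse (y\<^sup>2) * inverse (?c\<^sup>2)) * (?c\<^sup>2 - y\<^sup>2) \<in> pZ 1"
      using C c yu \<delta> by (intro pZ_closed(6)) auto
    moreover have "(- \<delta> * inverse (y\<^sup>2) * inverse (?c\<^sup>2)) * (?c\<^sup>2 - y\<^sup>2) = \<delta> / ?c\<^sup>2 - \<delta> / y\<^sup>2"
      using c yu by (simp add: field_simps)
    moreover have "\<delta> / y\<^sup>2 = x" using x \<delta> by (simp add: divide_inverse flip: y)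
    ultimately have "r \<delta> C = residue x" using residue_eq_iff[OF unit[OF \<delta> C(1), THEN Zp_units_imp_Zp], of x] x unfolding r_def by simp
    then show ?thesis using C by blast
  qed
  show "{0..<int CARD('p)} = insert 0 (r 1 ` ?U \<union> r lam ` ?U)"
  proof
    have "r \<delta> C \<in> {0..<int CARD('p)}" if "\<delta> \<in> Zp_units" "C \<in> ?U" for \<delta> C
      using residue_spec(1,2)[OF unit[OF that, THEN Zp_units_imp_Zp]] unfolding r_def by simp
    then show "insert 0 (r 1 ` ?U \<union> r lam ` ?U) \<subseteq> {0..<int CARD('p)}"
      using lam(1) p_gt_2 by auto
    show "{0..<int CARD('p)} \<subseteq> insert 0 (r 1 ` ?U \<union> r lam ` ?U)"
    proof
      fix n assume n: "n \<in> {0..<int CARD('p)}"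
      let ?x = "of_int n :: 'p qp"
      have x: "residue ?x = n" using n by (simp add: residue_of_int)
      show "n \<in> insert 0 (r 1 ` ?U \<union> r lam ` ?U)"
      proof (cases "n = 0")
        case False
        then have "?x \<in> Zp_units" using x residue_eq_0_iff[of ?x] Zp_cases[of ?x] by auto
        then show ?thesis using surj[of 1 ?x] surj[of lam ?x] legl leg1 x lam(1) legendre_p_values[of ?x]
          by (metis UnCI Zp_units_closed(1) image_eqI insertCI)
      qed simp
    qed
  qed
qed

lemma sum_square_classes:
  fixes G :: "'p qp \<Rightarrow> 'v::ab_group_add"
  assumes G: "\<And>x y. x \<in> Zp \<Longrightarrow> y \<in> Zp \<Longrightarrow> x - y \<in> pZ 1 \<Longrightarrow> G x = G y"
    and lam: "lam \<in> Zp_units" "\<not> (\<exists>x\<in>Zp. lam - x\<^sup>2 \<in> pZ 1)"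
  shows "G 0 + (\<Sum>C\<in>unit_classes. G (1 / (class_rep C)\<^sup>2)) + (\<Sum>C\<in>unit_classes. G (lam / (class_rep C)\<^sup>2))
    = (\<Sum>n\<in>{0..<int CARD('p)}. G (of_int n))"
proof -
  let ?U = "unit_classes :: 'p qp set set" and ?r = "\<lambda>\<delta> C. residue (\<delta> / (class_rep C)\<^sup>2 :: 'p qp)"
  note R = residues_square_classes[OF lam]
  have *: "(\<Sum>C\<in>?U. G (\<delta> / (class_rep C)\<^sup>2)) = (\<Sum>n\<in>?r \<delta> ` ?U. G (of_int n))"
    if "inj_on (?r \<delta>) ?U" "\<delta> \<in> Zp_units" for \<delta>
    unfolding sum.reindex[OF that(1)] comp_def
  proof (intro sum.cong refl G)
    fix C assume "C \<in> ?U"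
    then show Z: "\<delta> / (class_rep C)\<^sup>2 \<in> Zp"
      using class_rep_unit[of C] that(2) by (simp add: divide_inverse flip: power_inverse)
    show "\<delta> / (class_rep C)\<^sup>2 - of_int (residue (\<delta> / (class_rep C)\<^sup>2)) \<in> pZ 1" by (rule residue_spec(3)[OF Z])
  qed simp
  have fin: "finite (?r 1 ` ?U \<union> ?r lam ` ?U)"
    by (rule finite_subset[of _ "{0..<int CARD('p)}"]) (use R(3) in blast, simp)
  then show ?thesis
    unfolding R(3) using R(4,5) *[OF R(1)] *[OF R(2) lam(1)]
    by (simp add: sum.union_disjoint)
qed

text \<open>Once h(u) is moved to the right, it acts on v by \<open>ch u\<close>, cancelling the
  coefficient of the operator.\<close>

lemma T_op_eq_ym:
  assumes \<delta>: "\<delta> \<in> (Zp_units :: 'p qp set)" and r: "r \<ge> 1" and sc: "vector_space sc"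
    and lin: "\<And>k. k \<in> K \<Longrightarrow> Vector_Spaces.linear sc sc (R k)"
    and mult: "\<And>k k' w. k \<in> K \<Longrightarrow> k' \<in> K \<Longrightarrow> R (k ** k') w = R k (R k' w)"
    and yK: "\<And>t. t \<in> pZ (int r - 1) \<Longrightarrow> ym t \<in> K"
    and hK: "\<And>u. u \<in> Zp_units \<Longrightarrow> hm u \<in> K"
    and ch: "\<And>u. u \<in> Zp_units \<Longrightarrow> ch u \<noteq> 0"
    and v_h: "\<And>u. u \<in> Zp_units \<Longrightarrow> R (hm u) v = sc (ch u) v"
  shows "T_op sc ch R r \<delta> v = (\<Sum>C\<in>unit_classes. R (ym (\<delta> / (class_rep C)\<^sup>2 * pp ^ (r - 1))) v)"
  unfolding T_op_alt
proof (intro sum.cong refl)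
  fix C :: "'p qp set" assume "C \<in> unit_classes"
  let ?u = "class_rep C" and ?p = "pp ^ (r - 1) :: 'p qp"
  interpret vector_space sc by (rule sc)
  have u: "?u \<in> Zp_units" by (rule class_rep_unit) fact
  have "\<delta> / ?u\<^sup>2 \<in> Zp" using \<delta> u by (simp add: divide_inverse flip: power_inverse)
  then have "\<delta> / ?u\<^sup>2 * ?p \<in> pZ (int (r - 1))" by (intro pZ_closed(6) pp_power_mem_pZ)
  then have y: "ym (\<delta> / ?u\<^sup>2 * ?p) \<in> K" using yK r by (simp add: of_nat_diff)
  interpret lin: Vector_Spaces.linear sc sc "R (ym (\<delta> / ?u\<^sup>2 * ?p))" by (rule lin[OF y])
  have "hm ?u ** ym (\<delta> * ?p) = ym (\<delta> / ?u\<^sup>2 * ?p) ** hm ?u" using u by (simp add: hm_ym)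
  then have "R (hm ?u ** ym (\<delta> * ?p)) v = sc (ch ?u) (R (ym (\<delta> / ?u\<^sup>2 * ?p)) v)"
    using mult[OF y hK[OF u]] v_h[OF u] lin.scale by simp
  then show "sc (inverse (ch ?u)) (R (hm ?u ** ym (\<delta> * ?p)) v) = R (ym (\<delta> / ?u\<^sup>2 * ?p)) v"
    using ch[OF u] by simp
qed

text \<open>As y(p^r) fixes v, the vector y(z p^(r-1)) v depends only on z mod p. The summand v
  itself is the residue 0.\<close>

lemma T_op_sum:
  assumes lam: "lam \<in> (Zp_units :: 'p qp set)" "\<not> (\<exists>x\<in>Zp. lam - x\<^sup>2 \<in> pZ 1)" and r: "r \<ge> 1" and sc: "vector_space sc"
    and lin: "\<And>k. k \<in> K \<Longrightarrow> Vector_Spaces.linear sc sc (R k)"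
    and mult: "\<And>k k' w. k \<in> K \<Longrightarrow> k' \<in> K \<Longrightarrow> R (k ** k') w = R k (R k' w)"
    and yK: "\<And>t. t \<in> pZ (int r - 1) \<Longrightarrow> ym t \<in> K"
    and hK: "\<And>u. u \<in> Zp_units \<Longrightarrow> hm u \<in> K"
    and ch: "\<And>u. u \<in> Zp_units \<Longrightarrow> ch u \<noteq> 0"
    and v_h: "\<And>u. u \<in> Zp_units \<Longrightarrow> R (hm u) v = sc (ch u) v"
    and v_y: "\<And>t. t \<in> pZ (int r) \<Longrightarrow> R (ym t) v = v"
  shows "v + T_op sc ch R r 1 v + T_op sc ch R r lam v = (\<Sum>n\<in>{0..<int CARD('p)}. R (ym (of_int n * pp ^ (r - 1))) v)"
proof -
  let ?p = "pp ^ (r - 1) :: 'p qp"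
  let ?G = "\<lambda>z. R (ym (z * ?p)) v"
  have p: "?p \<in> pZ (int r - 1)" using pp_power_mem_pZ[of "r - 1"] r by (simp add: of_nat_diff)
  have G: "?G x = ?G y" if "x \<in> Zp" "y \<in> Zp" "x - y \<in> pZ 1" for x y
  proof -
    have "(x - y) * ?p \<in> pZ (1 + (int r - 1))" by (rule pZ_mult[OF that(3) p])
    then have d: "(x - y) * ?p \<in> pZ (int r)" by simp
    then have "(x - y) * ?p \<in> pZ (int r - 1)" using pZ_mono[of "int r - 1" "int r"] by simp
    then have "R (ym (y * ?p) ** ym ((x - y) * ?p)) v = R (ym (y * ?p)) (R (ym ((x - y) * ?p)) v)"
      using p that by (intro mult yK) auto
    then show ?thesis using v_y[OF d] by (simp add: ym_mult algebra_simps)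
  qed
  have G0: "?G 0 = v" using v_y[of 0] by simp
  have T: "T_op sc ch R r \<delta> v = (\<Sum>C\<in>unit_classes. ?G (\<delta> / (class_rep C)\<^sup>2))" if "\<delta> \<in> Zp_units" for \<delta>
    by (rule T_op_eq_ym[OF that r sc lin mult yK hK ch v_h])
  show ?thesis
    using sum_square_classes[of ?G, OF G lam] unfolding T[OF Zp_units_closed(1)] T[OF lam(1)] G0 .
qed

end

text \<open>Covers both kinds of data: c = 1 with g the antidiagonal permutation matrix, and c =
  \<open>pp\<close> with g the generator of \<open>Z_prime\<close>. The inverse g' is given
  separately because \<open>H\<close> is merely a set of matrices.\<close>

lemma sum_unipotent_zero:
  fixes \<tau> :: "'p::prime_card mat2 \<Rightarrow> 'v::ab_group_add \<Rightarrow> 'v"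
  assumes rep: "is_rep sc H \<tau>" and l: "l \<ge> 1"
    and xH: "\<And>t. t \<in> Zp \<Longrightarrow> xm t \<in> H" and yH: "\<And>t. t \<in> Zp \<Longrightarrow> ym (c * t) \<in> H"
    and triv: "\<And>t. t \<in> pZ (int l) \<Longrightarrow> \<tau> (xm t) = id"
    and cusp: "Hom_triv sc (N_level (int l - 1)) \<tau> = {\<lambda>_. 0}"
    and g: "g \<in> H" "g' \<in> H" "g ** g' = mat 1" "\<And>t. g ** xm t = ym (c * t) ** g"
  shows "(\<Sum>n\<in>{0..<int CARD('p)}. \<tau> (ym (c * (of_int n * pp ^ (l - 1)))) b) = 0"
proof -
  have sc: "vector_space sc" and lin: "\<And>h. h \<in> H \<Longrightarrow> Vector_Spaces.linear sc sc (\<tau> h)"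
    and one: "\<tau> (mat 1) = id" and mult: "\<And>h k v. h \<in> H \<Longrightarrow> k \<in> H \<Longrightarrow> \<tau> (h ** k) v = \<tau> h (\<tau> k v)"
    using rep by (auto simp: is_rep_def)
  interpret vector_space sc by (rule sc)
  let ?N = "{0..<int CARD('p)}" and ?p = "pp ^ (l - 1) :: 'p qp"
  have p: "?p \<in> pZ (int l - 1)" using pp_power_mem_pZ[of "l - 1"] l by (simp add: of_nat_diff)
  have pZp: "z * ?p \<in> Zp" if "z \<in> Zp" for z using that by simp
  define b' where "b' = \<tau> g' b"
  let ?G = "\<lambda>z. \<tau> (xm (z * ?p)) b'"
  define S where "S = (\<Sum>n\<in>?N. ?G (of_int n))"
  have G: "?G x = ?G y" if "x \<in> Zp" "y \<in> Zp" "x - y \<in> pZ 1" for x y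
  proof -
    have "(x - y) * ?p \<in> pZ (1 + (int l - 1))" by (rule pZ_mult[OF that(3) p])
    then have d: "\<tau> (xm ((x - y) * ?p)) = id" using triv by simp
    have "\<tau> (xm (y * ?p) ** xm ((x - y) * ?p)) b' = \<tau> (xm (y * ?p)) (\<tau> (xm ((x - y) * ?p)) b')"
      using that by (intro mult xH pZp) auto
    then show ?thesis using d by (simp add: xm_mult algebra_simps)
  qed
  have inv: "\<tau> (xm t) S = S" if t: "t \<in> pZ (int l - 1)" for t
  proof -
    from t obtain z where z: "z \<in> Zp" "t = z * ?p"
      using l by (auto simp: pZ_def of_nat_diff power_int_def nat_diff_distrib mult.commute)
    interpret lin: Vector_Spaces.linear sc sc "\<tau> (xm t)" using lin xH pZp z by simp
    have "\<tau> (xm t) S = (\<Sum>n\<in>?N. \<tau> (xm t) (?G (of_int n)))" by (simp add: S_def lin.sum)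
    also have "\<dots> = (\<Sum>n\<in>?N. ?G (z + of_int n))"
    proof (intro sum.cong refl)
      fix n
      have "\<tau> (xm t ** xm (of_int n * ?p)) b' = \<tau> (xm t) (?G (of_int n))"
        using z by (intro mult xH pZp) auto
      then show "\<tau> (xm t) (?G (of_int n)) = ?G (z + of_int n)" by (simp add: xm_mult z(2) algebra_simps)
    qed
    also have "\<dots> = S" unfolding S_def using sum_residues_shift[of ?G, OF G z(1)] .
    finally show ?thesis .
  qed
  \<comment> \<open>An invariant vector S amounts to the homomorphism sending z to z S from the
    trivial representation, the form in which very cuspidality is assumed.\<close>
  have "(\<lambda>z. sc z S) \<in> Hom_triv sc (N_level (int l - 1)) \<tau>"
  proof -
    have "Vector_Spaces.linear (*) sc (\<lambda>z. sc z S)"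
      unfolding Vector_Spaces.linear_iff using sc vector_space_over_itself.vector_space_axioms
      by (simp add: scale_left_distrib)
    moreover have "sc z S = \<tau> h (sc z S)" if "h \<in> N_level (int l - 1)" for h z
    proof -
      from that obtain t where t: "h = xm t" "t \<in> pZ (int l - 1)" by (auto simp: N_level_def)
      have "t \<in> Zp" using t l pZ_imp_Zp[of "int l - 1" t] by simp
      then interpret lin: Vector_Spaces.linear sc sc "\<tau> h" using lin xH t by simp
      show ?thesis using inv[OF t(2)] t(1) lin.scale by simp
    qed
    ultimately show ?thesis by (simp add: Hom_triv_def)
  qed
  then have "(\<lambda>z. sc z S) = (\<lambda>_. 0)" using cusp by simp
  then have "sc 1 S = 0" by metis
  then have S0: "S = 0" by simp
  interpret lin: Vector_Spaces.linear sc sc "\<tau> g" by (rule lin[OF g(1)])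
  have "\<tau> (ym (c * (of_int n * ?p))) b = \<tau> g (?G (of_int n))" for n
  proof -
    let ?t = "of_int n * ?p"
    have t: "?t \<in> Zp" by simp
    have b: "\<tau> g b' = b" using mult[OF g(1,2), of b] g(3) one by (simp add: b'_def)
    have "\<tau> (ym (c * ?t)) (\<tau> g b') = \<tau> g (\<tau> (xm ?t) b')"
      using mult[OF yH[OF t] g(1), of b'] mult[OF g(1) xH[OF t], of b'] g(4)[of ?t] by simp
    then show ?thesis by (simp add: b)
  qed
  then show ?thesis using S0 by (simp add: S_def flip: lin.sum)
qed

section \<open>Conjugation by \<open>alpha\<close>\<close>

lemma matrix_inv_alpha: "matrix_inv alpha = mat2 (inverse (pp :: 'p::prime_card qp)) 0 0 1"
  unfolding matrix_inv_def
proof (rule some_equality)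
  let ?B = "mat2 (inverse pp) 0 0 1 :: 'p mat2"
  show *: "alpha ** ?B = mat 1 \<and> ?B ** alpha = mat 1" by (simp add: alpha_def mat_1_eq)
  fix A :: "'p mat2" assume "alpha ** A = mat 1 \<and> A ** alpha = mat 1"
  then show "A = ?B" using * by (metis matrix_mul_assoc matrix_mul_lid matrix_mul_rid)
qed

lemma alpha_conj_mat2:
  "alpha ** mat2 a b c d ** matrix_inv alpha = mat2 a (pp * b) (c / pp) (d :: 'p::prime_card qp)"
  "matrix_inv alpha ** mat2 a b c d ** alpha = mat2 a (b / pp) (pp * c) d"
  unfolding matrix_inv_alpha by (simp_all add: alpha_def mat2_eq_iff field_simps)

lemma mult_pp_mem_pZ: "pp * t \<in> pZ (r + 1) \<longleftrightarrow> t \<in> pZ r"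
proof
  assume "t \<in> pZ r"
  then show "pp * t \<in> pZ (r + 1)" using pZ_mult[OF pp_power_mem_pZ[of 1], of t r] by (simp add: add.commute)
next
  assume "pp * t \<in> pZ (r + 1)"
  then show "t \<in> pZ r" using pZ_mult[OF _ pp_powi_mem_pZ[of "- 1"], of "pp * t" "r + 1"] by (simp add: power_int_minus field_simps)
qed

lemma divide_pp_mem_pZ: "t / pp \<in> pZ r \<longleftrightarrow> t \<in> pZ (r + 1)"
  using mult_pp_mem_pZ[of "t / pp" r] by simp

lemma mem_K_one: "A \<in> K_one \<longleftrightarrow> A \<in> carrier SL2 \<and> A $ 1 $ 1 \<in> Zp \<and> A $ 1 $ 2 \<in> pZ (- 1) \<and> A $ 2 $ 1 \<in> pZ 1 \<and> A $ 2 $ 2 \<in> Zp"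
    (is "_ \<longleftrightarrow> ?P A")
  and alpha_conj_K_one: "A \<in> K_one \<Longrightarrow> alpha ** A ** matrix_inv alpha \<in> K_zero"
proof -
  have z: "pp * t \<in> Zp \<longleftrightarrow> t \<in> pZ (- 1)" "t / pp \<in> Zp \<longleftrightarrow> t \<in> pZ 1" for t :: "'a qp"
    using mult_pp_mem_pZ[of t "- 1"] divide_pp_mem_pZ[of t 0] by (simp_all add: pZ_0)
  have 1: "alpha ** A ** matrix_inv alpha \<in> K_zero \<longleftrightarrow> ?P A" for A :: "'a mat2"
    using alpha_conj_mat2(1)[of "A $ 1 $ 1" "A $ 1 $ 2" "A $ 2 $ 1" "A $ 2 $ 2"]
    by (simp add: mat2_eta mem_K_zero z mem_SL2)
  have inv: "alpha ** (matrix_inv alpha ** k ** alpha) ** matrix_inv alpha = k"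
    "matrix_inv alpha ** (alpha ** k ** matrix_inv alpha) ** alpha = k" for k :: "'a mat2"
    using alpha_conj_mat2[of "k $ 1 $ 1" "k $ 1 $ 2" "k $ 2 $ 1" "k $ 2 $ 2"] by (simp_all add: mat2_eta alpha_conj_mat2)
  show 2: "A \<in> K_one \<Longrightarrow> alpha ** A ** matrix_inv alpha \<in> K_zero" for A :: "'a mat2"
    by (auto simp: K_one_def inv)
  show "A \<in> K_one \<longleftrightarrow> ?P A" for A :: "'a mat2"
  proof
    assume "?P A"
    then have "alpha ** A ** matrix_inv alpha \<in> K_zero" using 1 by blast
    then have "matrix_inv alpha ** (alpha ** A ** matrix_inv alpha) ** alpha \<in> K_one" unfolding K_one_def by (rule imageI)
    then show "A \<in> K_one" unfolding inv .
  qed (use 1 2 in blast)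
qed

lemma K_zero_eq: "K_zero = K_level 0"
  by (auto simp: K_level_def mem_K_zero pZ_0)

lemma Iw_eq: "Iw = K_level 1"
  by (auto simp: Iw_def I_GL_def K_GL_def mem_K_level forall_2 mem_SL2 det_2 SL2_def intro: pZ_imp_Zp[of 1])

lemma Iw_subset_K_one: "Iw \<subseteq> K_one"
  using pZ_mono[of "- 1" 0] by (auto simp: Iw_eq mem_K_one mem_K_level pZ_0)

lemma Iw_subset_K_zero: "Iw \<subseteq> K_zero"
  unfolding Iw_eq by (rule K_level_subset_K_zero)

lemma K_one_mult: "A \<in> K_one \<Longrightarrow> B \<in> K_one \<Longrightarrow> A ** B \<in> K_one"
  using pZ_mult[of "A $ 1 $ 2" "- 1" "B $ 2 $ 1" 1] pZ_mult[of "A $ 2 $ 1" 1 "B $ 1 $ 2" "- 1"]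
  by (simp add: mem_K_one matmul_nth pZ_0)

lemma K_one_adj2: "A \<in> K_one \<Longrightarrow> adj2 A \<in> K_one"
  using adj2_mem_SL2[of A] by (simp add: mem_K_one adj2_def)

lemma xm_ym_hm_K_one:
  "t \<in> pZ (- 1) \<Longrightarrow> xm t \<in> K_one" "t \<in> pZ 1 \<Longrightarrow> ym t \<in> K_one" "u \<in> Zp_units \<Longrightarrow> hm u \<in> K_one"
  by (simp_all add: mem_K_one xm_def ym_def hm_def)

lemma alpha_conj_xm_ym_hm:
  "alpha_conj R (xm t) = R (xm (pp * t))" "alpha_conj R (ym t) = R (ym (t / pp))"
  "alpha_conj R (hm u) = R (hm u)" "alpha_conj R (hm u ** ym t) = R (hm u ** ym (t / pp))"
  by (simp_all add: alpha_conj_def xm_def ym_def hm_def alpha_conj_mat2)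

lemma alpha_conj_mult:
  assumes "\<And>k k' w. k \<in> K_zero \<Longrightarrow> k' \<in> K_zero \<Longrightarrow> R (k ** k') w = R k (R k' w)" "k \<in> K_one" "k' \<in> K_one"
  shows "alpha_conj R (k ** k') w = alpha_conj R k (alpha_conj R k' w)"
proof -
  have "matrix_inv alpha ** alpha = (mat 1 :: 'a mat2)" unfolding matrix_inv_alpha by (simp add: alpha_def mat_1_eq)
  then have "alpha ** (k ** k') ** matrix_inv alpha =
      (alpha ** k ** matrix_inv alpha) ** (alpha ** k' ** matrix_inv alpha)"
    by (simp add: matrix_mul_assoc matrix_mul_rid matrix_mul_assoc[symmetric, of "alpha ** k" "matrix_inv alpha" alpha])
  then show ?thesis
    using assms(1)[OF alpha_conj_K_one[OF assms(2)] alpha_conj_K_one[OF assms(3)]] by (simp add: alpha_conj_def)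
qed

text \<open>Conjugation by \<open>alpha\<close> divides the parameter of y by p. Hence
  \<open>T_op\<close> may be stated with the representation before conjugation, at an index smaller
  by one.\<close>

lemma T_op_alpha_conj:
  assumes "r \<ge> 1"
  shows "T_op sc ch (alpha_conj R) (r + 1) \<delta> v = T_op sc ch R r \<delta> v"
  using assms by (cases r) (simp_all add: T_op_alt alpha_conj_xm_ym_hm)

section \<open>Operators on vectors of the induced representation\<close>

context induced_vector
begin

lemma character_values:
  assumes "u \<in> Zp_units"
  shows "\<eta> u * of_int (\<psi> u) = 1 \<or> \<eta> u * of_int (\<psi> u) = - 1"
  using eta_values[OF assms] hK[OF assms] is_splittingD(1)[OF split, of "hm u"] by auto

text \<open>The exponent M - 1 - 2 m is r - 1, and the character has values 1 and -1, so its value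
  in \<open>V_op\<close> is the inverse required by \<open>T_op\<close>.\<close>

lemma V_op_eq_T_op:
  assumes "M = 2 * m + r" "r \<ge> 1" "\<delta> \<in> Zp_units" "x \<in> carrier Mp"
  shows "V_op sc \<eta> M \<delta> (f v) x = f (T_op sc (\<lambda>u. \<eta> u * of_int (\<psi> u)) \<rho> r \<delta> v) x"
proof -
  have "M - 1 = 2 * m + (r - 1)" using assms by simp
  then have "\<delta> * pp ^ (M - 1) / (pp ^ m)\<^sup>2 = \<delta> * pp ^ (r - 1)"
    by (simp add: power_add power_mult mult.commute[of 2])
  moreover have "\<eta> u * of_int (\<psi> u) = inverse (\<eta> u * of_int (\<psi> u))" if "u \<in> Zp_units" for u
    using character_values[OF that] by (elim disjE) (simp_all only: inverse_1 inverse_minus_eq)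
  ultimately show ?thesis
    unfolding V_op_f[OF assms(3,4)] T_op_alt using class_rep_unit
    by (intro arg_cong[of _ _ "\<lambda>w. f w x"] sum.cong) auto
qed

lemma Y_op_eq_0:
  assumes r: "M = 2 * m + r" "r \<ge> 1" and lam: "lam \<in> Zp_units" "\<not> (\<exists>x\<in>Zp. lam - x\<^sup>2 \<in> pZ 1)"
    and 0: "(\<Sum>n\<in>{0..<int CARD('p)}. \<rho> (ym (of_int n * pp ^ (r - 1))) v) = 0"
    and x: "x \<in> carrier Mp"
  shows "Y_op sc \<eta> M lam (f v) x = 0"
proof -
  let ?T = "\<lambda>\<delta>. T_op sc (\<lambda>u. \<eta> u * of_int (\<psi> u)) \<rho> r \<delta> v"
  have ym: "ym t \<in> K" if "t \<in> pZ (int r - 1)" for t using yK[of t] r that by (simp add: algebra_simps)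
  have vy: "\<rho> (ym t) v = v" if "t \<in> pZ (int r)" for t using v_y[of t] r that by simp
  have hm: "hm u \<in> K" "\<eta> u * of_int (\<psi> u) \<noteq> 0" if "u \<in> Zp_units" for u
    using hK[OF that] character_values[OF that] by auto
  have "v + ?T 1 + ?T lam = 0"
    using T_op_sum[where K = K and R = \<rho> and ch = "\<lambda>u. \<eta> u * of_int (\<psi> u)", OF lam r(2) sc lin rho_mult ym hm v_h vy] 0 by simp
  moreover have "Y_op sc \<eta> M lam (f v) x = f (v + ?T 1 + ?T lam) x"
    using V_op_eq_T_op[OF r _ x] lam x by (simp add: Y_op_def f_add)
  moreover have "f 0 x = 0" using f_add[OF x, of 0 0] by simp
  ultimately show ?thesis by simp
qed

end

text \<open>Serves odd l in both kinds of data. Conjugation by \<open>alpha\<close> multiplies the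
  parameter of x by p, so invariance is needed under x(p^(2m+1)), and 2 m + 1 is exactly l. The
  parameter of y is divided by p, so the conductor grows from r to r + 1.\<close>

lemma (in eta_setting) induced_vector_alpha_conj:
  assumes s1: "is_s_one s1" and r: "r \<ge> 1" and sc: "vector_space sc"
    and lin: "\<And>k. k \<in> K_zero \<Longrightarrow> Vector_Spaces.linear sc sc (R k)"
    and mult: "\<And>k k' w. k \<in> K_zero \<Longrightarrow> k' \<in> K_zero \<Longrightarrow> R (k ** k') w = R k (R k' w)"
    and v_y: "\<And>t. t \<in> pZ (int r) \<Longrightarrow> R (ym t) v = v"
    and v_x: "\<And>t. t \<in> pZ (2 * int m + 1) \<Longrightarrow> R (xm t) v = v"
    and v_h: "\<And>u. u \<in> Zp_units \<Longrightarrow> R (hm u) v = sc (\<eta> u * of_int (legendre_p u)) v"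
  shows "induced_vector \<eta> s0 sc K_one s1 (alpha_conj R) m (2 * m + (r + 1)) legendre_p v"
proof (intro induced_vector.intro induced_vector_axioms.intro eta_setting_axioms)
  show "K_one \<subseteq> carrier SL2" by (auto simp: mem_K_one)
  show "is_splitting K_one s1" using s1 by (simp add: is_s_one_def)
  show "Vector_Spaces.linear sc sc (alpha_conj R k)" if "k \<in> K_one" for k
    unfolding alpha_conj_def by (rule lin[OF alpha_conj_K_one[OF that]])
  show "alpha_conj R (k ** k') w = alpha_conj R k (alpha_conj R k' w)" if "k \<in> K_one" "k' \<in> K_one" for k k' w
    using mult that by (rule alpha_conj_mult)
  show "ym t \<in> K_one \<and> s1 (ym t) = 1" if "t \<in> pZ (int (2 * m + (r + 1)) - 1 - 2 * int m)" for t
  proof -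
    have "t \<in> pZ 1" using that r pZ_mono[of 1 "int r" t] by simp
    then show ?thesis using s1 xm_ym_hm_K_one(2) by (simp add: is_s_one_def)
  qed
  show "xm t \<in> K_one \<and> s1 (xm t) = 1" if "t \<in> pZ (2 * int m)" for t
  proof -
    have "t \<in> pZ (- 1)" using that pZ_mono[of "- 1" "2 * int m" t] by simp
    then show ?thesis using s1 xm_ym_hm_K_one(1) by (simp add: is_s_one_def)
  qed
  show "hm u \<in> K_one \<and> s1 (hm u) = legendre_p u" if "u \<in> Zp_units" for u
    using s1 xm_ym_hm_K_one(3) that by (simp add: is_s_one_def)
  show "alpha_conj R (ym t) v = v" if "t \<in> pZ (int (2 * m + (r + 1)) - 2 * int m)" for t
    using v_y[of "t / pp"] that by (simp add: alpha_conj_xm_ym_hm divide_pp_mem_pZ add.commute)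
  show "alpha_conj R (xm t) v = v" if "t \<in> pZ (2 * int m)" for t
    using v_x[of "pp * t"] that by (simp add: alpha_conj_xm_ym_hm mult_pp_mem_pZ)
  show "alpha_conj R (hm u) v = sc (\<eta> u * of_int (legendre_p u)) v" if "u \<in> Zp_units" for u
    using v_h[OF that] by (simp add: alpha_conj_xm_ym_hm)
qed (use r in \<open>auto intro: sc K_one_mult K_one_adj2\<close>)

lemma (in eta_setting) operators_alpha_conj:
  assumes ind: "induced_vector \<eta> s0 sc K_one s1 (alpha_conj R) m (2 * m + (r + 1)) legendre_p v"
    and r: "r \<ge> 1" and lam: "lam \<in> Zp_units" "\<not> (\<exists>x\<in>Zp. lam - x\<^sup>2 \<in> pZ 1)"
    and 0: "(\<Sum>n\<in>{0..<int CARD('p)}. R (ym (of_int n * pp ^ (r - 1))) v) = 0"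
    and x: "x \<in> carrier Mp"
  shows "\<delta> \<in> Zp_units \<Longrightarrow> V_op sc \<eta> (2 * m + (r + 1)) \<delta> (f_vec sc K_one (genuine_lift sc s1 (alpha_conj R)) m v) x =
      f_vec sc K_one (genuine_lift sc s1 (alpha_conj R)) m (T_op sc (\<lambda>u. \<eta> u * of_int (legendre_p u)) R r \<delta> v) x"
    and "Y_op sc \<eta> (2 * m + (r + 1)) lam (f_vec sc K_one (genuine_lift sc s1 (alpha_conj R)) m v) x = 0"
proof -
  interpret induced_vector prime_type \<eta> s0 sc K_one s1 "alpha_conj R" m "2 * m + (r + 1)" legendre_p v by (rule ind)
  show "V_op sc \<eta> (2 * m + (r + 1)) \<delta> (f v) x = f (T_op sc (\<lambda>u. \<eta> u * of_int (legendre_p u)) R r \<delta> v) x"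
    if "\<delta> \<in> Zp_units"
    using V_op_eq_T_op[OF refl _ that x] unfolding T_op_alpha_conj[OF r] by simp
  have "alpha_conj R (ym (of_int n * pp ^ (r + 1 - 1))) = R (ym (of_int n * pp ^ (r - 1)))" for n
    using r by (cases r) (simp_all add: alpha_conj_xm_ym_hm)
  then show "Y_op sc \<eta> (2 * m + (r + 1)) lam (f v) x = 0"
    using 0 by (intro Y_op_eq_0[OF refl _ lam _ x]) simp_all
qed

section \<open>Very cuspidal data\<close>

lemma constituent_rep:
  assumes "is_constituent scV \<tau> H scW \<rho>"
  shows "vector_space scW" "h \<in> H \<Longrightarrow> Vector_Spaces.linear scW scW (\<rho> h)"
    "h \<in> H \<Longrightarrow> h' \<in> H \<Longrightarrow> \<rho> (h ** h') w = \<rho> h (\<rho> h' w)"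
  using assms by (auto simp: is_constituent_def is_irred_def is_rep_def)

lemma constituent_fixed:
  assumes "is_constituent scV \<tau> H scW \<rho>" "h \<in> H" "\<tau> h = id"
  shows "\<rho> h w = w"
proof -
  obtain B T where T: "\<forall>h\<in>H. \<forall>v\<in>B. T (\<tau> h v) = \<rho> h (T v)" "T ` B = UNIV"
    using assms(1) by (auto simp: is_constituent_def)
  obtain b where "b \<in> B" "w = T b" using T(2) by blast
  then show ?thesis using T(1) assms(2,3) by (metis id_apply)
qed

text \<open>Very cuspidality concerns \<open>\<tau>\<close>, so the vanishing is proved there and
  carried over by T. Since T is additive only on B, the induction keeps the partial sums in B along
  the way.\<close>

lemma constituent_sum_zero:
  assumes V: "vector_space scV" and c: "is_constituent scV \<tau> H scW \<rho>"
    and k: "\<And>n. n \<in> N \<Longrightarrow> k n \<in> H" and "finite N" and 0: "\<And>b. (\<Sum>n\<in>N. \<tau> (k n) b) = 0"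
  shows "(\<Sum>n\<in>N. \<rho> (k n) w) = 0"
proof -
  interpret V: vector_space scV by (rule V)
  obtain B T where T: "module.subspace scV B" "\<And>h. h \<in> H \<Longrightarrow> \<tau> h ` B \<subseteq> B"
    "\<And>v v'. v \<in> B \<Longrightarrow> v' \<in> B \<Longrightarrow> T (v + v') = T v + T v'"
    "\<And>h v. h \<in> H \<Longrightarrow> v \<in> B \<Longrightarrow> T (\<tau> h v) = \<rho> h (T v)" "T ` B = UNIV"
    using c unfolding is_constituent_def by metis
  obtain b where b: "b \<in> B" "w = T b" using T(5) by blast
  have B0: "0 \<in> B" using T(1) by (rule V.subspace_0)
  have T0: "T 0 = 0" using T(3)[OF B0 B0] by simp
  have "(\<Sum>n\<in>N. \<tau> (k n) b) \<in> B \<and> T (\<Sum>n\<in>N. \<tau> (k n) b) = (\<Sum>n\<in>N. \<rho> (k n) w)"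
    using \<open>finite N\<close> k
  proof (induction N)
    case (insert n N)
    have "\<tau> (k n) b \<in> B" "T (\<tau> (k n) b) = \<rho> (k n) w" using T(2,4) insert.prems b by blast+
    then show ?case using insert T(3) V.subspace_add[OF T(1)] by simp
  qed (simp add: B0 T0)
  then show ?thesis using 0[of b] T0 by simp
qed

lemma K_GL_subset_ZK: "K_GL \<subseteq> ZK"
proof
  fix k :: "'p::prime_card mat2" assume k: "k \<in> K_GL"
  have "mat 1 \<in> (center_GL :: 'p mat2 set)" by (simp add: center_GL_def GL2_def matrix_mul_lid matrix_mul_rid)
  moreover have "k = mat 1 \<otimes>\<^bsub>GL2\<^esub> k" by (simp add: GL2_def matrix_mul_lid)
  ultimately show "k \<in> ZK" using k unfolding ZK_def set_mult_def by blast
qed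

lemma Z_prime_I_GL_mem_ZI: "z \<in> Z_prime \<Longrightarrow> k \<in> I_GL \<Longrightarrow> z ** k \<in> ZI"
  by (force simp: ZI_def set_mult_def GL2_def)

lemma I_GL_subset_ZI: "I_GL \<subseteq> ZI"
proof
  fix k :: "'p::prime_card mat2" assume "k \<in> I_GL"
  moreover have "mat 1 \<in> (Z_prime :: 'p mat2 set)"
    using generate.one[of GL2 "{mat2 0 1 pp 0 :: 'p mat2}"] by (simp add: Z_prime_def GL2_def)
  ultimately show "k \<in> ZI" using Z_prime_I_GL_mem_ZI[of "mat 1" k] by (simp add: matrix_mul_lid)
qed

lemma Z_prime_generator_mem_ZI:
  "mat2 0 1 pp 0 \<in> (ZI :: 'p::prime_card mat2 set)" "mat2 0 (inverse pp) 1 0 \<in> (ZI :: 'p mat2 set)"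
proof -
  let ?g = "mat2 0 1 pp 0 :: 'p mat2" and ?g' = "mat2 0 (inverse pp) 1 0 :: 'p mat2"
  have 1: "mat 1 \<in> (I_GL :: 'p mat2 set)" by (simp add: I_GL_def K_GL_def forall_2 mat_1_eq)
  have "?g \<in> Z_prime" unfolding Z_prime_def by (rule generate.incl) simp
  then show "?g \<in> ZI" using Z_prime_I_GL_mem_ZI[OF _ 1, of ?g] by (simp add: matrix_mul_rid)
  have gg: "?g ** ?g' = mat 1" "?g' ** ?g = mat 1" by (simp_all add: mat_1_eq)
  have "inv\<^bsub>GL2\<^esub> ?g = ?g'"
    unfolding m_inv_def
  proof (rule the_equality)
    show "?g' \<in> carrier GL2 \<and> ?g \<otimes>\<^bsub>GL2\<^esub> ?g' = \<one>\<^bsub>GL2\<^esub> \<and> ?g' \<otimes>\<^bsub>GL2\<^esub> ?g = \<one>\<^bsub>GL2\<^esub>"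
      using gg by (simp add: GL2_def)
    fix y assume "y \<in> carrier GL2 \<and> ?g \<otimes>\<^bsub>GL2\<^esub> y = \<one>\<^bsub>GL2\<^esub> \<and> y \<otimes>\<^bsub>GL2\<^esub> ?g = \<one>\<^bsub>GL2\<^esub>"
    then have "y ** ?g = mat 1" by (simp add: GL2_def)
    then have "y ** (?g ** ?g') = ?g'" by (simp only: matrix_mul_assoc matrix_mul_lid)
    then show "y = ?g'" unfolding gg by (simp only: matrix_mul_rid)
  qed
  moreover have "inv\<^bsub>GL2\<^esub> ?g \<in> Z_prime" unfolding Z_prime_def by (rule generate.inv) simp
  ultimately show "?g' \<in> ZI" using Z_prime_I_GL_mem_ZI[OF _ 1, of ?g'] by (simp add: matrix_mul_rid)
qed

lemma xm_ym_mem_congr_unram: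
  "t \<in> pZ (int l) \<Longrightarrow> xm t \<in> congr_unram l" "t \<in> pZ (int l) \<Longrightarrow> ym t \<in> congr_unram l"
  by (simp_all add: congr_unram_def forall_2 mat_1_eq xm_def ym_def)

lemma xm_ym_mem_K_GL: "t \<in> Zp \<Longrightarrow> xm t \<in> K_GL" "t \<in> Zp \<Longrightarrow> ym t \<in> K_GL"
  by (simp_all add: K_GL_def forall_2 xm_def ym_def)

lemma xm_ym_mem_I_GL: "t \<in> Zp \<Longrightarrow> xm t \<in> I_GL" "t \<in> pZ 1 \<Longrightarrow> ym t \<in> I_GL"
  by (simp_all add: I_GL_def K_GL_def forall_2 xm_def ym_def pZ_imp_Zp[of 1])

lemma xm_ym_mem_congr_ram:
  "t \<in> pZ (int l) \<Longrightarrow> xm t \<in> congr_ram l" "t \<in> pZ (int l + 1) \<Longrightarrow> ym t \<in> congr_ram l"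
  using xm_ym_mem_I_GL pZ_imp_Zp[of "int l" t] pZ_mono[of 1 "int l + 1" t]
  by (simp_all add: congr_ram_def) (simp_all add: xm_def ym_def)

lemma unram_constituent:
  fixes \<tau> :: "'p::prime_card mat2 \<Rightarrow> 'v::ab_group_add \<Rightarrow> 'v"
  assumes d: "unram_datum l scV \<tau>" and c: "is_constituent scV \<tau> K_zero scW \<rho>" and l: "l \<ge> 1"
  shows "t \<in> pZ (int l) \<Longrightarrow> \<rho> (xm t) w = w" "t \<in> pZ (int l) \<Longrightarrow> \<rho> (ym t) w = w"
    "(\<Sum>n\<in>{0..<int CARD('p)}. \<rho> (ym (of_int n * pp ^ (l - 1))) w) = 0"
proof -
  have rep: "is_rep scV ZK \<tau>" and triv: "\<And>k. k \<in> congr_unram l \<Longrightarrow> \<tau> k = id"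
    and cusp: "Hom_triv scV (N_level (int l - 1)) \<tau> = {\<lambda>_. 0}"
    using d by (auto simp: unram_datum_def is_irred_def)
  have K: "xm t \<in> K_zero" "ym t \<in> K_zero" if "t \<in> Zp" for t :: "'p qp"
    using that by (simp_all add: mem_K_zero) (simp_all add: xm_def ym_def)
  show "\<rho> (xm t) w = w" "\<rho> (ym t) w = w" if t: "t \<in> pZ (int l)"
    using constituent_fixed[OF c K(1) triv] constituent_fixed[OF c K(2) triv]
      xm_ym_mem_congr_unram[OF t] pZ_imp_Zp[OF _ t] by simp_all
  \<comment> \<open>Its determinant is -1, which is allowed as \<open>\<tau>\<close> lives on
    \<open>ZK\<close>. It exchanges x(t) and y(t) without a sign and is its own inverse, so it is
    passed as both g and g'.\<close>
  let ?g = "mat2 0 1 1 0 :: 'p mat2"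
  have g: "?g \<in> ZK" using K_GL_subset_ZK by (auto simp: K_GL_def forall_2)
  have "(\<Sum>n\<in>{0..<int CARD('p)}. \<tau> (ym (1 * (of_int n * pp ^ (l - 1)))) b) = 0" for b
  proof (rule sum_unipotent_zero[OF rep l _ _ _ cusp g g])
    show "xm t \<in> ZK" "ym (1 * t) \<in> ZK" if "t \<in> Zp" for t :: "'p qp"
      using xm_ym_mem_K_GL[OF that] K_GL_subset_ZK by auto
    show "\<tau> (xm t) = id" if "t \<in> pZ (int l)" for t
      using triv xm_ym_mem_congr_unram(1) that by blast
  qed (simp_all add: mat_1_eq xm_def ym_def)
  then show "(\<Sum>n\<in>{0..<int CARD('p)}. \<rho> (ym (of_int n * pp ^ (l - 1))) w) = 0"
    using rep K(2) by (intro constituent_sum_zero[OF _ c]) (auto simp: is_rep_def)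
qed

text \<open>The generator of \<open>Z_prime\<close> takes x(t) to y(p t), so
  \<open>N_level (int l - 1)\<close> corresponds to y(p^l). This extra factor p is the reason for
  the index l + 1 of \<open>T_op\<close> in the ramified cases.\<close>

lemma ram_constituent:
  fixes \<tau> :: "'p::prime_card mat2 \<Rightarrow> 'v::ab_group_add \<Rightarrow> 'v"
  assumes d: "ram_datum l scV \<tau>" and c: "is_constituent scV \<tau> Iw scW \<sigma>" and l: "l \<ge> 1"
  shows "t \<in> pZ (int l) \<Longrightarrow> \<sigma> (xm t) w = w" "t \<in> pZ (int l + 1) \<Longrightarrow> \<sigma> (ym t) w = w"
    "(\<Sum>n\<in>{0..<int CARD('p)}. \<sigma> (ym (of_int n * pp ^ l)) w) = 0"
proof -
  have rep: "is_rep scV ZI \<tau>" and triv: "\<And>k. k \<in> congr_ram l \<Longrightarrow> \<tau> k = id"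
    and cusp: "Hom_triv scV (N_level (int l - 1)) \<tau> = {\<lambda>_. 0}"
    using d by (auto simp: ram_datum_def is_irred_def)
  have K: "t \<in> Zp \<Longrightarrow> xm t \<in> Iw" "t \<in> pZ 1 \<Longrightarrow> ym t \<in> Iw" for t :: "'p qp"
    unfolding Iw_eq using xm_mem_K_level ym_mem_K_level[of t 1] by simp_all
  show "\<sigma> (xm t) w = w" if t: "t \<in> pZ (int l)"
    using constituent_fixed[OF c K(1) triv] xm_ym_mem_congr_ram(1)[OF t] pZ_imp_Zp[OF _ t] by simp
  show "\<sigma> (ym t) w = w" if t: "t \<in> pZ (int l + 1)"
    using constituent_fixed[OF c K(2) triv] xm_ym_mem_congr_ram(2)[OF t] pZ_mono[OF _ t, of 1] by simp
  have pl: "pp * (z * pp ^ (l - 1)) = z * pp ^ l" for z :: "'p qp" using l by (cases l) simp_all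
  have p1: "pp * t \<in> pZ 1" if "t \<in> Zp" for t :: "'p qp" using that mult_pp_mem_pZ[of t 0] by (simp add: pZ_0)
  have "(\<Sum>n\<in>{0..<int CARD('p)}. \<tau> (ym (pp * (of_int n * pp ^ (l - 1)))) b) = 0" for b
  proof (rule sum_unipotent_zero[OF rep l _ _ _ cusp Z_prime_generator_mem_ZI])
    show "xm t \<in> ZI" "ym (pp * t) \<in> ZI" if "t \<in> Zp" for t :: "'p qp"
      using xm_ym_mem_I_GL p1 I_GL_subset_ZI that by blast+
    show "\<tau> (xm t) = id" if "t \<in> pZ (int l)" for t
      using triv xm_ym_mem_congr_ram(1) that by blast
  qed (simp_all add: mat_1_eq xm_def ym_def)
  then have 0: "(\<Sum>n\<in>{0..<int CARD('p)}. \<tau> (ym (of_int n * pp ^ l)) b) = 0" for b by (simp only: pl)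
  have "(ym (of_int n * pp ^ l) :: 'p mat2) \<in> Iw" for n
    using K(2)[OF p1[of "of_int n * pp ^ (l - 1)"]] unfolding pl by simp
  then show "(\<Sum>n\<in>{0..<int CARD('p)}. \<sigma> (ym (of_int n * pp ^ l)) w) = 0"
    using rep 0 by (intro constituent_sum_zero[OF _ c]) (auto simp: is_rep_def)
qed

section \<open>The vectors supported on the Iwahori subgroup\<close>

lemma vector_space_fun_scale: "vector_space sc \<Longrightarrow> vector_space (fun_scale sc)"
  by (simp add: vector_space_def fun_scale_def fun_eq_iff)

text \<open>The action is linear on all functions, so the function type itself serves as the
  representation space and no subtype for \<open>Ind_space\<close> is needed.\<close>

lemma linear_Ind_act:
  assumes "vector_space sc"
  shows "Vector_Spaces.linear (fun_scale sc) (fun_scale sc) (Ind_act K k)"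
proof -
  interpret vector_space sc by fact
  show ?thesis
    unfolding Vector_Spaces.linear_iff using vector_space_fun_scale[OF assms]
    by (simp add: Ind_act_def fun_scale_def fun_eq_iff)
qed

lemma Ind_act_mult:
  assumes "\<And>x. x \<in> K \<Longrightarrow> x ** k \<in> K"
  shows "Ind_act K (k ** k') \<phi> = Ind_act K k (Ind_act K k' \<phi>)"
  using assms by (auto simp: Ind_act_def fun_eq_iff matrix_mul_assoc)

text \<open>For k in the group \<open>Iw\<close>, right translation by k preserves the support
  \<open>Iw\<close>. Thus the embedding of \<open>\<sigma>\<close> into the induced representation
  is equivariant, and everything about \<open>phi_vec\<close> is inherited from
  \<open>\<sigma>\<close>.\<close>

lemma Ind_act_phi_vec:
  assumes k: "k \<in> Iw" and K: "Iw \<subseteq> K"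
    and mult: "\<And>h h'. h \<in> Iw \<Longrightarrow> h' \<in> Iw \<Longrightarrow> \<sigma> (h ** h') w = \<sigma> h (\<sigma> h' w)"
  shows "Ind_act K k (phi_vec \<sigma> w) = phi_vec \<sigma> (\<sigma> k w)"
proof
  fix x
  have "x \<in> Iw" if "x ** k \<in> Iw"
  proof -
    have "x ** k ** adj2 k \<in> Iw" using that k by (simp add: Iw_eq)
    then show ?thesis using adj2_mult(2)[of k] k
      by (simp add: Iw_eq mem_K_level matrix_mul_rid flip: matrix_mul_assoc)
  qed
  moreover have "x ** k \<in> Iw" if "x \<in> Iw" using that k by (simp add: Iw_eq)
  ultimately show "Ind_act K k (phi_vec \<sigma> w) x = phi_vec \<sigma> (\<sigma> k w) x"
    using mult[OF _ k] K by (auto simp: Ind_act_def phi_vec_def)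
qed

lemma phi_vec_sum:
  assumes "\<And>h. h \<in> Iw \<Longrightarrow> Vector_Spaces.linear sc sc (\<sigma> h)"
  shows "(\<Sum>n\<in>N. phi_vec \<sigma> (a n)) = phi_vec \<sigma> (\<Sum>n\<in>N. a n)"
proof -
  have add: "\<sigma> h (x + y) = \<sigma> h x + \<sigma> h y" if "h \<in> Iw" for h x y
    using assms[OF that] by (simp add: Vector_Spaces.linear_iff)
  then have "\<sigma> h 0 = 0" if "h \<in> Iw" for h using add[OF that, of 0 0] by simp
  then show ?thesis
    using sum_comp_morphism[of "phi_vec \<sigma>" a N] add by (simp add: phi_vec_def fun_eq_iff comp_def)
qed

lemma phi_vec_scale:
  assumes "\<And>h. h \<in> Iw \<Longrightarrow> Vector_Spaces.linear sc sc (\<sigma> h)" "vector_space sc"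
  shows "phi_vec \<sigma> (sc a w) = fun_scale sc a (phi_vec \<sigma> w)"
proof -
  interpret vector_space sc by fact
  show ?thesis using assms(1) by (auto simp: phi_vec_def fun_scale_def Vector_Spaces.linear_iff)
qed

section \<open>The four cases\<close>

context eta_setting
begin

text \<open>Even l: r = l, with \<open>s0\<close> and trivial \<open>\<psi>\<close>. Odd l: r = l
  before conjugation by \<open>alpha\<close>, hence 2 l = 2 m + (l + 1), with \<open>s1\<close> and
  \<open>\<psi>\<close> the Legendre symbol. The level l of the datum is what \<open>v_x\<close> and
  \<open>v_y\<close> require.\<close>

lemma unram_operators:
  fixes \<rho> :: "'p mat2 \<Rightarrow> 'w::ab_group_add \<Rightarrow> 'w"
  assumes s1: "is_s_one s1" and lam: "lam \<in> Zp_units" "\<not> (\<exists>x\<in>Zp. lam - x\<^sup>2 \<in> pZ 1)" and l: "l \<ge> 1"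
    and d: "unram_datum l scV \<tau>" and c: "is_constituent scV \<tau> K_zero scW \<rho>"
    and w: "w \<in> eigen_U scW (eta_unram \<eta> l) \<rho>" and x: "x \<in> carrier Mp"
  shows "\<delta> \<in> Zp_units \<Longrightarrow> V_op scW \<eta> (2 * l) \<delta> (f_unram scW s0 s1 l \<rho> w) x =
      f_unram scW s0 s1 l \<rho> (T_op scW (eta_unram \<eta> l) \<rho> l \<delta> w) x"
    and "Y_op scW \<eta> (2 * l) lam (f_unram scW s0 s1 l \<rho> w) x = 0"
proof -
  note rep = constituent_rep[OF c] and fxd = unram_constituent[OF d c l]
  have h: "\<rho> (hm u) w = scW (eta_unram \<eta> l u) w" if "u \<in> Zp_units" for u
    using w that by (simp add: eigen_U_def)
  have "(\<delta> \<in> Zp_units \<longrightarrow> V_op scW \<eta> (2 * l) \<delta> (f_unram scW s0 s1 l \<rho> w) x =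
      f_unram scW s0 s1 l \<rho> (T_op scW (eta_unram \<eta> l) \<rho> l \<delta> w) x) \<and>
      Y_op scW \<eta> (2 * l) lam (f_unram scW s0 s1 l \<rho> w) x = 0"
  proof (cases "even l")
    case True
    then obtain m where m: "l = 2 * m" by (elim evenE)
    then have lm: "2 * l = 2 * m + l" "l div 2 = m" by simp_all
    \<comment> \<open>Written with a trivial sign to match the eigencharacter of
      \<open>induced_vector\<close> for \<open>\<psi>\<close> constantly 1.\<close>
    have ch: "eta_unram \<eta> l = (\<lambda>u. \<eta> u * of_int 1)" using True by (simp add: eta_unram_def)
    have f: "f_unram scW s0 s1 l \<rho> = f_vec scW K_zero (genuine_lift scW s0 \<rho>) m"
      using True lm(2) by (simp add: f_unram_def)
    interpret induced_vector prime_type \<eta> s0 scW K_zero s0 \<rho> m "2 * m + l" "\<lambda>_. 1" w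
    proof (intro induced_vector.intro induced_vector_axioms.intro eta_setting_axioms)
      show "K_zero \<subseteq> carrier SL2" by (auto simp: mem_K_zero)
      show "is_splitting K_zero s0" using s0 by (simp add: is_s_zero_def)
      show "ym t \<in> K_zero \<and> s0 (ym t) = 1" if "t \<in> pZ (int (2 * m + l) - 1 - 2 * int m)" for t
      proof -
        have "t \<in> Zp" using that l pZ_imp_Zp[of "int l - 1" t] by simp
        then show ?thesis using s0 ym_mem_K_level[of t 0] by (simp add: is_s_zero_def K_zero_eq pZ_0)
      qed
      show "xm t \<in> K_zero \<and> s0 (xm t) = 1" if "t \<in> pZ (2 * int m)" for t
      proof -
        have "t \<in> Zp" using that pZ_imp_Zp[of "2 * int m" t] by simp
        then show ?thesis using s0 xm_mem_K_level by (simp add: is_s_zero_def K_zero_eq)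
      qed
      show "hm u \<in> K_zero \<and> s0 (hm u) = 1" if "u \<in> Zp_units" for u
        using s0 that hm_mem_K_level by (simp add: is_s_zero_def K_zero_eq)
      show "\<rho> (ym t) w = w" if "t \<in> pZ (int (2 * m + l) - 2 * int m)" for t
        using fxd(2)[of t] that by simp
      show "\<rho> (xm t) w = w" if "t \<in> pZ (2 * int m)" for t
        using fxd(1)[of t] that m by simp
      show "\<rho> (hm u) w = scW (\<eta> u * of_int 1) w" if "u \<in> Zp_units" for u
        using h[OF that] ch by simp
    qed (use rep m l in \<open>auto simp: K_zero_eq\<close>)
    show ?thesis
      unfolding f ch lm(1) using V_op_eq_T_op[OF refl l _ x, of \<delta>] Y_op_eq_0[OF refl l lam fxd(3) x] by blast
  next
    case False
    then obtain m where m: "l = 2 * m + 1" by (elim oddE)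
    then have lm: "2 * l = 2 * m + (l + 1)" "(l - 1) div 2 = m" by simp_all
    have ch: "eta_unram \<eta> l = (\<lambda>u. \<eta> u * of_int (legendre_p u))" using False by (simp add: eta_unram_def)
    have f: "f_unram scW s0 s1 l \<rho> = f_vec scW K_one (genuine_lift scW s1 (alpha_conj \<rho>)) m"
      using False lm(2) by (simp add: f_unram_def)
    have ind: "induced_vector \<eta> s0 scW K_one s1 (alpha_conj \<rho>) m (2 * m + (l + 1)) legendre_p w"
      using m fxd h[unfolded ch] by (intro induced_vector_alpha_conj s1 l rep) (auto simp: add.commute)
    show ?thesis
      unfolding f ch lm(1) using operators_alpha_conj[OF ind l lam fxd(3) x] by blast
  qed
  then show "\<delta> \<in> Zp_units \<Longrightarrow> V_op scW \<eta> (2 * l) \<delta> (f_unram scW s0 s1 l \<rho> w) x =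
      f_unram scW s0 s1 l \<rho> (T_op scW (eta_unram \<eta> l) \<rho> l \<delta> w) x"
    "Y_op scW \<eta> (2 * l) lam (f_unram scW s0 s1 l \<rho> w) x = 0" by blast+
qed

text \<open>Both parities use \<open>s1\<close> and r = l + 1 for the unconjugated induced
  representation. For even l it is induced to \<open>K_one\<close> directly; for odd l it is induced
  to \<open>K_zero\<close> and then conjugated, so that 2 l + 1 = 2 m + (l + 1 + 1).\<close>

lemma ram_operators:
  fixes \<sigma> :: "'p mat2 \<Rightarrow> 'w::ab_group_add \<Rightarrow> 'w"
  assumes s1: "is_s_one s1" and lam: "lam \<in> Zp_units" "\<not> (\<exists>x\<in>Zp. lam - x\<^sup>2 \<in> pZ 1)" and l: "l \<ge> 1"
    and d: "ram_datum l scV \<tau>" and c: "is_constituent scV \<tau> Iw scW \<sigma>"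
    and w: "w \<in> eigen_U scW (eta_ram \<eta>) \<sigma>" and x: "x \<in> carrier Mp"
  shows "\<delta> \<in> Zp_units \<Longrightarrow> V_op (fun_scale scW) \<eta> (2 * l + 1) \<delta> (f_ram scW s1 l (phi_vec \<sigma> w)) x =
      f_ram scW s1 l (T_op (fun_scale scW) (eta_ram \<eta>) (rho_ram l) (l + 1) \<delta> (phi_vec \<sigma> w)) x"
    and "Y_op (fun_scale scW) \<eta> (2 * l + 1) lam (f_ram scW s1 l (phi_vec \<sigma> w)) x = 0"
proof -
  note rep = constituent_rep[OF c] and fxd = ram_constituent[OF d c l]
  let ?v = "phi_vec \<sigma> w" and ?sc = "fun_scale scW"
  have sc: "vector_space ?sc" by (rule vector_space_fun_scale[OF rep(1)])
  have act: "Ind_act K k ?v = phi_vec \<sigma> (\<sigma> k w)" if "Iw \<subseteq> K" "k \<in> Iw" for K k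
    using that(2,1) rep(3) by (rule Ind_act_phi_vec)
  have v_x: "Ind_act K (xm t) ?v = ?v" if "Iw \<subseteq> K" "t \<in> pZ (int l)" for K t
  proof -
    have "xm t \<in> Iw" unfolding Iw_eq by (rule xm_mem_K_level) (use that pZ_imp_Zp[of "int l" t] in simp)
    then show ?thesis using act that(1) fxd(1)[OF that(2)] by simp
  qed
  have v_y: "Ind_act K (ym t) ?v = ?v" if "Iw \<subseteq> K" "t \<in> pZ (int l + 1)" for K t
  proof -
    have "ym t \<in> Iw" unfolding Iw_eq by (rule ym_mem_K_level) (use that pZ_mono[of 1 "int l + 1" t] in simp)
    then show ?thesis using act that(1) fxd(2)[OF that(2)] by simp
  qed
  have v_h: "Ind_act K (hm u) ?v = ?sc (\<eta> u * of_int (legendre_p u)) ?v" if "Iw \<subseteq> K" "u \<in> Zp_units" for K u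
  proof -
    have "hm u \<in> Iw" unfolding Iw_eq using that(2) by (rule hm_mem_K_level)
    then show ?thesis
      using act that w phi_vec_scale[OF rep(2,1)] by (simp add: eigen_U_def eta_ram_def)
  qed
  have 0: "(\<Sum>n\<in>{0..<int CARD('p)}. Ind_act K (ym (of_int n * pp ^ (l + 1 - 1))) ?v) = 0" if "Iw \<subseteq> K" for K
  proof -
    have "(pp ^ l :: 'p qp) \<in> pZ 1" using l pZ_mono[OF _ pp_power_mem_pZ[of l], of 1] by simp
    then have "(ym (of_int n * pp ^ l) :: 'p mat2) \<in> Iw" for n
      unfolding Iw_eq by (intro ym_mem_K_level) simp
    then have "(\<Sum>n\<in>{0..<int CARD('p)}. Ind_act K (ym (of_int n * pp ^ (l + 1 - 1))) ?v) =
        phi_vec \<sigma> (\<Sum>n\<in>{0..<int CARD('p)}. \<sigma> (ym (of_int n * pp ^ l)) w)"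
      using act[OF that] phi_vec_sum[OF rep(2)] by simp
    \<comment> \<open>The instance with an empty index set says that
      \<open>phi_vec \<sigma> 0\<close> is 0.\<close>
    also have "\<dots> = 0" using phi_vec_sum[OF rep(2), where N = "{}"] by (simp add: fxd(3))
    finally show ?thesis .
  qed
  have ch: "eta_ram \<eta> = (\<lambda>u. \<eta> u * of_int (legendre_p u))" by (simp add: eta_ram_def)
  have "(\<delta> \<in> Zp_units \<longrightarrow> V_op ?sc \<eta> (2 * l + 1) \<delta> (f_ram scW s1 l ?v) x =
      f_ram scW s1 l (T_op ?sc (eta_ram \<eta>) (rho_ram l) (l + 1) \<delta> ?v) x) \<and>
      Y_op ?sc \<eta> (2 * l + 1) lam (f_ram scW s1 l ?v) x = 0"
  proof (cases "even l")
    case True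
    then obtain m where m: "l = 2 * m" by (elim evenE)
    then have lm: "2 * l + 1 = 2 * m + (l + 1)" "l div 2 = m" by simp_all
    have R: "(rho_ram l :: 'p mat2 \<Rightarrow> ('p mat2 \<Rightarrow> 'w) \<Rightarrow> _) = Ind_act K_one" using True by (simp add: rho_ram_def ram_K_def fun_eq_iff)
    have f: "f_ram scW s1 l = f_vec ?sc K_one (genuine_lift ?sc s1 (Ind_act K_one)) m"
      using True lm(2) R by (simp add: f_ram_def)
    interpret induced_vector prime_type \<eta> s0 ?sc K_one s1 "Ind_act K_one" m "2 * m + (l + 1)" legendre_p ?v
    proof (intro induced_vector.intro induced_vector_axioms.intro eta_setting_axioms)
      show "K_one \<subseteq> carrier SL2" by (auto simp: mem_K_one)
      show "is_splitting K_one s1" using s1 by (simp add: is_s_one_def)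
      show "ym t \<in> K_one \<and> s1 (ym t) = 1" if "t \<in> pZ (int (2 * m + (l + 1)) - 1 - 2 * int m)" for t
      proof -
        have "t \<in> pZ 1" using that l pZ_mono[of 1 "int l" t] by simp
        then show ?thesis using s1 xm_ym_hm_K_one(2) by (simp add: is_s_one_def)
      qed
      show "xm t \<in> K_one \<and> s1 (xm t) = 1" if "t \<in> pZ (2 * int m)" for t
      proof -
        have "t \<in> pZ (- 1)" using that pZ_mono[of "- 1" "2 * int m" t] by simp
        then show ?thesis using s1 xm_ym_hm_K_one(1) by (simp add: is_s_one_def)
      qed
      show "hm u \<in> K_one \<and> s1 (hm u) = legendre_p u" if "u \<in> Zp_units" for u
        using s1 xm_ym_hm_K_one(3) that by (simp add: is_s_one_def)
      show "Ind_act K_one (ym t) ?v = ?v" if "t \<in> pZ (int (2 * m + (l + 1)) - 2 * int m)" for t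
        using v_y[OF Iw_subset_K_one, of t] that by (simp add: add.commute)
      show "Ind_act K_one (xm t) ?v = ?v" if "t \<in> pZ (2 * int m)" for t
        using v_x[OF Iw_subset_K_one, of t] that m by simp
      show "Ind_act K_one (k ** k') \<phi> = Ind_act K_one k (Ind_act K_one k' \<phi>)" if "k \<in> K_one" "k' \<in> K_one" for k k' \<phi>
        using K_one_mult that(1) by (intro Ind_act_mult) blast
    qed (use l in \<open>auto intro: sc linear_Ind_act rep v_h[OF Iw_subset_K_one] K_one_mult K_one_adj2\<close>)
    have l1: "l + 1 \<ge> 1" by simp
    show ?thesis
      unfolding f ch R lm(1)
      using V_op_eq_T_op[OF refl l1 _ x, of \<delta>] Y_op_eq_0[OF refl l1 lam 0[OF Iw_subset_K_one] x] by blast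
  next
    case False
    then obtain m where m: "l = 2 * m + 1" by (elim oddE)
    then have lm: "2 * l + 1 = 2 * m + (l + 1 + 1)" "(l - 1) div 2 = m" by simp_all
    have R: "(rho_ram l :: 'p mat2 \<Rightarrow> ('p mat2 \<Rightarrow> 'w) \<Rightarrow> _) = Ind_act K_zero" using False by (simp add: rho_ram_def ram_K_def fun_eq_iff)
    have f: "f_ram scW s1 l = f_vec ?sc K_one (genuine_lift ?sc s1 (alpha_conj (Ind_act K_zero))) m"
      using False lm(2) R by (simp add: f_ram_def)
    have ind: "induced_vector \<eta> s0 ?sc K_one s1 (alpha_conj (Ind_act K_zero)) m (2 * m + (l + 1 + 1)) legendre_p ?v"
    proof (rule induced_vector_alpha_conj[OF s1 _ sc])
      show "Ind_act K_zero (k ** k') \<phi> = Ind_act K_zero k (Ind_act K_zero k' \<phi>)" if "k \<in> K_zero" for k k' \<phi>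
        using that by (intro Ind_act_mult) (simp add: K_zero_eq)
      show "Ind_act K_zero (ym t) ?v = ?v" if "t \<in> pZ (int (l + 1))" for t
        using v_y[OF Iw_subset_K_zero, of t] that by (simp add: add.commute)
      show "Ind_act K_zero (xm t) ?v = ?v" if "t \<in> pZ (2 * int m + 1)" for t
        using v_x[OF Iw_subset_K_zero, of t] that m by (simp add: add.commute)
    qed (use rep(1) v_h[OF Iw_subset_K_zero] in \<open>auto intro: linear_Ind_act\<close>)
    have l1: "l + 1 \<ge> 1" by simp
    show ?thesis
      unfolding f ch R lm(1) using operators_alpha_conj[OF ind l1 lam 0[OF Iw_subset_K_zero] x] by blast
  qed
  then show "\<delta> \<in> Zp_units \<Longrightarrow> V_op (fun_scale scW) \<eta> (2 * l + 1) \<delta> (f_ram scW s1 l (phi_vec \<sigma> w)) x =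
      f_ram scW s1 l (T_op (fun_scale scW) (eta_ram \<eta>) (rho_ram l) (l + 1) \<delta> (phi_vec \<sigma> w)) x"
    "Y_op (fun_scale scW) \<eta> (2 * l + 1) lam (f_ram scW s1 l (phi_vec \<sigma> w)) x = 0" by blast+
qed

end

theorem proposition4p14:
  fixes \<eta> :: "'p::prime_card qp \<Rightarrow> complex"
    and lam :: "'p qp"
    and l :: nat
    and s0 s1 :: "'p mat2 \<Rightarrow> int"
    and scV :: "complex \<Rightarrow> 'v::ab_group_add \<Rightarrow> 'v"
    and scW :: "complex \<Rightarrow> 'w::ab_group_add \<Rightarrow> 'w"
    and \<tau> :: "'p mat2 \<Rightarrow> 'v \<Rightarrow> 'v"
    and \<rho> \<sigma> :: "'p mat2 \<Rightarrow> 'w \<Rightarrow> 'w"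
    and w :: 'w
  assumes p_odd: "odd CARD('p)"
    and eta: "\<eta> = (\<lambda>_. 1) \<or> \<eta> = (\<lambda>u. of_int (legendre_p u))"
    and lam: "lam \<in> Zp_units" "\<not> (\<exists>x\<in>Zp. lam - x\<^sup>2 \<in> pZ 1)"
    and l: "l \<ge> 1"
    and s0: "is_s_zero s0"
    and s1: "is_s_one s1"
  shows
    "(unram_datum l scV \<tau> \<and> is_constituent scV \<tau> K_zero scW \<rho> \<and>
       w \<in> eigen_U scW (eta_unram \<eta> l) \<rho> \<longrightarrow>
     (\<forall>\<delta>\<in>{1, lam}. \<forall>g\<in>carrier Mp.
        V_op scW \<eta> (2 * l) \<delta> (f_unram scW s0 s1 l \<rho> w) g =
        f_unram scW s0 s1 l \<rho> (T_op scW (eta_unram \<eta> l) \<rho> l \<delta> w) g) \<and>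
     (\<forall>g\<in>carrier Mp. Y_op scW \<eta> (2 * l) lam (f_unram scW s0 s1 l \<rho> w) g = 0)) \<and>
    (ram_datum l scV \<tau> \<and> is_constituent scV \<tau> Iw scW \<sigma> \<and>
       w \<in> eigen_U scW (eta_ram \<eta>) \<sigma> \<longrightarrow>
     (\<forall>\<delta>\<in>{1, lam}. \<forall>g\<in>carrier Mp.
        V_op (fun_scale scW) \<eta> (2 * l + 1) \<delta> (f_ram scW s1 l (phi_vec \<sigma> w)) g =
        f_ram scW s1 l (T_op (fun_scale scW) (eta_ram \<eta>) (rho_ram l) (l + 1) \<delta> (phi_vec \<sigma> w)) g) \<and>
     (\<forall>g\<in>carrier Mp. Y_op (fun_scale scW) \<eta> (2 * l + 1) lam (f_ram scW s1 l (phi_vec \<sigma> w)) g = 0))"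
proof -
  interpret eta_setting "TYPE('p)" \<eta> s0 by unfold_locales (fact p_odd eta s0)+
  have \<delta>: "\<delta> \<in> Zp_units" if "\<delta> \<in> {1, lam}" for \<delta> using that lam(1) by auto
  show ?thesis
    by (intro conjI impI ballI; elim conjE;
      intro unram_operators[OF s1 lam l] ram_operators[OF s1 lam l]; (assumption | erule \<delta>)?)
qed

end
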